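(* Let $x$ be an abstract vector variable. For every finite set $Y=\{y_1,\dots,y_N\}$ of further abstract vector variables and every $k\ge0$, the determinant $D^Y_k=\det\mathcal K^Y_k$ is not the zero element of $\mathbb T_Y=\mathbb B[c_{ij}:1\le i\le j\le N]$.
   Context: **Radial algebra.** For a set $S$ of abstract vector variables, $R(S)$ is the associative unital $\mathbb R$-algebra generated by $S$ subject to $[\{u,v\},w]=0$ for all $u,v,w\in S$, where $\{a,b\}=ab+ba$, $[a,b]=ab-ba$. The wedge is the antisymmetrized product $u_1\wedge\cdots\wedge u_p=\frac1{p!}\sum_{\pi}\operatorname{sgn}(\pi)u_{\pi(1)}\cdots u_{\pi(p)}$ (empty wedge $=1$). **Coefficients.** $q,Q$ are algebraically independent indeterminates, $\mathbb B=\mathbb R[q,q^{-1},Q,(1-q)^{-1}]$, $R_{\mathbb B}(S)=\mathbb B\otimes_{\mathbb R}R(S)$. For integers $n,a$: $[n]_q=\frac{1-q^n}{1-q}$, $q^{m+a}:=Qq^a$, $[m+a]_q:=\frac{1-Qq^a}{1-q}$ ($m$ is only a formal symbol). **Scalars.** $r=x^2$, $s_i=\{x,y_i\}$, $c_{ij}=\{y_i,y_j\}=c_{ji}$ are central and $\mathcal A_x(Y)=\mathbb B[r,s_1,\dots,s_N,c_{ij}:1\le i\le j\le N]$ is a polynomial algebra. For $I=\{i_1<\cdots<i_p\}\subset\{1,\dots,N\}$, $y_I=y_{i_1}\wedge\cdots\wedge y_{i_p}$, $y_\varnothing=1$. It is known that $R_{\mathbb B}(\{x\}\cup Y)=\bigoplus_I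 y_I\mathcal A_x(Y)\oplus\bigoplus_I(x\wedge y_I)\mathcal A_x(Y)$, free over $\mathcal A_x(Y)$ on the elements $y_I,\ x\wedge y_I$. **Jackson operators.** For a scalar variable $u$ and parameter $P$: $\delta^{(u)}_Pf=\frac{f(u)-f(Pu)}{(1-P)u}$, $T^{(u)}_Pf(u)=f(Pu)$. For $A\in\mathcal A_x(Y)$, $$\partial^{\mathrm{sc},Y}_{x,q}A=(1+q)\,x\,\delta^{(r)}_{q^2}A+2\sum_{i=1}^N y_i\,T^{(r)}_{q^2}\delta^{(s_i)}_qA.$$ **Finite relative right $q$-vector derivative.** $\partial^{Y,\mathrm R}_{x,q}$ is the $\mathbb B$-linear operator on $R_{\mathbb B}(\{x\}\cup Y)$ with, for $p=|I|$ and $A,B\in\mathcal A_x(Y)$, $$\partial^{Y,\mathrm R}_{x,q}(y_IA)=y_I\,\partial^{\mathrm{sc},Y}_{x,q}(A),\qquad \partial^{Y,\mathrm R}_{x,q}((x\wedge y_I)B)=(-1)^p[m-p]_q\,y_IB+q^{m-p}(x\wedge y_I)\,\partial^{\mathrm{sc},Y}_{x,q}(B).$$ **Homogeneous blocks.** The $x$-degree is $\deg_xr=2$, $\deg_xs_i=1$, $\deg_xc_{ij}=0$, $\deg_xy_I=0$, $\deg_x(x\wedge y_I)=1$. $H^Y_n$ is the degree-$n$ component, a finite free $\mathbb T_Y$-module with basis $y_Ir^as^\beta$ ($2a+|\beta|=n$) and $(x\wedge y_I)r^as^\beta$ ($1+2a+|\beta|=n$). With $R_xF=Fx$ one has $R_xH^Y_n\subseteq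 H^Y_{n+1}$, $\partial^{Y,\mathrm R}_{x,q}H^Y_{n+1}\subseteq H^Y_n$, both $\mathbb T_Y$-linear. $\mathcal K^Y_k:=\partial^{Y,\mathrm R}_{x,q}R_x|_{H^Y_k}:H^Y_k\to H^Y_k$. *)

theory Defs
  imports
    "HOL-Library.Poly_Mapping"
    "HOL-Computational_Algebra.Fraction_Field"
    "HOL-Computational_Algebra.Polynomial"
    "HOL-Combinatorics.Permutations"
    "Jordan_Normal_Form.Determinant"
begin

section \<open>The coefficient ring\<close>

text \<open>The ambient field \<open>\<real>(q,Q)\<close> is the fraction field of \<open>\<real>[q][Q]\<close>.\<close>

definition fld_real :: "real \<Rightarrow> real poly poly fract" where
  "fld_real c = Fract [:[:c:]:] 1"

definition fld_q :: "real poly poly fract" where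
  "fld_q = Fract [:[:0, 1:]:] 1"

definition fld_Q :: "real poly poly fract" where
  "fld_Q = Fract [:0, 1:] 1"

text \<open>The subring \<open>\<real>[q, q\<inverse>, Q, (1 - q)\<inverse>]\<close>; additive inverses come from multiplication
  with the constant \<open>-1\<close>.\<close>

inductive_set coeff_ring :: "real poly poly fract set" where
  real: "fld_real c \<in> coeff_ring"
| q: "fld_q \<in> coeff_ring"
| q_inv: "inverse fld_q \<in> coeff_ring"
| Q: "fld_Q \<in> coeff_ring"
| one_minus_q_inv: "inverse (1 - fld_q) \<in> coeff_ring"
| add: "a \<in> coeff_ring \<Longrightarrow> b \<in> coeff_ring \<Longrightarrow> a + b \<in> coeff_ring"
| mult: "a \<in> coeff_ring \<Longrightarrow> b \<in> coeff_ring \<Longrightarrow> a * b \<in> coeff_ring"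

lemma fld_real_0: "fld_real 0 = 0"
  by (simp add: fld_real_def Zero_fract_def)

lemma fld_real_1: "fld_real 1 = 1"
  by (simp add: fld_real_def One_fract_def flip: one_pCons)

lemma fld_real_minus_1: "fld_real (-1) = -1"
proof -
  have "fld_real (-1) = - fld_real 1"
    by (simp add: fld_real_def)
  then show ?thesis
    by (simp add: fld_real_1)
qed

lemma coeff_ring_0: "0 \<in> coeff_ring"
  using coeff_ring.real[of 0] by (simp add: fld_real_0)

lemma coeff_ring_1: "1 \<in> coeff_ring"
  using coeff_ring.real[of 1] by (simp add: fld_real_1)

lemma coeff_ring_uminus: "a \<in> coeff_ring \<Longrightarrow> - a \<in> coeff_ring"
  using coeff_ring.mult[OF coeff_ring.real[of "-1"], of a] by (simp add: fld_real_minus_1)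

lemma coeff_ring_diff: "a \<in> coeff_ring \<Longrightarrow> b \<in> coeff_ring \<Longrightarrow> a - b \<in> coeff_ring"
  using coeff_ring.add[OF _ coeff_ring_uminus, of a b] by simp

lemma coeff_ring_power: "a \<in> coeff_ring \<Longrightarrow> a ^ n \<in> coeff_ring"
  by (induction n) (auto intro: coeff_ring_1 coeff_ring.mult)

lemma coeff_ring_q_powi: "fld_q powi a \<in> coeff_ring"
  by (auto simp: power_int_def intro!: coeff_ring_power coeff_ring.q coeff_ring.q_inv)

typedef qcoeff = coeff_ring
  using coeff_ring_0 by blast

setup_lifting type_definition_qcoeff

instantiation qcoeff :: idom
begin

lift_definition zero_qcoeff :: qcoeff is 0 by (rule coeff_ring_0)
lift_definition one_qcoeff :: qcoeff is 1 by (rule coeff_ring_1)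
lift_definition plus_qcoeff :: "qcoeff \<Rightarrow> qcoeff \<Rightarrow> qcoeff" is "(+)" by (rule coeff_ring.add)
lift_definition minus_qcoeff :: "qcoeff \<Rightarrow> qcoeff \<Rightarrow> qcoeff" is "(-)" by (rule coeff_ring_diff)
lift_definition uminus_qcoeff :: "qcoeff \<Rightarrow> qcoeff" is uminus by (rule coeff_ring_uminus)
lift_definition times_qcoeff :: "qcoeff \<Rightarrow> qcoeff \<Rightarrow> qcoeff" is "(*)" by (rule coeff_ring.mult)

instance
  by (standard; transfer) (auto simp: algebra_simps)

end

lift_definition coeff_real :: "real \<Rightarrow> qcoeff" is fld_real by (rule coeff_ring.real)
lift_definition coeff_q :: qcoeff is fld_q by (rule coeff_ring.q)

text \<open>\<open>q_m_plus a\<close> is \<open>q\<^sup>m\<^sup>+\<^sup>a = Q q\<^sup>a\<close> and \<open>bracket_m_plus a\<close> is \<open>[m + a]\<^sub>q = (1 - Q q\<^sup>a) / (1 - q)\<close>;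
  \<open>m\<close> is only a formal symbol.\<close>

lift_definition q_m_plus :: "int \<Rightarrow> qcoeff" is "\<lambda>a. fld_Q * fld_q powi a"
  by (intro coeff_ring.mult coeff_ring.Q coeff_ring_q_powi)

lift_definition bracket_m_plus :: "int \<Rightarrow> qcoeff" is "\<lambda>a. (1 - fld_Q * fld_q powi a) / (1 - fld_q)"
  unfolding divide_inverse
  by (intro coeff_ring.mult coeff_ring_diff coeff_ring_1 coeff_ring.Q coeff_ring_q_powi
      coeff_ring.one_minus_q_inv)


section \<open>The radial algebra\<close>

text \<open>The free algebra over \<open>'k\<close> on the set of all elements of \<open>'v\<close> is the monoid algebra of the
  free monoid on \<open>'v\<close>.\<close>

datatype 'v free_word = Free_Word (letters: "'v list")

instantiation free_word :: (type) monoid_add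
begin

definition zero_free_word :: "'a free_word" where "0 = Free_Word []"

definition plus_free_word :: "'a free_word \<Rightarrow> 'a free_word \<Rightarrow> 'a free_word" where
  "a + b = Free_Word (letters a @ letters b)"

instance
  by standard (auto simp: zero_free_word_def plus_free_word_def)

end

type_synonym ('v, 'k) free_alg = "'v free_word \<Rightarrow>\<^sub>0 'k"

definition free_gen :: "'v \<Rightarrow> ('v, 'k::comm_ring_1) free_alg" where
  "free_gen v = Poly_Mapping.single (Free_Word [v]) 1"

definition acomm :: "'a::ring \<Rightarrow> 'a \<Rightarrow> 'a" where
  "acomm a b = a * b + b * a"

definition commutator :: "'a::ring \<Rightarrow> 'a \<Rightarrow> 'a" where
  "commutator a b = a * b - b * a"

inductive_set radial_ideal :: "('v, 'k::comm_ring_1) free_alg set" where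
  zero: "0 \<in> radial_ideal"
| add: "f \<in> radial_ideal \<Longrightarrow> g \<in> radial_ideal \<Longrightarrow> f + g \<in> radial_ideal"
| gen: "f * commutator (acomm (free_gen u) (free_gen v)) (free_gen w) * g \<in> radial_ideal"

lemma radial_ideal_mult_left: "g \<in> radial_ideal \<Longrightarrow> f * g \<in> radial_ideal"
proof (induction rule: radial_ideal.induct)
  case (gen a u v w b)
  then show ?case
    using radial_ideal.gen[of "f * a" u v w b] by (simp add: mult.assoc)
qed (auto simp: distrib_left intro: radial_ideal.intros)

lemma radial_ideal_mult_right: "g \<in> radial_ideal \<Longrightarrow> g * f \<in> radial_ideal"
proof (induction rule: radial_ideal.induct)
  case (gen a u v w b)
  then show ?case
    using radial_ideal.gen[of a u v w "b * f"] by (simp add: mult.assoc)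
qed (auto simp: distrib_right intro: radial_ideal.intros)

lemma radial_ideal_uminus: "g \<in> radial_ideal \<Longrightarrow> - g \<in> radial_ideal"
  using radial_ideal_mult_left[of g "-1"] by simp

lemma lookup_mult_empty_word:
  fixes f g :: "('v, 'k::comm_ring_1) free_alg"
  shows "Poly_Mapping.lookup (f * g) 0 = Poly_Mapping.lookup f 0 * Poly_Mapping.lookup g 0"
proof -
  have split: "(0 = k + l) \<longleftrightarrow> (k = 0 \<and> l = 0)" for k l :: "'v free_word"
    by (cases k; cases l) (auto simp: zero_free_word_def plus_free_word_def)
  have "Poly_Mapping.lookup (f * g) 0 =
      Sum_any (\<lambda>k. Poly_Mapping.lookup f k * Sum_any (\<lambda>l. Poly_Mapping.lookup g l when k = 0 \<and> l = 0))"
    by (simp add: lookup_mult split)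
  also have "\<dots> = Sum_any (\<lambda>k. Poly_Mapping.lookup f k * Poly_Mapping.lookup g 0 when k = 0)"
    by (intro Sum_any.cong) (auto simp: when_def)
  finally show ?thesis
    by simp
qed

lemma one_not_in_radial_ideal: "(1 :: ('v, 'k::comm_ring_1) free_alg) \<notin> radial_ideal"
proof -
  have "Poly_Mapping.lookup g 0 = 0" if "g \<in> radial_ideal" for g :: "('v, 'k) free_alg"
    using that
    by (induction rule: radial_ideal.induct)
       (auto simp: lookup_add lookup_mult_empty_word lookup_minus commutator_def acomm_def mult.commute)
  then show ?thesis
    by fastforce
qed

definition radial_rel :: "('v, 'k::comm_ring_1) free_alg \<Rightarrow> ('v, 'k) free_alg \<Rightarrow> bool" where
  "radial_rel f g \<longleftrightarrow> f - g \<in> radial_ideal"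

lemma equivp_radial_rel: "equivp (radial_rel :: ('v, 'k::comm_ring_1) free_alg \<Rightarrow> _)"
proof (rule equivpI)
  show "reflp (radial_rel :: ('v, 'k) free_alg \<Rightarrow> _)"
    by (auto simp: reflp_def radial_rel_def intro: radial_ideal.zero)
  show "symp (radial_rel :: ('v, 'k) free_alg \<Rightarrow> _)"
    unfolding symp_def radial_rel_def by (metis radial_ideal_uminus minus_diff_eq)
  show "transp (radial_rel :: ('v, 'k) free_alg \<Rightarrow> _)"
  proof (rule transpI)
    fix f g h :: "('v, 'k) free_alg"
    assume "radial_rel f g" "radial_rel g h"
    then have "(f - g) + (g - h) \<in> radial_ideal"
      unfolding radial_rel_def by (rule radial_ideal.add)
    then show "radial_rel f h"
      by (simp add: radial_rel_def)
  qed
qed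

text \<open>\<open>('v, 'k) radial\<close> is the radial algebra with coefficients \<open>'k\<close> on the set of vector variables
  \<open>UNIV :: 'v set\<close>: the associative unital \<open>'k\<close>-algebra on these generators with relations
  \<open>[{u,v},w] = 0\<close>. For \<open>'k = real\<close> it is \<open>R(S)\<close>, and for \<open>'k = qcoeff\<close> it is the scalar extension
  \<open>\<bbbB> \<otimes> R(S)\<close>, which has the same presentation over \<open>\<bbbB>\<close>.\<close>

quotient_type (overloaded) ('v, 'k) radial = "('v, 'k::comm_ring_1) free_alg" / radial_rel
  by (rule equivp_radial_rel)

instantiation radial :: (type, comm_ring_1) ring_1
begin

lift_definition zero_radial :: "('a, 'b) radial" is 0 .
lift_definition one_radial :: "('a, 'b) radial" is 1 .

lift_definition plus_radial :: "('a, 'b) radial \<Rightarrow> ('a, 'b) radial \<Rightarrow> ('a, 'b) radial" is "(+)"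
  unfolding radial_rel_def by (metis add_diff_add radial_ideal.add)

lift_definition uminus_radial :: "('a, 'b) radial \<Rightarrow> ('a, 'b) radial" is uminus
  unfolding radial_rel_def by (metis minus_diff_minus radial_ideal_uminus)

lift_definition minus_radial :: "('a, 'b) radial \<Rightarrow> ('a, 'b) radial \<Rightarrow> ('a, 'b) radial" is "(-)"
proof -
  fix f f' g g' :: "('a, 'b) free_alg"
  assume "radial_rel f f'" "radial_rel g g'"
  then have "(f - f') + - (g - g') \<in> radial_ideal"
    unfolding radial_rel_def by (intro radial_ideal.add radial_ideal_uminus)
  then show "radial_rel (f - g) (f' - g')"
    by (simp add: radial_rel_def algebra_simps)
qed

lift_definition times_radial :: "('a, 'b) radial \<Rightarrow> ('a, 'b) radial \<Rightarrow> ('a, 'b) radial" is "(*)"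
proof -
  fix f f' g g' :: "('a, 'b) free_alg"
  assume "radial_rel f f'" "radial_rel g g'"
  then have "(f - f') * g + f' * (g - g') \<in> radial_ideal"
    unfolding radial_rel_def
    by (intro radial_ideal.add radial_ideal_mult_left radial_ideal_mult_right)
  then show "radial_rel (f * g) (f' * g')"
    by (simp add: radial_rel_def algebra_simps)
qed

instance
proof
  show "(0 :: ('a, 'b) radial) \<noteq> 1"
    by transfer (metis diff_0 radial_ideal_uminus minus_minus one_not_in_radial_ideal radial_rel_def)
qed (transfer; simp add: radial_rel_def algebra_simps radial_ideal.zero)+

end

lift_definition vecvar :: "'v \<Rightarrow> ('v, 'k::comm_ring_1) radial" is free_gen .

lift_definition const :: "'k \<Rightarrow> ('v, 'k::comm_ring_1) radial" is "Poly_Mapping.single 0" .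

definition wedge :: "('v, qcoeff) radial list \<Rightarrow> ('v, qcoeff) radial" where
  "wedge us = const (coeff_real (1 / fact (length us))) *
     (\<Sum>\<pi> | \<pi> permutes {..<length us}.
        of_int (sign \<pi>) * prod_list (map (\<lambda>i. us ! \<pi> i) [0..<length us]))"


section \<open>Scalars\<close>

text \<open>In the following, \<open>x\<close> is a vector variable and the list \<open>ys\<close> enumerates the further vector
  variables \<open>y\<^sub>1, \<dots>, y\<^sub>N\<close>; the indices are shifted so as to start from \<open>0\<close>.\<close>

definition rad_r :: "'v \<Rightarrow> ('v, qcoeff) radial" where
  "rad_r x = vecvar x ^ 2"

definition rad_s :: "'v \<Rightarrow> 'v list \<Rightarrow> nat \<Rightarrow> ('v, qcoeff) radial" where
  "rad_s x ys i = acomm (vecvar x) (vecvar (ys ! i))"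

definition rad_c :: "'v list \<Rightarrow> nat \<Rightarrow> nat \<Rightarrow> ('v, qcoeff) radial" where
  "rad_c ys i j = acomm (vecvar (ys ! i)) (vecvar (ys ! j))"

definition y_wedge :: "'v list \<Rightarrow> nat set \<Rightarrow> ('v, qcoeff) radial" where
  "y_wedge ys I = wedge (map (\<lambda>i. vecvar (ys ! i)) (sorted_list_of_set I))"

definition xy_wedge :: "'v \<Rightarrow> 'v list \<Rightarrow> nat set \<Rightarrow> ('v, qcoeff) radial" where
  "xy_wedge x ys I = wedge (vecvar x # map (\<lambda>i. vecvar (ys ! i)) (sorted_list_of_set I))"

text \<open>Names of polynomial variables. The linear orders have no mathematical meaning; they give
  access to the library's \<open>idom\<close> instance for polynomials over these variables.\<close>

datatype cvar = C_Var nat nat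

datatype svar = R_Var | S_Var nat

instantiation cvar :: linorder
begin

definition less_eq_cvar :: "cvar \<Rightarrow> cvar \<Rightarrow> bool" where
  "u \<le> v \<longleftrightarrow> (case (u, v) of (C_Var i j, C_Var k l) \<Rightarrow> i < k \<or> i = k \<and> j \<le> l)"

definition less_cvar :: "cvar \<Rightarrow> cvar \<Rightarrow> bool" where
  "u < v \<longleftrightarrow> (case (u, v) of (C_Var i j, C_Var k l) \<Rightarrow> i < k \<or> i = k \<and> j < l)"

instance
  by standard (auto simp: less_eq_cvar_def less_cvar_def split: cvar.splits)

end

instantiation svar :: linorder
begin

definition less_eq_svar :: "svar \<Rightarrow> svar \<Rightarrow> bool" where
  "u \<le> v \<longleftrightarrow> (case (u, v) of (R_Var, _) \<Rightarrow> True | (S_Var i, S_Var j) \<Rightarrow> i \<le> j | _ \<Rightarrow> False)"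

definition less_svar :: "svar \<Rightarrow> svar \<Rightarrow> bool" where
  "u < v \<longleftrightarrow> (case (u, v) of (_, R_Var) \<Rightarrow> False | (R_Var, _) \<Rightarrow> True | (S_Var i, S_Var j) \<Rightarrow> i < j)"

instance
  by standard (auto simp: less_eq_svar_def less_svar_def split: svar.splits)

end

text \<open>\<open>T_poly\<close> and \<open>A_poly\<close> are polynomial rings over all variables \<open>c\<^sub>i\<^sub>j\<close> resp. \<open>r, s\<^sub>i, c\<^sub>i\<^sub>j\<close>, the latter
  written as polynomials in \<open>r, s\<^sub>i\<close> with coefficients in the former. The sets \<open>T_ring N\<close> and
  \<open>A_ring N\<close> single out \<open>\<bbbT>\<^sub>Y = \<bbbB>[c\<^sub>i\<^sub>j : i \<le> j]\<close> and \<open>\<A>\<^sub>x(Y) = \<bbbT>\<^sub>Y[r, s\<^sub>i]\<close> with indices below \<open>N\<close>.\<close>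

type_synonym T_poly = "(cvar \<Rightarrow>\<^sub>0 nat) \<Rightarrow>\<^sub>0 qcoeff"
type_synonym A_poly = "(svar \<Rightarrow>\<^sub>0 nat) \<Rightarrow>\<^sub>0 T_poly"

definition T_ring :: "nat \<Rightarrow> T_poly set" where
  "T_ring N = {t. \<forall>m \<in> Poly_Mapping.keys t. Poly_Mapping.keys m \<subseteq> {C_Var i j | i j. i \<le> j \<and> j < N}}"

definition A_ring :: "nat \<Rightarrow> A_poly set" where
  "A_ring N = {A. \<forall>m \<in> Poly_Mapping.keys A.
     Poly_Mapping.lookup A m \<in> T_ring N \<and> Poly_Mapping.keys m \<subseteq> insert R_Var (S_Var ` {..<N})}"

text \<open>Evaluation of these polynomials at \<open>x\<^sup>2\<close>, \<open>{x,y\<^sub>i}\<close> and \<open>{y\<^sub>i,y\<^sub>j}\<close>. These elements are central, but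
  the type of the radial algebra is not commutative, hence the lists as index sets of the products.\<close>

definition eval_T :: "'v list \<Rightarrow> T_poly \<Rightarrow> ('v, qcoeff) radial" where
  "eval_T ys t = (\<Sum>m \<in> Poly_Mapping.keys t. const (Poly_Mapping.lookup t m) *
     prod_list (map (\<lambda>(i, j). rad_c ys i j ^ Poly_Mapping.lookup m (C_Var i j))
       [(i, j). i \<leftarrow> [0..<length ys], j \<leftarrow> [i..<length ys]]))"

definition rs_monomial :: "'v \<Rightarrow> 'v list \<Rightarrow> nat \<Rightarrow> (nat \<Rightarrow> nat) \<Rightarrow> ('v, qcoeff) radial" where
  "rs_monomial x ys a \<beta> = rad_r x ^ a * prod_list (map (\<lambda>i. rad_s x ys i ^ \<beta> i) [0..<length ys])"

definition eval_A :: "'v \<Rightarrow> 'v list \<Rightarrow> A_poly \<Rightarrow> ('v, qcoeff) radial" where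
  "eval_A x ys A = (\<Sum>m \<in> Poly_Mapping.keys A. eval_T ys (Poly_Mapping.lookup A m) *
     rs_monomial x ys (Poly_Mapping.lookup m R_Var) (\<lambda>i. Poly_Mapping.lookup m (S_Var i)))"


section \<open>Jackson operators\<close>

definition A_const :: "qcoeff \<Rightarrow> A_poly" where
  "A_const b = Poly_Mapping.single 0 (Poly_Mapping.single 0 b)"

definition A_var :: "svar \<Rightarrow> A_poly" where
  "A_var u = Poly_Mapping.single (Poly_Mapping.single u 1) 1"

text \<open>The substitution \<open>u \<mapsto> P u\<close>.\<close>

definition dilation :: "svar \<Rightarrow> qcoeff \<Rightarrow> A_poly \<Rightarrow> A_poly" where
  "dilation u P = Poly_Mapping.mapp (\<lambda>m t. Poly_Mapping.single 0 (P ^ Poly_Mapping.lookup m u) * t)"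

text \<open>The quotient of \<open>f(u) - f(P u)\<close> by \<open>(1 - P) u\<close>; see \<open>jackson_eq\<close> below.\<close>

definition jackson :: "svar \<Rightarrow> qcoeff \<Rightarrow> A_poly \<Rightarrow> A_poly" where
  "jackson u P f = (THE g. A_const (1 - P) * A_var u * g = f - dilation u P f)"

lemma lookup_dilation:
  "Poly_Mapping.lookup (dilation u P f) m =
     Poly_Mapping.single 0 (P ^ Poly_Mapping.lookup m u) * Poly_Mapping.lookup f m"
  by (auto simp: dilation_def lookup_mapp when_def in_keys_iff)

lemma dilation_add: "dilation u P (f + g) = dilation u P f + dilation u P g"
  by (rule poly_mapping_eqI) (simp add: lookup_dilation lookup_add distrib_left)

lemma dilation_single:
  "dilation u P (Poly_Mapping.single m t) =
     Poly_Mapping.single m (Poly_Mapping.single 0 (P ^ Poly_Mapping.lookup m u) * t)"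
  by (rule poly_mapping_eqI)
     (auto simp: lookup_dilation lookup_single when_def)

lemma single_eq_0_iff: "Poly_Mapping.single k b = 0 \<longleftrightarrow> b = 0"
  by (metis lookup_single_eq lookup_zero single_zero)

lemma jackson_eq:
  assumes "P \<noteq> 1"
  shows "A_const (1 - P) * A_var u * jackson u P f = f - dilation u P f"
proof -
  let ?d = "A_const (1 - P) * A_var u"
  have "A_const (1 - P) \<noteq> 0" "A_var u \<noteq> 0"
    using assms by (simp_all add: A_const_def A_var_def single_eq_0_iff)
  then have nz: "?d \<noteq> 0"
    by simp
  have "\<exists>g. ?d * g = f - dilation u P f"
  proof (induction f rule: update_induct)
    case const
    show ?case
      by (intro exI[of _ 0]) (simp add: dilation_def poly_mapping_eq_iff fun_eq_iff lookup_mapp)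
  next
    case (update f m t)
    have upd: "Poly_Mapping.update m t f = f + Poly_Mapping.single m t"
      using update.hyps(1)
      by (intro poly_mapping_eqI) (auto simp: lookup_update lookup_add lookup_single when_def in_keys_iff)
    have "\<exists>g. ?d * g = Poly_Mapping.single m t - dilation u P (Poly_Mapping.single m t)"
    proof (cases "Poly_Mapping.lookup m u")
      case 0
      then show ?thesis
        by (intro exI[of _ 0]) (simp add: dilation_single)
    next
      case (Suc n)
      define m' where "m' = m - Poly_Mapping.single u 1"
      have m: "m = Poly_Mapping.single u 1 + m'"
        using Suc by (intro poly_mapping_eqI) (auto simp: m'_def lookup_add lookup_minus lookup_single when_def)
      define c where "c = (\<Sum>i<Suc n. P ^ i)"
      have geo: "(1 - P) * c = 1 - P ^ Suc n"
        unfolding c_def by (rule one_diff_power_eq[symmetric])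
      have "?d * Poly_Mapping.single m' (Poly_Mapping.single 0 c * t) =
          Poly_Mapping.single m (Poly_Mapping.single 0 ((1 - P) * c) * t)"
        by (simp add: A_const_def A_var_def mult_single m mult.assoc[symmetric])
      also have "\<dots> = Poly_Mapping.single m (Poly_Mapping.single 0 (1 - P ^ Suc n) * t)"
        by (simp only: geo)
      also have "\<dots> = Poly_Mapping.single m t - dilation u P (Poly_Mapping.single m t)"
        by (simp only: dilation_single Suc single_diff left_diff_distrib single_one mult_1_left)
      finally show ?thesis ..
    qed
    then obtain a b where "?d * a = f - dilation u P f"
      "?d * b = Poly_Mapping.single m t - dilation u P (Poly_Mapping.single m t)"
      using update.IH by blast
    then have "?d * (a + b) = Poly_Mapping.update m t f - dilation u P (Poly_Mapping.update m t f)"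
      by (simp add: upd dilation_add distrib_left)
    then show ?case ..
  qed
  then have "\<exists>!g. ?d * g = f - dilation u P f"
    using nz by (metis mult_left_cancel)
  then show ?thesis
    unfolding jackson_def by (rule theI')
qed


section \<open>The finite relative right \<open>q\<close>-vector derivative\<close>

definition deriv_sc :: "'v \<Rightarrow> 'v list \<Rightarrow> A_poly \<Rightarrow> ('v, qcoeff) radial" where
  "deriv_sc x ys A =
     const (1 + coeff_q) * vecvar x * eval_A x ys (jackson R_Var (coeff_q ^ 2) A) +
     2 * (\<Sum>i < length ys. vecvar (ys ! i) *
            eval_A x ys (dilation R_Var (coeff_q ^ 2) (jackson (S_Var i) coeff_q A)))"

definition is_right_deriv ::
  "'v \<Rightarrow> 'v list \<Rightarrow> (('v, qcoeff) radial \<Rightarrow> ('v, qcoeff) radial) \<Rightarrow> bool" where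
  "is_right_deriv x ys D \<longleftrightarrow>
     (\<forall>F G. D (F + G) = D F + D G) \<and>
     (\<forall>b F. D (const b * F) = const b * D F) \<and>
     (\<forall>I A. I \<subseteq> {..<length ys} \<longrightarrow> A \<in> A_ring (length ys) \<longrightarrow>
        D (y_wedge ys I * eval_A x ys A) = y_wedge ys I * deriv_sc x ys A) \<and>
     (\<forall>I B. I \<subseteq> {..<length ys} \<longrightarrow> B \<in> A_ring (length ys) \<longrightarrow>
        D (xy_wedge x ys I * eval_A x ys B) =
          (-1) ^ card I * const (bracket_m_plus (- int (card I))) * y_wedge ys I * eval_A x ys B +
          const (q_m_plus (- int (card I))) * xy_wedge x ys I * deriv_sc x ys B)"

text \<open>If \<open>x\<close> and \<open>ys\<close> are all the vector variables, without repetition, then the radial algebra is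
  free over \<open>\<A>\<^sub>x(Y)\<close> on the elements \<open>y_wedge ys I\<close> and \<open>xy_wedge x ys I\<close>, and hence there is exactly
  one such operator.\<close>

definition right_deriv :: "'v \<Rightarrow> 'v list \<Rightarrow> ('v, qcoeff) radial \<Rightarrow> ('v, qcoeff) radial" where
  "right_deriv x ys = (THE D. is_right_deriv x ys D)"


section \<open>Homogeneous blocks\<close>

definition block_basis :: "'v \<Rightarrow> 'v list \<Rightarrow> nat \<Rightarrow> ('v, qcoeff) radial set" where
  "block_basis x ys n =
     {y_wedge ys I * rs_monomial x ys a \<beta> | I a \<beta>.
        I \<subseteq> {..<length ys} \<and> 2 * a + (\<Sum>i < length ys. \<beta> i) = n} \<union>
     {xy_wedge x ys I * rs_monomial x ys a \<beta> | I a \<beta>.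
        I \<subseteq> {..<length ys} \<and> 1 + 2 * a + (\<Sum>i < length ys. \<beta> i) = n}"

text \<open>The matrix of a \<open>\<bbbT>\<^sub>Y\<close>-linear endomorphism of the free \<open>\<bbbT>\<^sub>Y\<close>-module with ordered basis \<open>es\<close>.\<close>

definition matrix_wrt ::
  "'v list \<Rightarrow> ('v, qcoeff) radial list \<Rightarrow> (('v, qcoeff) radial \<Rightarrow> ('v, qcoeff) radial) \<Rightarrow> T_poly mat"
where
  "matrix_wrt ys es f = (THE M. M \<in> carrier_mat (length es) (length es) \<and>
     (\<forall>i < length es. \<forall>j < length es. M $$ (i, j) \<in> T_ring (length ys)) \<and>
     (\<forall>j < length es. f (es ! j) = (\<Sum>i < length es. es ! i * eval_T ys (M $$ (i, j)))))"

text \<open>The determinant of an endomorphism does not depend on the enumeration of the basis.\<close>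

definition endo_det ::
  "'v list \<Rightarrow> ('v, qcoeff) radial set \<Rightarrow> (('v, qcoeff) radial \<Rightarrow> ('v, qcoeff) radial) \<Rightarrow> T_poly"
where
  "endo_det ys E f = det (matrix_wrt ys (SOME es. distinct es \<and> set es = E) f)"

definition block_op :: "'v \<Rightarrow> 'v list \<Rightarrow> ('v, qcoeff) radial \<Rightarrow> ('v, qcoeff) radial" where
  "block_op x ys F = right_deriv x ys (F * vecvar x)"

definition block_det :: "'v \<Rightarrow> 'v list \<Rightarrow> nat \<Rightarrow> T_poly" where
  "block_det x ys k = endo_det ys (block_basis x ys k) (block_op x ys)"

end

theory Submission
  imports Defs
begin

text \<open>The radial algebra acts faithfully on a free module over \<open>\<A>\<^sub>x(Y)\<close> whose basis is indexed by the
  sets of vector variables: a vector acts by a creation operator plus contractions with all vectors.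
  This identifies the radial algebra with that module, so the block matrices can be read off from
  explicit operators.

  The determinant is shown to be nonzero after the specialisation \<open>c\<^sub>i\<^sub>j = 0\<close>, \<open>Q = 0\<close>, followed by the
  limit \<open>q \<rightarrow> 0\<close> through positive reals. (The limit is needed because \<open>q\<close> is invertible in \<open>\<bbbB>\<close>; after
  \<open>Q = 0\<close> no negative power of \<open>q\<close> is left.) There the Jackson derivatives become shifts
  \<open>u\<^sup>n \<mapsto> u\<^sup>n\<^sup>-\<^sup>1\<close>, and up to a triangular part the operator becomes \<open>1 + D\<iota>\<close> on
  \<open>\<Lambda>(y) \<otimes> \<real>[s]\<close>, with the Koszul contraction \<open>\<iota> = \<Sum> s\<^sub>j \<partial>/\<partial>y\<^sub>j\<close> and the shift version
  \<open>D = \<Sum> y\<^sub>i d\<^sub>i\<close> of the de Rham differential. As \<open>\<iota>\<^sup>2 = 0\<close> and \<open>\<iota>D + D\<iota>\<close> is diagonal with nonnegative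
  entries, \<open>1 + D\<iota>\<close> is injective.\<close>

text \<open>\<open>right_deriv\<close> and \<open>matrix_wrt\<close> are definite descriptions, so
  nothing can be computed before existence and uniqueness are proved, that is, before the radial
  algebra is known to be free over its scalars. The model supplies both halves:
  \<open>expand\<close> shows that the wedges span, \<open>coord\<close> that they are independent.
  The model operators are written over an arbitrary commutative ring, with all parameters as
  arguments, so that one formula serves \<open>T_poly\<close> and the real specialisation.

  Each specialisation removes one obstruction. At Q = 0 all q^(m-p) vanish and all [m-p] become
  1/(1-q), so of the derivative of (x \<and> y_I) B only the contraction term survives. As q tends
  to 0, the dilation of r becomes the projection to r^0 and all positive q-integers become 1. At
  c_ij = 0, right multiplication by y_i keeps only creation and the contraction with x. What remains
  is the identity plus terms that see only the part without x, and only the r^0 component of that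
  part feeds back into it. Injectivity is therefore proved first at r^0, then for all powers of r,
  and last for the part containing x.\<close>

abbreviation (input) lookup :: "('a \<Rightarrow>\<^sub>0 'b::zero) \<Rightarrow> 'a \<Rightarrow> 'b" where
  "lookup \<equiv> Poly_Mapping.lookup"

abbreviation (input) single :: "'a \<Rightarrow> 'b \<Rightarrow> 'a \<Rightarrow>\<^sub>0 'b::zero" where
  "single \<equiv> Poly_Mapping.single"

section \<open>Antisymmetrised products\<close>

text \<open>A permutation of m + 1 points is determined by the image b of m and a permutation of the
  first m points.\<close>

lemma sum_permutes_Suc:
  "(\<Sum>p | p permutes {..<Suc m}. F p) =
     (\<Sum>b<Suc m. \<Sum>p | p permutes {..<m}. F (transpose m b \<circ> p))"
  unfolding lessThan_Suc by (rule sum_over_permutations_insert) auto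

text \<open>The wedge without the factor 1/n!, so that it makes sense in every ring.\<close>

definition alt_sum :: "nat \<Rightarrow> (nat \<Rightarrow> 'a::ring_1) \<Rightarrow> 'a" where
  "alt_sum n f = (\<Sum>p | p permutes {..<n}. of_int (sign p) * prod_list (map (\<lambda>i. f (p i)) [0..<n]))"

lemma alt_sum_0 [simp]: "alt_sum 0 f = 1"
  by (simp add: alt_sum_def)

lemma alt_sum_cong:
  assumes "\<And>i. i < n \<Longrightarrow> f i = g i"
  shows "alt_sum n f = alt_sum n g"
proof -
  have "map (\<lambda>i. f (p i)) [0..<n] = map (\<lambda>i. g (p i)) [0..<n]" if "p permutes {..<n}" for p
    using assms permutes_in_image[OF that] by auto
  then show ?thesis
    unfolding alt_sum_def by (intro sum.cong refl arg_cong2[where f = times] arg_cong[where f = prod_list]) auto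
qed

lemma alt_sum_permute:
  assumes s: "s permutes {..<n}"
  shows "alt_sum n (f \<circ> s) = of_int (sign s) * alt_sum n f"
proof -
  have "of_int (sign s) * alt_sum n f =
      (\<Sum>p | p permutes {..<n}. of_int (sign s * sign p) * prod_list (map (\<lambda>i. f (p i)) [0..<n]))"
    by (simp add: alt_sum_def sum_distrib_left mult.assoc)
  also have "\<dots> = (\<Sum>p | p permutes {..<n}. of_int (sign s * sign (s \<circ> p)) *
      prod_list (map (\<lambda>i. f ((s \<circ> p) i)) [0..<n]))"
    by (rule setum_permutations_compose_left[OF s])
  also have "\<dots> = alt_sum n (f \<circ> s)"
    unfolding alt_sum_def
  proof (intro sum.cong refl)
    fix p assume "p \<in> {p. p permutes {..<n}}"
    then have "sign s * sign (s \<circ> p) = sign p"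
      using s by (simp add: sign_compose permutes_imp_permutation[of "{..<n}"] mult.assoc[symmetric])
    then show "of_int (sign s * sign (s \<circ> p)) * prod_list (map (\<lambda>i. f ((s \<circ> p) i)) [0..<n]) =
        of_int (sign p) * prod_list (map (\<lambda>i. (f \<circ> s) (p i)) [0..<n])"
      by simp
  qed
  finally show ?thesis ..
qed

lemma sign_transpose_comp:
  fixes m :: nat
  assumes "p permutes {..<m}"
  shows "sign (transpose a b \<circ> p) = sign (transpose a b) * sign p"
  using permutes_imp_permutation[OF finite_lessThan assms] by (intro sign_compose permutation_swap_id)

lemma permutes_lessThan_self:
  "p permutes {..<m} \<Longrightarrow> p m = (m::nat)"
  by (auto simp: permutes_def)

text \<open>Laplace expansion along the last factor, b being the index that ends there;
  \<open>f \<circ> transpose m b\<close> lists the remaining entries, with \<open>f m\<close> in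
  place of \<open>f b\<close>.\<close>

lemma alt_sum_Suc:
  "alt_sum (Suc m) f =
     (\<Sum>b<Suc m. of_int (sign (transpose m b)) * alt_sum m (f \<circ> transpose m b) * f b)"
proof -
  have "alt_sum (Suc m) f = (\<Sum>b<Suc m. \<Sum>p | p permutes {..<m}.
      of_int (sign (transpose m b)) * (of_int (sign p) *
        prod_list (map (\<lambda>i. (f \<circ> transpose m b) (p i)) [0..<m])) * f b)"
    unfolding alt_sum_def sum_permutes_Suc
    by (intro sum.cong refl) (auto simp: sign_transpose_comp permutes_lessThan_self mult.assoc)
  then show ?thesis
    by (simp add: alt_sum_def sum_distrib_left sum_distrib_right)
qed

text \<open>The contraction of v with each entry in turn, again without normalisation. Exchanging b
  with the last slot leaves the other entries in the first m - 1 slots.\<close>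

definition contr_sum :: "nat \<Rightarrow> (nat \<Rightarrow> 'a::ring_1) \<Rightarrow> 'a \<Rightarrow> 'a" where
  "contr_sum m f v = (\<Sum>b<m. of_int (sign (transpose (m - 1) b)) * acomm (f b) v *
     alt_sum (m - 1) (f \<circ> transpose (m - 1) b))"

text \<open>With the contracted entry always in the last slot, contractions become one sum over
  permutations, which can be reindexed by a transposition.\<close>

lemma contr_sum_Suc:
  "contr_sum (Suc m) f v = (\<Sum>p | p permutes {..<Suc m}. of_int (sign p) * acomm (f (p m)) v *
     prod_list (map (\<lambda>i. f (p i)) [0..<m]))"
proof -
  have "(\<Sum>p | p permutes {..<Suc m}. of_int (sign p) * acomm (f (p m)) v *
     prod_list (map (\<lambda>i. f (p i)) [0..<m])) = (\<Sum>b<Suc m. \<Sum>p | p permutes {..<m}.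
      of_int (sign (transpose m b)) * acomm (f b) v * (of_int (sign p) *
        prod_list (map (\<lambda>i. (f \<circ> transpose m b) (p i)) [0..<m])))"
    unfolding sum_permutes_Suc
    by (intro sum.cong refl)
       (auto simp: sign_transpose_comp permutes_lessThan_self mult.assoc,
         metis (no_types, lifting) mult.assoc mult_of_int_commute)
  then show ?thesis
    by (simp add: contr_sum_def alt_sum_def sum_distrib_left del: sum.lessThan_Suc)
qed

text \<open>The wedge product formula \<open>U v = U \<and> v + U \<bullet> v\<close>, multiplied out so that no division is needed.
  In the Laplace expansion of \<open>alt_sum (Suc n) (f(n := v))\<close> along the last factor, \<open>v\<close> is moved to the
  right end by the induction hypothesis; the double contractions (\<open>Y\<close>) collapse by antisymmetry.\<close>

lemma alt_sum_mult_right: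
  fixes f :: "nat \<Rightarrow> 'a::ring_1"
  assumes central: "\<And>u u' w. u \<in> V \<Longrightarrow> u' \<in> V \<Longrightarrow> acomm u u' * w = w * acomm u u'"
    and f: "range f \<subseteq> V" and v: "v \<in> V"
  shows "of_nat (2 * Suc n) * alt_sum n f * v =
     2 * alt_sum (Suc n) (f(n := v)) + of_nat (n * Suc n) * contr_sum n f v"
  using f
proof (induction n arbitrary: f)
  case 0
  then show ?case by (simp add: alt_sum_Suc)
next
  case (Suc m)
  let ?n = "Suc m"
  define s :: "nat \<Rightarrow> 'a" where "s b = of_int (sign (transpose m b))" for b
  define g where "g b = f \<circ> transpose m b" for b
  have fV: "f i \<in> V" for i
    using Suc.prems by auto
  have scom: "s b * w = w * s b" for b w
    by (simp add: s_def mult_of_int_commute)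
  have ss: "s b * (s b * w) = w" for b w
    by (simp add: s_def mult.assoc[symmetric] flip: of_int_mult)
  have IH: "2 * alt_sum ?n ((g b)(m := v)) =
      of_nat (2 * ?n) * alt_sum m (g b) * v - of_nat (m * ?n) * contr_sum m (g b) v" for b
    proof -
    have "range (g b) \<subseteq> V"
      using Suc.prems by (auto simp: g_def)
    from Suc.IH[OF this] show ?thesis
      by (simp add: eq_diff_eq del: fun_upd_apply)
  qed
  \<comment> \<open>\<open>v\<close> in slot b is carried to the last slot at the price of the sign
    \<open>s b\<close>; there the induction hypothesis for \<open>g b\<close> applies.\<close>
  have upd: "alt_sum ?n (f(b := v)) = s b * alt_sum ?n ((g b)(m := v))" if "b < ?n" for b
  proof -
    have "alt_sum ?n ((g b)(m := v)) = alt_sum ?n (f(b := v) \<circ> transpose m b)"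
      by (intro alt_sum_cong) (auto simp: g_def transpose_def)
    also have "\<dots> = s b * alt_sum ?n (f(b := v))"
      unfolding s_def using that by (intro alt_sum_permute permutes_swap_id) auto
    finally show ?thesis by (simp add: ss)
  qed
  have lap: "alt_sum ?n f = (\<Sum>b<?n. s b * alt_sum m (g b) * f b)"
    unfolding s_def g_def by (rule alt_sum_Suc)
  then have lapv: "(\<Sum>b<?n. s b * (alt_sum m (g b) * (f b * v))) =
      (\<Sum>b<?n. s b * (alt_sum m (g b) * f b)) * v"
    by (simp add: sum_distrib_right mult.assoc del: sum.lessThan_Suc)
  have con: "contr_sum ?n f v = (\<Sum>b<?n. s b * acomm (f b) v * alt_sum m (g b))"
    by (simp add: contr_sum_def s_def g_def del: sum.lessThan_Suc)
  have Y: "of_nat m * (\<Sum>b<?n. s b * contr_sum m (g b) v * f b) = - of_nat m * contr_sum ?n f v"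
  proof (cases m)
    case (Suc l)
    define Z where "Z \<sigma> = of_int (sign \<sigma>) * acomm (f (\<sigma> l)) v *
        prod_list (map (\<lambda>i. f (\<sigma> i)) [0..<l]) * f (\<sigma> m)" for \<sigma>
    have "(\<Sum>b<?n. s b * contr_sum m (g b) v * f b) = (\<Sum>\<sigma> | \<sigma> permutes {..<?n}. Z \<sigma>)"
      unfolding sum_permutes_Suc
    proof (intro sum.cong refl)
      fix b
      show "s b * contr_sum m (g b) v * f b = (\<Sum>p | p permutes {..<m}. Z (transpose m b \<circ> p))"
        unfolding Suc contr_sum_Suc sum_distrib_left sum_distrib_right
        by (intro sum.cong refl)
           (auto simp: Z_def s_def g_def Suc sign_transpose_comp permutes_lessThan_self mult.assoc)
    qed
    \<comment> \<open>Exchanging the contracted slot \<open>l\<close> with the loose last factor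
      \<open>m\<close> costs only a sign: slot \<open>m\<close> is now contracted, and the loose
      factor completes the product over the first m slots.\<close>
    also have "\<dots> = (\<Sum>\<sigma> | \<sigma> permutes {..<?n}. Z (\<sigma> \<circ> transpose l m))"
      by (rule sum_permutations_compose_right, rule permutes_swap_id) (auto simp: Suc)
    also have "\<dots> = (\<Sum>\<sigma> | \<sigma> permutes {..<?n}. - (of_int (sign \<sigma>) * acomm (f (\<sigma> m)) v *
        prod_list (map (\<lambda>i. f (\<sigma> i)) [0..<m])))"
    proof (intro sum.cong refl)
      fix \<sigma> assume "\<sigma> \<in> {\<sigma>. \<sigma> permutes {..<?n}}"
      then have sg: "sign (\<sigma> \<circ> transpose l m) = - sign \<sigma>"
        by (subst sign_compose)
           (auto simp: Suc sign_swap_id permutation_swap_id intro: permutes_imp_permutation[of "{..<?n}"])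
      have "prod_list (map (\<lambda>i. f (\<sigma> (transpose l (Suc l) i))) [0..<l]) =
          prod_list (map (\<lambda>i. f (\<sigma> i)) [0..<l])"
        by (intro arg_cong[where f = prod_list]) (auto simp: transpose_def)
      then show "Z (\<sigma> \<circ> transpose l m) = - (of_int (sign \<sigma>) * acomm (f (\<sigma> m)) v *
          prod_list (map (\<lambda>i. f (\<sigma> i)) [0..<m]))"
        unfolding Z_def sg by (simp add: Suc mult.assoc)
    qed
    finally show ?thesis
      by (simp add: contr_sum_Suc sum_negf)
  qed simp
  \<comment> \<open>The Laplace term of the last slot is \<open>alt_sum ?n f * v\<close>; in every
    other term \<open>v\<close> has taken the place of \<open>f b\<close>, with sign -1.\<close>
  have "2 * alt_sum (Suc ?n) (f(?n := v)) = 2 * alt_sum ?n f * v - (\<Sum>b<?n. 2 * alt_sum ?n (f(b := v)) * f b)"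
  proof -
    have "alt_sum ?n (f(?n := v) \<circ> transpose ?n b) = alt_sum ?n (f(b := v))" if "b < ?n" for b
      using that by (intro alt_sum_cong) (auto simp: transpose_def)
    moreover have "alt_sum ?n (f(?n := v)) = alt_sum ?n f"
      by (intro alt_sum_cong) auto
    ultimately have "alt_sum (Suc ?n) (f(?n := v)) =
        alt_sum ?n f * v - (\<Sum>b<?n. alt_sum ?n (f(b := v)) * f b)"
      unfolding alt_sum_Suc[of ?n] sum.lessThan_Suc[of _ ?n]
      by (simp add: sign_swap_id sum_negf del: sum.lessThan_Suc)
    then show ?thesis
      by (simp add: right_diff_distrib sum_distrib_left mult.assoc del: sum.lessThan_Suc fun_upd_apply)
  qed
  also have "(\<Sum>b<?n. 2 * alt_sum ?n (f(b := v)) * f b) =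
      (\<Sum>b<?n. of_nat (2 * ?n) * (s b * acomm (f b) v * alt_sum m (g b))
        - of_nat (2 * ?n) * (s b * alt_sum m (g b) * f b) * v
        - of_nat ?n * (of_nat m * (s b * contr_sum m (g b) v * f b)))"
  proof (intro sum.cong refl)
    fix b assume "b \<in> {..<?n}"
    then have "2 * alt_sum ?n (f(b := v)) * f b = s b * (2 * alt_sum ?n ((g b)(m := v))) * f b"
      using scom[of b 2] by (simp add: upd mult.assoc[symmetric])
    also have "\<dots> = s b * of_nat (2 * ?n) * alt_sum m (g b) * (v * f b)
        - s b * (of_nat ?n * of_nat m) * contr_sum m (g b) v * f b"
      unfolding IH by (simp add: algebra_simps)
    also have "v * f b = acomm (f b) v - f b * v"
      by (simp add: acomm_def)
    also have "s b * of_nat (2 * ?n) * alt_sum m (g b) * (acomm (f b) v - f b * v) =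
       s b * of_nat (2 * ?n) * (acomm (f b) v * alt_sum m (g b)) - s b * of_nat (2 * ?n) * alt_sum m (g b) * (f b * v)"
      using central[OF fV v] by (simp add: mult.assoc right_diff_distrib)
    finally show "2 * alt_sum ?n (f(b := v)) * f b = of_nat (2 * ?n) * (s b * acomm (f b) v * alt_sum m (g b))
        - of_nat (2 * ?n) * (s b * alt_sum m (g b) * f b) * v
        - of_nat ?n * (of_nat m * (s b * contr_sum m (g b) v * f b))"
      unfolding scom by (simp only: mult.assoc scom)
  qed
  also have "\<dots> = of_nat (2 * ?n) * contr_sum ?n f v - of_nat (2 * ?n) * alt_sum ?n f * v
      + of_nat ?n * (of_nat m * contr_sum ?n f v)"
    using Y lapv unfolding lap con
    by (simp add: sum_subtractf sum_distrib_left[symmetric] mult.assoc del: sum.lessThan_Suc of_nat_Suc of_nat_mult)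
  finally have "2 * alt_sum (Suc ?n) (f(?n := v)) = 2 * (alt_sum ?n f * v) + of_nat (2 * ?n) * (alt_sum ?n f * v)
      - (of_nat (2 * ?n) * contr_sum ?n f v + of_nat ?n * (of_nat m * contr_sum ?n f v))"
    by (simp only: mult.assoc) (simp only: diff_conv_add_uminus minus_add_distrib minus_minus ac_simps)
  moreover have "(of_nat (2 * Suc ?n) :: 'a) = 2 + of_nat (2 * ?n)"
    "(of_nat (?n * Suc ?n) :: 'a) = of_nat (2 * ?n) + of_nat ?n * of_nat m"
    by (simp_all add: algebra_simps mult_2_right)
  ultimately show ?case
    by (simp only: mult.assoc distrib_right) simp
qed

section \<open>Generation and central elements of the radial algebra\<close>

lemma poly_mapping_induct [case_names zero single add]:
  assumes "P 0" "\<And>m t. P (single m t)" "\<And>f g. P f \<Longrightarrow> P g \<Longrightarrow> P (f + g)"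
  shows "P (f :: 'a \<Rightarrow>\<^sub>0 'b::monoid_add)"
proof (induction f rule: update_induct)
  case (update f m t)
  have "Poly_Mapping.update m t f = f + single m t"
    using update.hyps(1)
    by (intro poly_mapping_eqI) (auto simp: lookup_update lookup_add lookup_single when_def in_keys_iff)
  then show ?case
    using update.IH assms(2,3) by simp
qed (rule assms)

lemma const_add: "const (a + b) = const a + const b"
  by transfer (simp add: single_add radial_rel_def radial_ideal.zero)

lemma const_mult: "const (a * b) = const a * const b"
  by transfer (simp add: mult_single radial_rel_def radial_ideal.zero)

lemma const_0 [simp]: "const 0 = 0"
  by transfer (simp add: radial_rel_def radial_ideal.zero)

lemma const_1 [simp]: "const 1 = 1"
  by transfer (simp add: radial_rel_def radial_ideal.zero)

text \<open>Words grow on the right because the radial algebra will act on the model from the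
  right.\<close>

lemma free_alg_induct [case_names single_zero gen add]:
  fixes f :: "('v, 'k::comm_ring_1) free_alg"
  assumes "\<And>c. P (single 0 c)" "\<And>f v. P f \<Longrightarrow> P (f * free_gen v)"
    "\<And>f g. P f \<Longrightarrow> P g \<Longrightarrow> P (f + g)"
  shows "P f"
proof (induction f rule: poly_mapping_induct)
  case zero
  then show ?case using assms(1)[of 0] by simp
next
  case (single w c)
  obtain vs where w: "w = Free_Word vs" by (cases w)
  show ?case
    unfolding w
  proof (induction vs rule: rev_induct)
    case Nil
    then show ?case using assms(1)[of c] by (simp add: zero_free_word_def)
  next
    case (snoc v vs)
    have "single (Free_Word (vs @ [v])) c = single (Free_Word vs) c * free_gen v"
      by (simp add: free_gen_def mult_single plus_free_word_def)
    then show ?case using assms(2)[OF snoc] by simp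
  qed
qed (rule assms(3))

lemma radial_induct [case_names const gen add]:
  fixes F :: "('v, 'k::comm_ring_1) radial"
  assumes "\<And>c. P (const c)" "\<And>F v. P F \<Longrightarrow> P (F * vecvar v)" "\<And>F G. P F \<Longrightarrow> P G \<Longrightarrow> P (F + G)"
  shows "P F"
proof -
  have "P (abs_radial f)" for f
  proof (induction f rule: free_alg_induct)
    case (single_zero c)
    then show ?case using assms(1)[of c] by (simp add: const.abs_eq)
  next
    case (gen f v)
    then show ?case using assms(2)[of "abs_radial f" v] by (simp add: vecvar.abs_eq times_radial.abs_eq)
  next
    case (add f g)
    then show ?case using assms(3)[of "abs_radial f" "abs_radial g"] by (simp add: plus_radial.abs_eq)
  qed
  then show ?thesis
    by (metis Quotient3_abs_rep[OF Quotient3_radial])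
qed

definition central :: "'a::ring_1 \<Rightarrow> bool" where
  "central a \<longleftrightarrow> (\<forall>b. a * b = b * a)"

lemma centralD: "central a \<Longrightarrow> a * b = b * a"
  by (simp add: central_def)

lemma central_left_commute: "central a \<Longrightarrow> b * (a * c) = a * (b * c)"
  by (metis centralD mult.assoc)

lemma central_0 [simp]: "central 0" and central_1 [simp]: "central 1"
  by (simp_all add: central_def)

lemma central_add: "central a \<Longrightarrow> central b \<Longrightarrow> central (a + b)"
  by (simp add: central_def algebra_simps)

lemma central_mult: "central a \<Longrightarrow> central b \<Longrightarrow> central (a * b)"
  by (metis central_def mult.assoc)

lemma central_power: "central a \<Longrightarrow> central (a ^ n)"
  by (induction n) (auto intro: central_mult)

lemma central_sum: "(\<And>i. i \<in> I \<Longrightarrow> central (f i)) \<Longrightarrow> central (sum f I)"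
  by (induction I rule: infinite_finite_induct) (auto intro: central_add)

lemma central_prod_list: "(\<And>a. a \<in> set as \<Longrightarrow> central a) \<Longrightarrow> central (prod_list as)"
  by (induction as) (auto intro: central_mult)

lemma prod_list_mult_central:
  fixes f g :: "_ \<Rightarrow> 'a::ring_1"
  assumes "\<And>i. i \<in> set is \<Longrightarrow> central (g i)"
  shows "prod_list (map (\<lambda>i. f i * g i) is) = prod_list (map f is) * prod_list (map g is)"
  using assms
proof (induction "is")
  case (Cons i "is")
  then have "central (g i)" by simp
  then show ?case
    using Cons by (simp add: mult.assoc central_left_commute[of "g i"])
qed simp

lemma central_const: "central (const b :: ('v, 'k::comm_ring_1) radial)"
proof -
  have "const b * F = F * const b" for F :: "('v, 'k) radial"
  proof (induction F rule: radial_induct)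
    case (const c)
    then show ?case by (metis const_mult mult.commute)
  next
    case (gen F v)
    have "const b * vecvar v = (vecvar v * const b :: ('v, 'k) radial)"
      by transfer (simp add: free_gen_def mult_single radial_rel_def radial_ideal.zero)
    then show ?case using gen by (metis mult.assoc)
  qed (simp add: algebra_simps)
  then show ?thesis by (simp add: central_def)
qed

text \<open>The defining relation gives commutation with one generator; \<open>radial_induct\<close>
  extends it to all elements.\<close>

lemma central_acomm_vecvar: "central (acomm (vecvar u) (vecvar v) :: ('v, 'k::comm_ring_1) radial)"
proof -
  have "acomm (vecvar u) (vecvar v) * F = F * acomm (vecvar u) (vecvar v)" (is "?a * F = _")
    for F :: "('v, 'k) radial"
  proof (induction F rule: radial_induct)
    case (const c)
    then show ?case by (simp add: centralD[OF central_const])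
  next
    case (gen F w)
    have "acomm (vecvar u) (vecvar v) * vecvar w = vecvar w * (acomm (vecvar u) (vecvar v) :: ('v, 'k) radial)"
      unfolding acomm_def
    proof transfer
      fix u v w :: 'v
      show "radial_rel ((free_gen u * free_gen v + free_gen v * free_gen u) * free_gen w)
         (free_gen w * (free_gen u * free_gen v + free_gen v * free_gen u) :: ('v, 'k) free_alg)"
        using radial_ideal.gen[of 1 u v w 1]
        by (simp add: radial_rel_def commutator_def acomm_def)
    qed
    then show ?case using gen by (metis mult.assoc)
  qed (simp add: algebra_simps)
  then show ?thesis by (simp add: central_def)
qed

lemma coeff_real_add: "coeff_real (a + b) = coeff_real a + coeff_real b"
  by transfer (simp add: fld_real_def)

lemma coeff_real_mult: "coeff_real (a * b) = coeff_real a * coeff_real b"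
  by transfer (simp add: fld_real_def)

lemma coeff_real_1: "coeff_real 1 = 1"
  by transfer (rule fld_real_1)

lemma coeff_real_of_nat: "coeff_real (of_nat n) = of_nat n"
proof (induction n)
  case 0
  show ?case by (simp, transfer, rule fld_real_0)
qed (simp add: coeff_real_add coeff_real_1)

definition half :: qcoeff where "half = coeff_real (1 / 2)"

lemma half_add_half: "half + half = 1"
  by (simp add: half_def coeff_real_1 flip: coeff_real_add)

lemma const_of_nat: "const (of_nat n) = of_nat n"
  by (induction n) (simp_all add: const_add)

abbreviation rconst :: "real \<Rightarrow> ('v, qcoeff) radial" where
  "rconst a \<equiv> const (coeff_real a)"

lemma rconst_mult_of_nat: "rconst a * of_nat n = rconst (a * of_nat n)"
  by (simp add: coeff_real_mult coeff_real_of_nat const_mult const_of_nat)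

lemma rconst_mult_of_nat_mult: "rconst a * (of_nat n * F) = rconst (a * of_nat n) * F"
  by (simp add: rconst_mult_of_nat flip: mult.assoc)

lemma const_half_double: "const half * F + const half * F = F"
  by (simp add: half_add_half flip: distrib_right const_add)

section \<open>Wedges and the product of a wedge with a vector\<close>

lemma wedge_eq_alt_sum:
  "wedge us = rconst (1 / fact (length us)) * alt_sum (length us) ((!) us)"
  by (simp add: wedge_def alt_sum_def)

lemma wedge_swap:
  assumes "i < length us" "j < length us" "i \<noteq> j"
  shows "wedge (us[i := us ! j, j := us ! i]) = - wedge us"
proof -
  have "alt_sum (length us) ((!) (us[i := us ! j, j := us ! i])) =
      alt_sum (length us) ((!) us \<circ> transpose i j)"
    using assms by (intro alt_sum_cong) (auto simp: nth_list_update transpose_def)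
  also have "\<dots> = - alt_sum (length us) ((!) us)"
    using assms by (subst alt_sum_permute) (auto simp: permutes_swap_id sign_swap_id)
  finally show ?thesis
    by (simp add: wedge_eq_alt_sum)
qed

text \<open>\<open>a\<close> passes the entries of \<open>vs\<close> one at a time, each time by a
  swap of neighbours.\<close>

lemma wedge_move:
  "wedge (us @ a # vs) = (-1) ^ length vs * wedge (us @ vs @ [a])"
proof (induction vs arbitrary: us)
  case (Cons b vs)
  have "wedge (us @ b # a # vs) = - wedge (us @ a # b # vs)"
    using wedge_swap[of "length us" "us @ a # b # vs" "Suc (length us)"]
    by (simp add: nth_append list_update_append)
  then have "wedge (us @ a # b # vs) = - wedge ((us @ [b]) @ a # vs)"
    by simp
  then show ?case
    using Cons.IH[of "us @ [b]"] by simp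
qed simp

text \<open>Swapping the two copies of \<open>a\<close> shows that the wedge is its own negative;
  the constant \<open>half\<close> then cancels the factor 2.\<close>

lemma wedge_repeat: "wedge (us @ a # vs @ [a]) = 0"
proof -
  let ?w = "wedge (us @ a # vs @ [a])"
  have "?w = - ?w"
    using wedge_swap[of "length us" "us @ a # vs @ [a]" "length us + length vs + 1"]
    by (simp add: nth_append list_update_append)
  then have "?w + ?w = 0"
    by (metis add.right_inverse)
  then have "const half * (?w + ?w) = 0"
    by simp
  then show ?thesis
    by (simp add: distrib_left const_half_double)
qed

text \<open>This is \<open>alt_sum_mult_right\<close> divided by 2 (n+1)!. Since v arrives from the
  right, the sign of a contraction counts the vectors behind the contracted one.\<close>

lemma wedge_mult_vecvar:
  assumes V: "set us \<subseteq> range vecvar" and v: "v \<in> range vecvar"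
  shows "wedge us * v = wedge (us @ [v]) +
    const half * (\<Sum>b<length us. (-1) ^ (length us - 1 - b) * acomm (us ! b) v *
      wedge (take b us @ drop (Suc b) us))"
proof -
  let ?n = "length us"
  \<comment> \<open>The values beyond the list are filled with v, so that the whole range of f
    consists of vector variables, as \<open>alt_sum_mult_right\<close> demands.\<close>
  define f where "f i = (if i < ?n then us ! i else v)" for i
  have "of_nat (2 * Suc ?n) * alt_sum ?n f * v =
     2 * alt_sum (Suc ?n) (f(?n := v)) + of_nat (?n * Suc ?n) * contr_sum ?n f v"
  proof (rule alt_sum_mult_right[where V = "range vecvar"])
    show "range f \<subseteq> range vecvar"
      using V v by (auto simp: f_def subset_eq)
  qed (use v centralD[OF central_acomm_vecvar] in auto)
  then have "rconst (1 / (2 * fact (Suc ?n))) * (of_nat (2 * Suc ?n) * alt_sum ?n f * v) =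
    rconst (1 / (2 * fact (Suc ?n))) * (of_nat 2 * alt_sum (Suc ?n) (f(?n := v)) + of_nat (?n * Suc ?n) * contr_sum ?n f v)"
    by simp
  then have "rconst (1 / (2 * fact (Suc ?n)) * of_nat (2 * Suc ?n)) * (alt_sum ?n f * v) =
    rconst (1 / (2 * fact (Suc ?n)) * of_nat 2) * alt_sum (Suc ?n) (f(?n := v)) +
    rconst (1 / (2 * fact (Suc ?n)) * of_nat (?n * Suc ?n)) * contr_sum ?n f v"
    by (simp only: distrib_left mult.assoc rconst_mult_of_nat_mult)
  moreover have "1 / (2 * fact (Suc ?n)) * of_nat (2 * Suc ?n) = (1 / fact ?n :: real)"
    "1 / (2 * fact (Suc ?n)) * of_nat 2 = (1 / fact (Suc ?n) :: real)"
    "1 / (2 * fact (Suc ?n)) * of_nat (?n * Suc ?n) = (1 / 2 * (of_nat ?n / fact ?n) :: real)"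
    by (simp_all add: divide_simps) (simp_all add: algebra_simps)
  ultimately have 1: "rconst (1 / fact ?n) * (alt_sum ?n f * v) =
      rconst (1 / fact (Suc ?n)) * alt_sum (Suc ?n) (f(?n := v)) +
      rconst (1 / 2 * (of_nat ?n / fact ?n)) * contr_sum ?n f v"
    by simp
  have 2: "alt_sum ?n f = alt_sum ?n ((!) us)"
    by (intro alt_sum_cong) (auto simp: f_def)
  have 3: "alt_sum (Suc ?n) (f(?n := v)) = alt_sum (Suc ?n) ((!) (us @ [v]))"
    by (intro alt_sum_cong) (auto simp: f_def nth_append)
  have "rconst (of_nat ?n / fact ?n) * contr_sum ?n f v =
     (\<Sum>b<?n. (-1) ^ (?n - 1 - b) * acomm (us ! b) v * wedge (take b us @ drop (Suc b) us))"
    unfolding contr_sum_def sum_distrib_left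
  proof (intro sum.cong refl)
    fix b assume "b \<in> {..<?n}"
    then have b: "b < ?n" by simp
    have n: "of_nat ?n / fact ?n = (1 / fact (?n - 1) :: real)"
      using b by (cases ?n) (auto simp: divide_simps)
    define ls rs where "ls = take b us" and "rs = drop (Suc b) us"
    have us: "us = ls @ us ! b # rs"
      using b by (simp add: ls_def rs_def id_take_nth_drop)
    have bl: "length ls = b" and nl: "?n = Suc (b + length rs)"
      using b by (simp_all add: ls_def rs_def)
    \<comment> \<open>The transposition puts the last entry \<open>l\<close> into the gap left by
      \<open>us ! b\<close>. Carrying it back to the end gives one sign fewer than
      \<open>length rs\<close>, and the sign of the transposition supplies the missing one. If
      \<open>us ! b\<close> is itself last, nothing moves.\<close>
    have "of_int (sign (transpose (?n - 1) b)) * (rconst (1 / fact (?n - 1)) * alt_sum (?n - 1) (f \<circ> transpose (?n - 1) b)) =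
       (-1) ^ length rs * wedge (ls @ rs)"
    proof (cases rs rule: rev_cases)
      case Nil
      have "alt_sum (?n - 1) f = alt_sum (?n - 1) ((!) ls)"
      proof (rule alt_sum_cong)
        fix i assume "i < ?n - 1"
        then have "i < length ls" "i < ?n" using nl bl Nil by auto
        then show "f i = ls ! i"
          by (simp add: f_def) (simp add: ls_def)
      qed
      then show ?thesis
        using Nil nl bl by (simp add: wedge_eq_alt_sum)
    next
      case (snoc rs' l)
      have "alt_sum (?n - 1) (f \<circ> transpose (?n - 1) b) = alt_sum (?n - 1) ((!) (ls @ l # rs'))"
      proof (rule alt_sum_cong)
        fix i assume i: "i < ?n - 1"
        have nth: "us ! j = (ls @ us ! b # rs' @ [l]) ! j" for j
          using us snoc by simp
        show "(f \<circ> transpose (?n - 1) b) i = (ls @ l # rs') ! i"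
        proof (cases "i = b")
          case True
          have "us ! (?n - 1) = l"
            using nth[of "?n - 1"] nl snoc bl by (simp add: nth_append)
          moreover have "?n - 1 < ?n"
            using b by simp
          ultimately show ?thesis using True bl by (simp add: f_def nth_append)
        next
          case False
          then show ?thesis
            using nth[of i] i nl snoc bl b by (auto simp: f_def nth_append nth_Cons transpose_def split: nat.split)
        qed
      qed
      moreover have "wedge (ls @ l # rs') = (-1) ^ length rs' * wedge (ls @ rs)"
        using wedge_move[of ls l rs'] snoc by simp
      moreover have "length (ls @ l # rs') = ?n - 1"
        using nl bl snoc by simp
      ultimately show ?thesis
        using snoc nl by (simp add: wedge_eq_alt_sum[of "ls @ l # rs'"] sign_swap_id)
    qed
    moreover have "length rs = ?n - 1 - b"
      using nl by simp
    moreover have "central (acomm (us ! b) v)"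
      using V v nth_mem[OF b] by (auto simp: subset_eq image_iff) (metis central_acomm_vecvar)
    moreover have "c * (s * a * A) = a * (s * (c * A))" if "central a" "central c" for a c s A :: "'c::ring_1"
      using that by (metis central_left_commute mult.assoc)
    from this[OF \<open>central (acomm (us ! b) v)\<close> central_const]
    have "rconst (1 / fact (?n - 1)) * (of_int (sign (transpose (?n - 1) b)) * acomm (us ! b) v *
        alt_sum (?n - 1) (f \<circ> transpose (?n - 1) b)) =
        acomm (us ! b) v * (of_int (sign (transpose (?n - 1) b)) *
          (rconst (1 / fact (?n - 1)) * alt_sum (?n - 1) (f \<circ> transpose (?n - 1) b)))" .
    moreover have "a * (c * w) = c * a * w" if "central a" for a c w :: "'c::ring_1"
      using that by (simp add: central_left_commute mult.assoc)
    note this[OF \<open>central (acomm (us ! b) v)\<close>, of "(-1) ^ length rs" "wedge (ls @ rs)"]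
    ultimately show "rconst (of_nat ?n / fact ?n) * (of_int (sign (transpose (?n - 1) b)) * acomm (f b) v *
        alt_sum (?n - 1) (f \<circ> transpose (?n - 1) b)) =
        (-1) ^ (?n - 1 - b) * acomm (us ! b) v * wedge (take b us @ drop (Suc b) us)"
      unfolding n using b by (simp add: f_def ls_def rs_def)
  qed
  then have 4: "rconst (1 / 2 * (of_nat ?n / fact ?n)) * contr_sum ?n f v = const half *
     (\<Sum>b<?n. (-1) ^ (?n - 1 - b) * acomm (us ! b) v * wedge (take b us @ drop (Suc b) us))"
    unfolding half_def by (simp only: coeff_real_mult const_mult mult.assoc)
  show ?thesis
    using 1 unfolding 2 3 4 by (simp add: wedge_eq_alt_sum mult.assoc)
qed

lemma sorted_list_of_set_split:
  fixes S :: "nat set"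
  assumes "finite S"
  shows "sorted_list_of_set (insert u S) =
      sorted_list_of_set {j \<in> S. j < u} @ u # sorted_list_of_set {j \<in> S. u < j}"
    and "sorted_list_of_set (S - {u}) =
      sorted_list_of_set {j \<in> S. j < u} @ sorted_list_of_set {j \<in> S. u < j}"
proof -
  let ?A = "sorted_list_of_set {j \<in> S. j < u}" and ?B = "sorted_list_of_set {j \<in> S. u < j}"
  have set: "set ?A = {j \<in> S. j < u}" "set ?B = {j \<in> S. u < j}"
    using assms by simp_all
  have "sorted (?A @ u # ?B)" "distinct (?A @ u # ?B)" "sorted (?A @ ?B)" "distinct (?A @ ?B)"
    unfolding sorted_append distinct_append sorted_simps distinct.simps list.set set
    by (auto intro: less_imp_le)
  moreover have "set (?A @ u # ?B) = insert u S" "set (?A @ ?B) = S - {u}"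
    unfolding set_append list.set set by auto
  ultimately show "sorted_list_of_set (insert u S) = ?A @ u # ?B" "sorted_list_of_set (S - {u}) = ?A @ ?B"
    by (metis sorted_list_of_set.idem_if_sorted_distinct)+
qed

text \<open>With x as \<open>z 0\<close> and y_i as \<open>z (Suc i)\<close>, one family indexed by
  sets S covers both y_I and x \<and> y_I; the second kind is recognised by 0 \<in> S.\<close>

definition zwedge :: "(nat \<Rightarrow> ('v, qcoeff) radial) \<Rightarrow> nat set \<Rightarrow> ('v, qcoeff) radial" where
  "zwedge z S = wedge (map z (sorted_list_of_set S))"

lemma zwedge_empty: "zwedge z {} = 1"
  by (simp add: zwedge_def wedge_eq_alt_sum coeff_real_1)

text \<open>Cutting off at \<open>N\<close> keeps the cardinality finite (not the junk value \<open>0\<close>) for every \<open>S\<close>, so that the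
  anticommutation relations below hold for all sets.\<close>

definition sgn_above :: "nat \<Rightarrow> nat set \<Rightarrow> nat \<Rightarrow> 'b::ring_1" where
  "sgn_above N S u = (-1) ^ card (S \<inter> {u<..N})"

text \<open>The list formula \<open>wedge_mult_vecvar\<close> in terms of sets. An appended v must
  be sorted in past the larger elements of S, and a contracted u is reached from the right past the
  larger ones; both signs are \<open>sgn_above\<close>.\<close>

lemma zwedge_mult:
  assumes SN: "S \<subseteq> {..N}" and z: "range z \<subseteq> range vecvar"
  shows "zwedge z S * z v = (if v \<in> S then 0 else sgn_above N S v * zwedge z (insert v S)) +
    const half * (\<Sum>u\<in>S. sgn_above N S u * acomm (z u) (z v) * zwedge z (S - {u}))"
proof -
  have S: "finite S" and above: "S \<inter> {u<..N} = {j \<in> S. u < j}" for u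
    using SN by (auto intro: finite_subset)
  define L where "L = sorted_list_of_set S"
  have len: "length L = card S" and setL: "set L = S" and dL: "distinct L"
    using S by (simp_all add: L_def)
  have Lsplit: "L = sorted_list_of_set {j \<in> S. j < u} @ u # sorted_list_of_set {j \<in> S. u < j}" if "u \<in> S" for u
    using sorted_list_of_set_split(1)[OF S, of u] that by (simp add: L_def insert_absorb)
  have 1: "wedge (map z L @ [z v]) = (if v \<in> S then 0 else sgn_above N S v * zwedge z (insert v S))"
  proof (cases "v \<in> S")
    case True
    then show ?thesis
      by (subst Lsplit[OF True]) (simp add: wedge_repeat)
  next
    case False
    let ?A = "map z (sorted_list_of_set {j \<in> S. j < v})" and ?B = "map z (sorted_list_of_set {j \<in> S. v < j})"
    have "map z L = ?A @ ?B"
      using sorted_list_of_set_split(2)[OF S, of v] False by (simp add: L_def)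
    then have "sgn_above N S v * zwedge z (insert v S) =
        ((-1) ^ length ?B * (-1) ^ length ?B) * wedge (map z L @ [z v])"
      using wedge_move[of ?A "z v" ?B]
      by (simp add: zwedge_def sorted_list_of_set_split(1)[OF S] sgn_above_def above mult.assoc)
    then show ?thesis
      using False by (simp add: minus_one_power_iff)
  qed
  let ?t = "\<lambda>b. (-1) ^ (length L - 1 - b) * acomm (z (L ! b)) (z v) *
      wedge (map z (take b L @ drop (Suc b) L))"
  have 2: "(\<Sum>b<length L. ?t b) = (\<Sum>u\<in>S. sgn_above N S u * acomm (z u) (z v) * zwedge z (S - {u}))"
  \<comment> \<open>Position b of the sorted list holds the element with exactly b smaller ones, so
    \<open>length L - 1 - b\<close> counts the elements above it.\<close>
  proof (rule sum.reindex_bij_witness[where i = "\<lambda>u. card {j \<in> S. j < u}" and j = "(!) L"])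
    have nthL: "L ! card {j \<in> S. j < u} = u" if "u \<in> S" for u
      by (subst Lsplit[OF that]) (simp add: nth_append)
    have inv: "card {j \<in> S. j < L ! b} = b" if b: "b < length L" for b
    proof -
      have mem: "L ! b \<in> S"
        using b setL nth_mem by blast
      have "card {j \<in> S. j < L ! b} < length L"
        unfolding len using mem S by (intro psubset_card_mono) auto
      then show ?thesis
        using nthL[OF mem] b dL nth_eq_iff_index_eq by blast
    qed
    fix b assume "b \<in> {..<length L}"
    then have b: "b < length L" by simp
    then show mem: "L ! b \<in> S"
      using setL nth_mem by blast
    show "card {j \<in> S. j < L ! b} = b"
      by (rule inv[OF b])
    let ?u = "L ! b"
    note sp = Lsplit[OF mem]
    have "length L = length (sorted_list_of_set {j \<in> S. j < ?u} @ ?u # sorted_list_of_set {j \<in> S. ?u < j})"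
      using sp by simp
    then have c: "length L - 1 - b = card {j \<in> S. ?u < j}"
      using inv[OF b] by simp
    have "take b L = sorted_list_of_set {j \<in> S. j < ?u}"
      by (subst sp) (simp add: inv[OF b])
    moreover have "drop (Suc b) L = sorted_list_of_set {j \<in> S. ?u < j}"
      by (subst sp) (simp add: inv[OF b])
    ultimately have "take b L @ drop (Suc b) L = sorted_list_of_set (S - {?u})"
      by (simp add: sorted_list_of_set_split(2)[OF S])
    then show "sgn_above N S ?u * acomm (z ?u) (z v) * zwedge z (S - {?u}) = ?t b"
      by (simp only: sgn_above_def above c zwedge_def)
  next
    fix u assume u: "u \<in> S"
    have nthL: "L ! card {j \<in> S. j < u} = u"
      by (subst Lsplit[OF u]) (simp add: nth_append)
    then show "L ! card {j \<in> S. j < u} = u" .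
    show "card {j \<in> S. j < u} \<in> {..<length L}"
      unfolding len using u S by (auto intro!: psubset_card_mono)
  qed
  have "zwedge z S * z v = wedge (map z L @ [z v]) + const half * (\<Sum>b<length L. ?t b)"
    unfolding zwedge_def L_def[symmetric]
    by (subst wedge_mult_vecvar) (use z in \<open>auto simp: take_map drop_map\<close>)
  then show ?thesis
    unfolding 1 2 .
qed

section \<open>Creation and annihilation operators\<close>

text \<open>Models are coefficient functions: \<open>m S\<close> belongs to the wedge over S.
  \<open>cre\<close> is right exterior multiplication by \<open>z u\<close> and \<open>ann\<close>
  is contraction from the right, both read off on coefficients.\<close>

definition cre :: "nat \<Rightarrow> nat \<Rightarrow> (nat set \<Rightarrow> 'b::comm_ring_1) \<Rightarrow> nat set \<Rightarrow> 'b" where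
  "cre N u m S = (if u \<in> S then sgn_above N S u * m (S - {u}) else 0)"

definition ann :: "nat \<Rightarrow> nat \<Rightarrow> (nat set \<Rightarrow> 'b::comm_ring_1) \<Rightarrow> nat set \<Rightarrow> 'b" where
  "ann N u m S = (if u \<in> S then 0 else sgn_above N S u * m (insert u S))"

lemma sgn_above_square: "sgn_above N S u * (sgn_above N S u * a) = a"
  by (simp add: sgn_above_def minus_one_power_iff)

lemma sgn_above_insert:
  assumes "v \<notin> S" "v \<le> N"
  shows "(sgn_above N (insert v S) u :: 'b::ring_1) = (if u < v then - sgn_above N S u else sgn_above N S u)"
  using assms by (auto simp: sgn_above_def Int_insert_left)

lemma sgn_above_remove:
  assumes "v \<in> S" "v \<le> N"
  shows "(sgn_above N (S - {v}) u :: 'b::ring_1) = (if u < v then - sgn_above N S u else sgn_above N S u)"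
  using sgn_above_insert[of v "S - {v}" N u, where 'b = 'b] assms by (auto simp: insert_absorb)

text \<open>Removing the larger of two indices flips the sign of the smaller one, but not
  conversely. So the two orders differ by exactly one sign; the same count gives
  \<open>ann_ann\<close> and the off-diagonal case of \<open>cre_ann\<close>.\<close>

lemma cre_cre:
  assumes "u \<le> N" "v \<le> N"
  shows "cre N u (cre N v m) S + cre N v (cre N u m) S = 0"
proof (cases u v rule: linorder_cases)
  case less
  have "S - {u} - {v} = S - {v} - {u}" by auto
  then show ?thesis
    using assms less by (simp add: cre_def sgn_above_remove algebra_simps)
next
  case greater
  have "S - {u} - {v} = S - {v} - {u}" by auto
  then show ?thesis
    using assms greater by (simp add: cre_def sgn_above_remove algebra_simps)
qed (simp add: cre_def)

lemma ann_ann: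
  assumes "u \<le> N" "v \<le> N"
  shows "ann N u (ann N v m) S + ann N v (ann N u m) S = 0"
proof (cases u v rule: linorder_cases)
  case less
  have "insert u (insert v S) = insert v (insert u S)" by auto
  then show ?thesis
    using assms less by (simp add: ann_def sgn_above_insert algebra_simps)
next
  case greater
  have "insert u (insert v S) = insert v (insert u S)" by auto
  then show ?thesis
    using assms greater by (simp add: ann_def sgn_above_insert algebra_simps)
qed (simp add: ann_def)

lemma cre_ann:
  assumes "u \<le> N" "v \<le> N"
  shows "cre N u (ann N v m) S + ann N v (cre N u m) S = (if u = v then m S else 0)"
proof (cases u v rule: linorder_cases)
  case less
  have "insert v (S - {u}) = insert v S - {u}" using less by auto
  then show ?thesis
    using assms less by (auto simp: cre_def ann_def sgn_above_remove sgn_above_insert algebra_simps)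
next
  case greater
  have "insert v (S - {u}) = insert v S - {u}" using greater by auto
  then show ?thesis
    using assms greater by (auto simp: cre_def ann_def sgn_above_remove sgn_above_insert algebra_simps)
next
  case equal
  have "sgn_above N (insert v S) v = (sgn_above N S v :: 'a)" "sgn_above N (S - {v}) v = (sgn_above N S v :: 'a)"
    by (auto simp: sgn_above_def intro!: arg_cong[where f = card] arg_cong[where f = "(^) (-1)"])
  then show ?thesis
    using equal by (auto simp: cre_def ann_def sgn_above_square insert_absorb)
qed

lemma cre_add: "cre N u (\<lambda>S. m S + m' S) S = cre N u m S + cre N u m' S"
  and ann_add: "ann N u (\<lambda>S. m S + m' S) S = ann N u m S + ann N u m' S"
  and cre_scale: "cre N u (\<lambda>S. c * m S) S = c * cre N u m S"
  and ann_scale: "ann N u (\<lambda>S. c * m S) S = c * ann N u m S"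
  by (auto simp: cre_def ann_def algebra_simps)

lemma cre_zero: "cre N u (\<lambda>S. 0) S = 0"
  and ann_zero: "ann N u (\<lambda>S. 0) S = 0"
  by (auto simp: cre_def ann_def)

lemma cre_sum: "cre N u (\<lambda>S. \<Sum>i\<in>I. m i S) S = (\<Sum>i\<in>I. cre N u (m i) S)"
  and ann_sum: "ann N u (\<lambda>S. \<Sum>i\<in>I. m i S) S = (\<Sum>i\<in>I. ann N u (m i) S)"
  by (auto simp: cre_def ann_def sum_distrib_left)

text \<open>Right Clifford multiplication by \<open>z v\<close> for the symmetric form g, with h in
  the role of 1/2: the formula of \<open>zwedge_mult\<close> on coefficients.\<close>

definition rho :: "nat \<Rightarrow> 'b \<Rightarrow> (nat \<Rightarrow> nat \<Rightarrow> 'b) \<Rightarrow> nat \<Rightarrow> (nat set \<Rightarrow> 'b::comm_ring_1) \<Rightarrow> nat set \<Rightarrow> 'b" where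
  "rho N h g v m S = cre N v m S + h * (\<Sum>u\<le>N. g u v * ann N u m S)"

lemma rho_add: "rho N h g v (\<lambda>S. m S + m' S) S = rho N h g v m S + rho N h g v m' S"
  and rho_scale: "rho N h g v (\<lambda>S. c * m S) S = c * rho N h g v m S"
  by (simp_all add: rho_def cre_add ann_add cre_scale ann_scale algebra_simps sum.distrib sum_distrib_left)

text \<open>The Clifford relation. Two creations cancel, two contractions cancel after exchanging
  the summation indices, and each of the two mixed pairs contributes \<open>h * g u v\<close>, hence
  the hypothesis on h.\<close>

lemma rho_rho:
  assumes h: "h + h = 1" and g: "\<And>u v. g u v = g v u" and uv: "u \<le> N" "v \<le> N"
  shows "rho N h g u (rho N h g v m) S + rho N h g v (rho N h g u m) S = g u v * m S"
proof -
  have ex: "rho N h g u (rho N h g v m) S = cre N u (cre N v m) S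
      + h * (\<Sum>w\<le>N. g w v * cre N u (ann N w m) S) + h * (\<Sum>w\<le>N. g w u * ann N w (cre N v m) S)
      + h * (h * (\<Sum>w\<le>N. \<Sum>w'\<le>N. g w u * g w' v * ann N w (ann N w' m) S))" for u v
  proof -
    have e: "rho N h g v m = (\<lambda>S. cre N v m S + h * (\<Sum>u\<le>N. g u v * ann N u m S))"
      by (simp add: rho_def fun_eq_iff)
    show ?thesis
      unfolding e unfolding rho_def
      by (simp add: cre_add ann_add cre_scale ann_scale cre_sum ann_sum algebra_simps sum.distrib sum_distrib_left)
  qed
  have mixed: "(\<Sum>w\<le>N. g w v * cre N u (ann N w m) S) + (\<Sum>w\<le>N. g w v * ann N w (cre N u m) S) = g u v * m S"
    if "u \<le> N" for u v
  proof -
    have "(\<Sum>w\<le>N. g w v * cre N u (ann N w m) S) + (\<Sum>w\<le>N. g w v * ann N w (cre N u m) S) =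
        (\<Sum>w\<le>N. if w = u then g w v * m S else 0)"
      unfolding sum.distrib[symmetric] distrib_left[symmetric]
      by (intro sum.cong refl) (use that in \<open>auto simp: cre_ann\<close>)
    then show ?thesis using that by simp
  qed
  have aa: "(\<Sum>w\<le>N. \<Sum>w'\<le>N. g w u * g w' v * ann N w (ann N w' m) S)
      + (\<Sum>w\<le>N. \<Sum>w'\<le>N. g w v * g w' u * ann N w (ann N w' m) S) = 0"
  proof -
    have "(\<Sum>w\<le>N. \<Sum>w'\<le>N. g w v * g w' u * ann N w (ann N w' m) S) =
        (\<Sum>w\<le>N. \<Sum>w'\<le>N. g w u * g w' v * ann N w' (ann N w m) S)"
      by (subst sum.swap) (simp add: mult.commute)
    then have "(\<Sum>w\<le>N. \<Sum>w'\<le>N. g w u * g w' v * ann N w (ann N w' m) S)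
      + (\<Sum>w\<le>N. \<Sum>w'\<le>N. g w v * g w' u * ann N w (ann N w' m) S) =
       (\<Sum>w\<le>N. \<Sum>w'\<le>N. g w u * g w' v * (ann N w (ann N w' m) S + ann N w' (ann N w m) S))"
      by (simp add: sum.distrib distrib_left)
    also have "\<dots> = 0"
      by (intro sum.neutral ballI) (simp add: ann_ann)
    finally show ?thesis .
  qed
  have "rho N h g u (rho N h g v m) S + rho N h g v (rho N h g u m) S =
      (cre N u (cre N v m) S + cre N v (cre N u m) S)
      + h * ((\<Sum>w\<le>N. g w v * cre N u (ann N w m) S) + (\<Sum>w\<le>N. g w v * ann N w (cre N u m) S))
      + h * ((\<Sum>w\<le>N. g w u * cre N v (ann N w m) S) + (\<Sum>w\<le>N. g w u * ann N w (cre N v m) S))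
      + h * (h * ((\<Sum>w\<le>N. \<Sum>w'\<le>N. g w u * g w' v * ann N w (ann N w' m) S)
      + (\<Sum>w\<le>N. \<Sum>w'\<le>N. g w v * g w' u * ann N w (ann N w' m) S)))"
    unfolding ex by (simp add: distrib_left)
  also have "\<dots> = (h + h) * (g u v * m S)"
    unfolding cre_cre[OF uv] mixed[OF uv(1)] mixed[OF uv(2)] aa g[of v u] by (simp add: distrib_right)
  finally show ?thesis
    by (simp add: h)
qed

section \<open>The derivative on a free model\<close>

lemma lookup_single_mult:
  fixes f :: "('a \<Rightarrow>\<^sub>0 nat) \<Rightarrow>\<^sub>0 'b::semiring_0"
  shows "lookup (single \<nu> t * f) (\<nu> + \<kappa>) = t * lookup f \<kappa>"
proof (induction f rule: poly_mapping_induct)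
  case (single m b)
  have "\<nu> + m = \<nu> + \<kappa> \<longleftrightarrow> m = \<kappa>" by simp
  then show ?case by (simp add: mult_single lookup_single when_def)
qed (simp_all add: distrib_left lookup_add)

lemma lookup_single_mult_eq_0:
  fixes f :: "('a \<Rightarrow>\<^sub>0 nat) \<Rightarrow>\<^sub>0 'b::semiring_0"
  assumes "\<And>\<kappa>. \<mu> \<noteq> \<nu> + \<kappa>"
  shows "lookup (single \<nu> t * f) \<mu> = 0"
  by (induction f rule: poly_mapping_induct)
     (use assms in \<open>auto simp: mult_single lookup_single when_def distrib_left lookup_add\<close>)

lemma lookup_const_mult:
  fixes f :: "('a \<Rightarrow>\<^sub>0 nat) \<Rightarrow>\<^sub>0 'b::semiring_0"
  shows "lookup (single 0 t * f) \<mu> = t * lookup f \<mu>"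
  using lookup_single_mult[of 0 t f \<mu>] by simp

type_synonym 'k spoly = "(svar \<Rightarrow>\<^sub>0 nat) \<Rightarrow>\<^sub>0 'k"

text \<open>The Jackson derivative without division: the coefficient of u^(n+1) is moved to u^n and
  multiplied by the q-integer 1 + P + ... + P^n. This makes sense over every ring and also at P = 0,
  where the limit is taken.\<close>

definition qdiff :: "svar \<Rightarrow> 'k::comm_ring_1 \<Rightarrow> 'k spoly \<Rightarrow> 'k spoly" where
  "qdiff u P f = Poly_Mapping.mapp (\<lambda>\<mu> t. (\<Sum>i\<le>lookup \<mu> u. P ^ i) * t)
     (Poly_Mapping.map_key (\<lambda>\<mu>. single u 1 + \<mu>) f)"

definition qdil :: "svar \<Rightarrow> 'k::comm_ring_1 \<Rightarrow> 'k spoly \<Rightarrow> 'k spoly" where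
  "qdil u P = Poly_Mapping.mapp (\<lambda>\<mu> t. P ^ lookup \<mu> u * t)"

lemma lookup_qdiff: "lookup (qdiff u P f) \<mu> =
    (\<Sum>i\<le>lookup \<mu> u. P ^ i) * lookup f (single u 1 + \<mu>)"
proof -
  have "inj (\<lambda>\<mu>. single u (1::nat) + \<mu>)"
    by (simp add: inj_def)
  then have "lookup (Poly_Mapping.map_key (\<lambda>\<mu>. single u 1 + \<mu>) f) \<mu> =
      lookup f (single u 1 + \<mu>)"
    by (simp add: map_key.rep_eq)
  then show ?thesis
    by (simp add: qdiff_def lookup_mapp when_def in_keys_iff)
qed

lemma lookup_qdil: "lookup (qdil u P f) \<mu> = P ^ lookup \<mu> u * lookup f \<mu>"
  by (auto simp: qdil_def lookup_mapp when_def in_keys_iff)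

lemma single_0_power: "single 0 (P ^ n) = (single 0 P :: 'a::monoid_add \<Rightarrow>\<^sub>0 'b::comm_ring_1) ^ n"
  by (induction n) (simp_all add: mult_single[of 0 _ 0, simplified, symmetric])

lemma dilation_eq_qdil: "dilation u P f = qdil u (single 0 P) f"
  by (rule poly_mapping_eqI) (simp add: lookup_qdil lookup_dilation single_0_power)

text \<open>\<open>jackson_eq\<close> determines the coefficients of \<open>jackson\<close> up to
  the factor 1 - P, and this factor cancels because \<open>T_poly\<close> is an integral
  domain.\<close>

lemma jackson_eq_qdiff:
  assumes "P \<noteq> 1"
  shows "jackson u P f = qdiff u (single 0 P) f"
proof (rule poly_mapping_eqI)
  fix \<mu> :: "svar \<Rightarrow>\<^sub>0 nat"
  let ?P = "single 0 P :: T_poly"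
  let ?\<mu> = "single u 1 + \<mu>"
  have "A_const (1 - P) * A_var u = single (single u 1) (1 - ?P)"
    by (simp add: A_const_def A_var_def mult_single single_diff left_diff_distrib)
  then have "(1 - ?P) * lookup (jackson u P f) \<mu> =
      lookup (A_const (1 - P) * A_var u * jackson u P f) ?\<mu>"
    by (simp only: lookup_single_mult)
  also have "\<dots> = lookup (f - dilation u P f) ?\<mu>"
    by (simp only: jackson_eq[OF assms])
  also have "\<dots> = (1 - ?P ^ Suc (lookup \<mu> u)) * lookup f ?\<mu>"
    by (simp only: lookup_minus lookup_dilation lookup_add single_0_power lookup_single_eq plus_1_eq_Suc
        left_diff_distrib mult_1_left)
  also have "\<dots> = (1 - ?P) * lookup (qdiff u ?P f) \<mu>"
    unfolding one_diff_power_eq lookup_qdiff lessThan_Suc_atMost by (simp add: mult.assoc)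
  finally have "(1 - ?P) * lookup (jackson u P f) \<mu> = (1 - ?P) * lookup (qdiff u ?P f) \<mu>" .
  moreover have "1 - ?P = single 0 (1 - P)"
    by (simp add: single_diff)
  then have "1 - ?P \<noteq> 0"
    using assms by (simp add: single_eq_0_iff del: single_diff)
  ultimately show "lookup (jackson u P f) \<mu> = lookup (qdiff u ?P f) \<mu>"
    by simp
qed

text \<open>The anticommutators of the vectors \<open>z u\<close> and \<open>z v\<close> as
  polynomials, index 0 standing for x; the corner is 2 because {x,x} = 2r.\<close>

definition gpair :: "(nat \<Rightarrow> nat \<Rightarrow> 'k::comm_ring_1) \<Rightarrow> nat \<Rightarrow> nat \<Rightarrow> 'k spoly" where
  "gpair c u v = (case u of
     0 \<Rightarrow> (case v of 0 \<Rightarrow> single (single R_Var 1) 2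
                   | Suc j \<Rightarrow> single (single (S_Var j) 1) 1)
   | Suc i \<Rightarrow> (case v of 0 \<Rightarrow> single (single (S_Var i) 1) 1
                   | Suc j \<Rightarrow> single 0 (c i j)))"

lemma gpair_commute: "(\<And>i j. c i j = c j i) \<Longrightarrow> gpair c u v = gpair c v u"
  by (auto simp: gpair_def split: nat.split)

type_synonym 'k model = "nat set \<Rightarrow> 'k spoly"

definition vmul :: "nat \<Rightarrow> 'k::comm_ring_1 \<Rightarrow> (nat \<Rightarrow> nat \<Rightarrow> 'k) \<Rightarrow> nat \<Rightarrow> 'k model \<Rightarrow> 'k model" where
  "vmul N h c = rho N (single 0 h) (gpair c)"

text \<open>\<open>deriv_sc\<close> with the wedge on its left. Scalars are central, so the vectors
  x and y_i may act by right multiplication on the differentiated coefficients.\<close>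

definition scalar_deriv :: "nat \<Rightarrow> 'k::comm_ring_1 \<Rightarrow> (nat \<Rightarrow> nat \<Rightarrow> 'k) \<Rightarrow> 'k \<Rightarrow> 'k model \<Rightarrow> 'k model" where
  "scalar_deriv N h c q m S = single 0 (1 + q) * vmul N h c 0 (\<lambda>S. qdiff R_Var (q ^ 2) (m S)) S +
     2 * (\<Sum>i<N. vmul N h c (Suc i) (\<lambda>S. qdil R_Var (q ^ 2) (qdiff (S_Var i) q (m S))) S)"

text \<open>\<open>br p\<close> and \<open>qm p\<close> stand for [m-p]_q and q^(m-p). The sign
  (-1)^p is contained in \<open>ann N 0\<close>, since index 0 lies below all others. A set
  containing 0 has p = card S - 1; after the contraction p is card S.\<close>

definition deriv_op :: "nat \<Rightarrow> 'k::comm_ring_1 \<Rightarrow> (nat \<Rightarrow> nat \<Rightarrow> 'k) \<Rightarrow> 'k \<Rightarrow> (nat \<Rightarrow> 'k) \<Rightarrow> (nat \<Rightarrow> 'k)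
    \<Rightarrow> 'k model \<Rightarrow> 'k model" where
  "deriv_op N h c q br qm m S = single 0 (br (card S)) * ann N 0 m S +
     scalar_deriv N h c q (\<lambda>S. if 0 \<in> S then single 0 (qm (card S - 1)) * m S else m S) S"

lemma qdiff_add: "qdiff u P (f + g) = qdiff u P f + qdiff u P g"
  by (rule poly_mapping_eqI) (simp add: lookup_qdiff lookup_add distrib_left)

lemma qdiff_0 [simp]: "qdiff u P 0 = 0"
  by (rule poly_mapping_eqI) (simp add: lookup_qdiff)

lemma qdiff_scale: "qdiff u P (single 0 b * f) = single 0 b * qdiff u P f"
  by (rule poly_mapping_eqI) (simp add: lookup_qdiff lookup_const_mult mult.left_commute)

lemma qdil_add: "qdil u P (f + g) = qdil u P f + qdil u P g"
  by (rule poly_mapping_eqI) (simp add: lookup_qdil lookup_add distrib_left)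

lemma qdil_0 [simp]: "qdil u P 0 = 0"
  by (rule poly_mapping_eqI) (simp add: lookup_qdil)

lemma qdil_scale: "qdil u P (single 0 b * f) = single 0 b * qdil u P f"
  by (rule poly_mapping_eqI) (simp add: lookup_qdil lookup_const_mult mult.left_commute)

lemma vmul_add: "vmul N h c v (\<lambda>S. m S + m' S) S = vmul N h c v m S + vmul N h c v m' S"
  and vmul_scale: "vmul N h c v (\<lambda>S. a * m S) S = a * vmul N h c v m S"
  by (simp_all add: vmul_def rho_add rho_scale)

lemma scalar_deriv_add: "scalar_deriv N h c q (\<lambda>S. m S + m' S) S = scalar_deriv N h c q m S + scalar_deriv N h c q m' S"
  by (simp add: scalar_deriv_def qdiff_add qdil_add vmul_add sum.distrib algebra_simps)

lemma scalar_deriv_scale: "scalar_deriv N h c q (\<lambda>S. single 0 b * m S) S = single 0 b * scalar_deriv N h c q m S"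
  by (simp add: scalar_deriv_def qdiff_scale qdil_scale vmul_scale sum_distrib_left distrib_left mult.left_commute)

lemma deriv_op_add: "deriv_op N h c q br qm (\<lambda>S. m S + m' S) S = deriv_op N h c q br qm m S + deriv_op N h c q br qm m' S"
proof -
  let ?k = "\<lambda>m S. if 0 \<in> S then single 0 (qm (card S - 1)) * m S else m S"
  have "?k (\<lambda>S. m S + m' S) = (\<lambda>S. ?k m S + ?k m' S)"
    by (auto simp: distrib_left)
  then show ?thesis
    unfolding deriv_op_def by (simp add: scalar_deriv_add ann_add distrib_left)
qed

lemma deriv_op_scale: "deriv_op N h c q br qm (\<lambda>S. single 0 b * m S) S = single 0 b * deriv_op N h c q br qm m S"
proof -
  let ?k = "\<lambda>m S. if 0 \<in> S then single 0 (qm (card S - 1)) * m S else m S"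
  have "?k (\<lambda>S. single 0 b * m S) = (\<lambda>S. single 0 b * ?k m S)"
    by (auto simp: mult.left_commute)
  then show ?thesis
    unfolding deriv_op_def by (simp add: scalar_deriv_scale ann_scale distrib_left mult.left_commute)
qed

section \<open>Operators on homogeneous models with coefficients in a subring\<close>

definition basis_vec :: "nat set \<Rightarrow> (svar \<Rightarrow>\<^sub>0 nat) \<Rightarrow> 'k::comm_ring_1 \<Rightarrow> 'k model" where
  "basis_vec S0 \<mu> b S = (if S = S0 then single \<mu> b else 0)"

text \<open>The \<open>x\<close>-degree, as an integer since \<open>in_block\<close> is transported along operators of degree \<open>-1\<close>.\<close>

definition weight :: "nat \<Rightarrow> nat set \<Rightarrow> (svar \<Rightarrow>\<^sub>0 nat) \<Rightarrow> int" where
  "weight N S \<mu> = of_bool (0 \<in> S) + 2 * int (lookup \<mu> R_Var) +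
     (\<Sum>i<N. int (lookup \<mu> (S_Var i)))"

definition admissible :: "nat \<Rightarrow> nat set \<Rightarrow> (svar \<Rightarrow>\<^sub>0 nat) \<Rightarrow> bool" where
  "admissible N S \<mu> \<longleftrightarrow> S \<subseteq> {..N} \<and> Poly_Mapping.keys \<mu> \<subseteq> insert R_Var (S_Var ` {..<N})"

text \<open>One predicate tracks two facts: the coefficients stay in K (later
  \<open>T_ring N\<close>) and the degrees satisfy P. A degree shift of an operator is a
  precomposition of P; constant truth leaves only the first fact, and \<open>w = k\<close> describes
  a block.\<close>

definition in_block :: "nat \<Rightarrow> 'k set \<Rightarrow> (int \<Rightarrow> bool) \<Rightarrow> 'k::comm_ring_1 model \<Rightarrow> bool" where
  "in_block N K P m \<longleftrightarrow> (\<forall>S \<mu>. lookup (m S) \<mu> \<in> K \<and>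
     (lookup (m S) \<mu> \<noteq> 0 \<longrightarrow> admissible N S \<mu> \<and> P (weight N S \<mu>)))"

definition subring :: "'k::comm_ring_1 set \<Rightarrow> bool" where
  "subring K \<longleftrightarrow> 0 \<in> K \<and> 1 \<in> K \<and> (\<forall>a\<in>K. \<forall>b\<in>K. a + b \<in> K \<and> a * b \<in> K) \<and> (\<forall>a\<in>K. - a \<in> K)"

lemma subringD:
  assumes "subring K"
  shows "0 \<in> K" "1 \<in> K" "a \<in> K \<Longrightarrow> b \<in> K \<Longrightarrow> a + b \<in> K" "a \<in> K \<Longrightarrow> b \<in> K \<Longrightarrow> a * b \<in> K" "a \<in> K \<Longrightarrow> - a \<in> K"
  using assms by (auto simp: subring_def)

lemma subring_power: "subring K \<Longrightarrow> a \<in> K \<Longrightarrow> a ^ n \<in> K"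
  by (induction n) (auto intro: subringD)

lemma subring_sum: "subring K \<Longrightarrow> (\<And>i. i \<in> I \<Longrightarrow> f i \<in> K) \<Longrightarrow> sum f I \<in> K"
  by (induction I rule: infinite_finite_induct) (auto intro: subringD)

context
  fixes N :: nat and K :: "'k::comm_ring_1 set"
  assumes K: "subring K"
begin

lemma in_block_add: "in_block N K P m \<Longrightarrow> in_block N K P m' \<Longrightarrow> in_block N K P (\<lambda>S. m S + m' S)"
  unfolding in_block_def lookup_add by (metis add_0 subringD(3)[OF K])

lemma in_block_0: "in_block N K P (\<lambda>S. 0)"
  by (auto simp: in_block_def subringD[OF K])

lemma in_block_sum: "(\<And>i. i \<in> I \<Longrightarrow> in_block N K P (m i)) \<Longrightarrow> in_block N K P (\<lambda>S. \<Sum>i\<in>I. m i S)"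
  by (induction I rule: infinite_finite_induct) (auto intro: in_block_add in_block_0)

lemma in_block_scale: "b \<in> K \<Longrightarrow> in_block N K P m \<Longrightarrow> in_block N K P (\<lambda>S. single 0 b * m S)"
  unfolding in_block_def lookup_const_mult by (metis mult_zero_right subringD(4)[OF K])

lemma sgn_above_mult: "sgn_above N S u * (a :: 'b::comm_ring_1) = a \<or> sgn_above N S u * a = - a"
  by (simp add: sgn_above_def minus_one_power_iff)

lemma in_block_cre:
  assumes "u \<le> N" "in_block N K P m"
  shows "in_block N K (\<lambda>w. P (w - of_bool (u = 0))) (cre N u m)"
  unfolding in_block_def
proof (intro allI)
  fix S \<mu>
  have "lookup (cre N u m S) \<mu> = 0 \<or> u \<in> S \<and>
      (lookup (cre N u m S) \<mu> = lookup (m (S - {u})) \<mu> \<or>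
       lookup (cre N u m S) \<mu> = - lookup (m (S - {u})) \<mu>)"
    using sgn_above_mult[of S u "m (S - {u})"] by (auto simp: cre_def)
  then consider "lookup (cre N u m S) \<mu> = 0"
    | "u \<in> S" "lookup (cre N u m S) \<mu> = lookup (m (S - {u})) \<mu>"
    | "u \<in> S" "lookup (cre N u m S) \<mu> = - lookup (m (S - {u})) \<mu>"
    by blast
  moreover have "admissible N (S - {u}) \<mu> \<longleftrightarrow> admissible N S \<mu>"
    using assms(1) by (auto simp: admissible_def)
  moreover have "weight N (S - {u}) \<mu> = weight N S \<mu> - of_bool (u = 0)" if "u \<in> S"
    using that by (auto simp: weight_def)
  ultimately show "lookup (cre N u m S) \<mu> \<in> K \<and> (lookup (cre N u m S) \<mu> \<noteq> 0 \<longrightarrow>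
     admissible N S \<mu> \<and> P (weight N S \<mu> - of_bool (u = 0)))"
    using assms(2)[unfolded in_block_def, rule_format, of "S - {u}" \<mu>] subringD(1,5)[OF K]
    by cases simp_all
qed

lemma in_block_ann:
  assumes "u \<le> N" "in_block N K P m"
  shows "in_block N K (\<lambda>w. P (w + of_bool (u = 0))) (ann N u m)"
  unfolding in_block_def
proof (intro allI)
  fix S \<mu>
  have "lookup (ann N u m S) \<mu> = 0 \<or> u \<notin> S \<and>
      (lookup (ann N u m S) \<mu> = lookup (m (insert u S)) \<mu> \<or>
       lookup (ann N u m S) \<mu> = - lookup (m (insert u S)) \<mu>)"
    using sgn_above_mult[of S u "m (insert u S)"] by (auto simp: ann_def)
  then consider "lookup (ann N u m S) \<mu> = 0"
    | "u \<notin> S" "lookup (ann N u m S) \<mu> = lookup (m (insert u S)) \<mu>"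
    | "u \<notin> S" "lookup (ann N u m S) \<mu> = - lookup (m (insert u S)) \<mu>"
    by blast
  moreover have "admissible N (insert u S) \<mu> \<longleftrightarrow> admissible N S \<mu>"
    using assms(1) by (auto simp: admissible_def)
  moreover have "weight N (insert u S) \<mu> = weight N S \<mu> + of_bool (u = 0)" if "u \<notin> S"
    using that by (auto simp: weight_def)
  ultimately show "lookup (ann N u m S) \<mu> \<in> K \<and> (lookup (ann N u m S) \<mu> \<noteq> 0 \<longrightarrow>
     admissible N S \<mu> \<and> P (weight N S \<mu> + of_bool (u = 0)))"
    using assms(2)[unfolded in_block_def, rule_format, of "insert u S" \<mu>] subringD(1,5)[OF K]
    by cases simp_all
qed

lemma sum_lookup_single_S:
  "(\<Sum>i<N. int (lookup (single (S_Var j) 1 + \<mu>) (S_Var i))) =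
     of_bool (j < N) + (\<Sum>i<N. int (lookup \<mu> (S_Var i)))"
proof -
  have "(\<Sum>i<N. int (lookup (single (S_Var j) 1 + \<mu>) (S_Var i))) =
      (\<Sum>i<N. of_bool (i = j) + int (lookup \<mu> (S_Var i)))"
    by (intro sum.cong) (auto simp: lookup_add lookup_single)
  then show ?thesis by (simp add: sum.distrib)
qed

lemma weight_add_R: "weight N S (single R_Var 1 + \<mu>) = weight N S \<mu> + 2"
  by (simp add: weight_def lookup_add lookup_single)

lemma weight_add_S: "j < N \<Longrightarrow> weight N S (single (S_Var j) 1 + \<mu>) = weight N S \<mu> + 1"
  by (simp only: weight_def sum_lookup_single_S) (simp add: lookup_add lookup_single)

lemma admissible_add:
  "admissible N S (single u 1 + \<mu>) \<longleftrightarrow>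
     u \<in> insert R_Var (S_Var ` {..<N}) \<and> admissible N S \<mu>"
proof -
  have "Poly_Mapping.keys (single u (1::nat) + \<mu>) = insert u (Poly_Mapping.keys \<mu>)"
    by (auto simp: in_keys_iff lookup_add lookup_single when_def split: if_splits)
  then show ?thesis
    by (auto simp: admissible_def)
qed

lemma in_block_shift:
  assumes u: "u \<in> insert R_Var (S_Var ` {..<N})" and b: "b \<in> K" and m: "in_block N K P m"
  shows "in_block N K (\<lambda>w. P (w - (if u = R_Var then 2 else 1)))
    (\<lambda>S. single (single u 1) b * m S)"
  unfolding in_block_def
proof (intro allI)
  fix S \<mu>
  show "lookup (single (single u 1) b * m S) \<mu> \<in> K \<and>
     (lookup (single (single u 1) b * m S) \<mu> \<noteq> 0 \<longrightarrow>
     admissible N S \<mu> \<and> P (weight N S \<mu> - (if u = R_Var then 2 else 1)))"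
  proof (cases "\<exists>\<kappa>. \<mu> = single u 1 + \<kappa>")
    case True
    then obtain \<kappa> where \<mu>: "\<mu> = single u 1 + \<kappa>" by blast
    have w: "weight N S \<mu> - (if u = R_Var then 2 else 1) = weight N S \<kappa>"
      using u weight_add_R[of S \<kappa>] weight_add_S[of _ S \<kappa>] by (auto simp: \<mu>)
    show ?thesis
      using m[unfolded in_block_def, rule_format, of S \<kappa>] b u subringD(4)[OF K]
      unfolding w by (auto simp: \<mu> lookup_single_mult[of "single u (Suc 0)", simplified]
          admissible_add[unfolded One_nat_def])
  next
    case False
    then have "lookup (single (single u 1) b * m S) \<mu> = 0"
      by (intro lookup_single_mult_eq_0) blast
    then show ?thesis
      using subringD(1)[OF K] by simp
  qed
qed

lemma in_block_qdiff:
  assumes u: "u \<in> insert R_Var (S_Var ` {..<N})" and b: "b \<in> K" and m: "in_block N K P m"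
  shows "in_block N K (\<lambda>w. P (w + (if u = R_Var then 2 else 1))) (\<lambda>S. qdiff u b (m S))"
  unfolding in_block_def
proof (intro allI)
  fix S \<mu>
  have w: "weight N S (single u 1 + \<mu>) = weight N S \<mu> + (if u = R_Var then 2 else 1)"
    using u weight_add_R[of S \<mu>] weight_add_S[of _ S \<mu>] by auto
  have "(\<Sum>i\<le>lookup \<mu> u. b ^ i) \<in> K"
    by (intro subring_sum subring_power K b)
  then show "lookup (qdiff u b (m S)) \<mu> \<in> K \<and> (lookup (qdiff u b (m S)) \<mu> \<noteq> 0 \<longrightarrow>
     admissible N S \<mu> \<and> P (weight N S \<mu> + (if u = R_Var then 2 else 1)))"
    using m[unfolded in_block_def, rule_format, of S "single u 1 + \<mu>"] subringD(4)[OF K]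
    unfolding w lookup_qdiff admissible_add by (metis mult_zero_right)
qed

lemma in_block_qdil:
  assumes "b \<in> K" and m: "in_block N K P m"
  shows "in_block N K P (\<lambda>S. qdil u b (m S))"
  using m subring_power[OF K assms(1)] subringD(4)[OF K]
  unfolding in_block_def lookup_qdil by (metis mult_zero_right)

context
  fixes h :: 'k and c :: "nat \<Rightarrow> nat \<Rightarrow> 'k"
  assumes h: "h \<in> K" and c: "\<And>i j. i < N \<Longrightarrow> j < N \<Longrightarrow> c i j \<in> K"
begin

lemma in_block_gpair:
  assumes "u \<le> N" "v \<le> N" "in_block N K P m"
  shows "in_block N K (\<lambda>w. P (w - of_bool (u = 0) - of_bool (v = 0))) (\<lambda>S. gpair c u v * m S)"
proof -
  have two: "2 \<in> K"
    using subringD(3)[OF K subringD(2)[OF K] subringD(2)[OF K]] by simp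
  show ?thesis
    using in_block_shift[of R_Var 2 P m] in_block_shift[of "S_Var (u - 1)" 1 P m] in_block_shift[of "S_Var (v - 1)" 1 P m]
      in_block_scale[of "c (u - 1) (v - 1)" P m] subringD(2)[OF K] two c assms
    by (cases u; cases v) (simp_all add: gpair_def diff_diff_eq)
qed

text \<open>Contraction with \<open>z u\<close> loses degree 1 exactly if u = 0, and
  \<open>gpair c u v\<close> gives it back, so only multiplication by x changes the degree.\<close>

lemma in_block_vmul:
  assumes v: "v \<le> N" and m: "in_block N K P m"
  shows "in_block N K (\<lambda>w. P (w - of_bool (v = 0))) (vmul N h c v m)"
proof -
  have e: "vmul N h c v m = (\<lambda>S. cre N v m S + single 0 h * (\<Sum>u\<le>N. gpair c u v * ann N u m S))"
    by (simp add: vmul_def rho_def fun_eq_iff)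
  have "in_block N K (\<lambda>w. P (w - of_bool (v = 0))) (\<lambda>S. gpair c u v * ann N u m S)" if "u \<le> N" for u
    using in_block_gpair[OF that v in_block_ann[OF that m]] by (simp add: algebra_simps)
  then show ?thesis
    unfolding e by (intro in_block_add in_block_cre in_block_scale in_block_sum v m h) auto
qed

context
  fixes q :: 'k and br qm :: "nat \<Rightarrow> 'k"
  assumes q: "q \<in> K" and br: "\<And>n. br n \<in> K" and qm: "\<And>n. qm n \<in> K"
begin

lemma in_block_scalar_deriv:
  assumes m: "in_block N K P m"
  shows "in_block N K (\<lambda>w. P (w + 1)) (scalar_deriv N h c q m)"
proof -
  have e: "scalar_deriv N h c q m = (\<lambda>S. single 0 (1 + q) * vmul N h c 0 (\<lambda>S. qdiff R_Var (q ^ 2) (m S)) S +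
     single 0 2 * (\<Sum>i<N. vmul N h c (Suc i) (\<lambda>S. qdil R_Var (q ^ 2) (qdiff (S_Var i) q (m S))) S))"
    by (simp add: scalar_deriv_def fun_eq_iff)
  have two: "2 \<in> K"
    using subringD(3)[OF K subringD(2)[OF K] subringD(2)[OF K]] by simp
  have "in_block N K (\<lambda>w. P (w + 1)) (vmul N h c 0 (\<lambda>S. qdiff R_Var (q ^ 2) (m S)))"
    using in_block_vmul[OF _ in_block_qdiff[where u = R_Var, OF _ subring_power[OF K q] m], where v = 0]
    by (simp add: algebra_simps)
  moreover have "in_block N K (\<lambda>w. P (w + 1)) (vmul N h c (Suc i) (\<lambda>S. qdil R_Var (q ^ 2) (qdiff (S_Var i) q (m S))))"
    if "i < N" for i
    using in_block_vmul[OF _ in_block_qdil[OF subring_power[OF K q] in_block_qdiff[where u = "S_Var i", OF _ q m]], where v = "Suc i"] that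
    by (simp add: algebra_simps)
  ultimately show ?thesis
    unfolding e by (intro in_block_add in_block_scale in_block_sum two subringD(3)[OF K] subringD(2)[OF K] q) auto
qed

lemma in_block_deriv_op:
  assumes m: "in_block N K P m"
  shows "in_block N K (\<lambda>w. P (w + 1)) (deriv_op N h c q br qm m)"
proof -
  have e: "deriv_op N h c q br qm m = (\<lambda>S. single 0 (br (card S)) * ann N 0 m S +
     scalar_deriv N h c q (\<lambda>S. if 0 \<in> S then single 0 (qm (card S - 1)) * m S else m S) S)"
    by (simp add: deriv_op_def fun_eq_iff)
  have "in_block N K (\<lambda>w. P (w + 1)) (ann N 0 m)"
    using in_block_ann[OF _ m, of 0] by simp
  then have 1: "in_block N K (\<lambda>w. P (w + 1)) (\<lambda>S. single 0 (br (card S)) * ann N 0 m S)"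
    using br subringD(4)[OF K] unfolding in_block_def lookup_const_mult by (metis mult_zero_right)
  have 2: "in_block N K P (\<lambda>S. if 0 \<in> S then single 0 (qm (card S - 1)) * m S else m S)"
    unfolding in_block_def
  proof (intro allI)
    fix S \<mu>
    show "lookup (if 0 \<in> S then single 0 (qm (card S - 1)) * m S else m S) \<mu> \<in> K \<and>
      (lookup (if 0 \<in> S then single 0 (qm (card S - 1)) * m S else m S) \<mu> \<noteq> 0 \<longrightarrow>
        admissible N S \<mu> \<and> P (weight N S \<mu>))"
      using m[unfolded in_block_def, rule_format, of S \<mu>] subringD(4)[OF K qm]
      by (cases "lookup (m S) \<mu> = 0") (simp_all add: lookup_const_mult)
  qed
  show ?thesis
    unfolding e by (rule in_block_add[OF 1 in_block_scalar_deriv[OF 2]])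
qed

end

end

end

section \<open>Evaluation of scalars\<close>

lemma central_mult_swap: "central c \<Longrightarrow> (a * b) * (c * d) = (a * c) * (b * d)"
  by (metis central_left_commute mult.assoc)

lemma eval_T_add: "eval_T ys (t + t') = eval_T ys t + eval_T ys t'"
  unfolding eval_T_def
  by (rule setsum_keys_plus_distrib) (simp_all add: const_add distrib_right)

lemma eval_T_0 [simp]: "eval_T ys 0 = 0"
  by (simp add: eval_T_def)

lemma eval_T_single: "eval_T ys (single m b) = const b * prod_list (map (\<lambda>(i, j).
    rad_c ys i j ^ lookup m (C_Var i j)) [(i, j). i \<leftarrow> [0..<length ys], j \<leftarrow> [i..<length ys]])"
  by (simp add: eval_T_def)

lemma central_rad_c: "central (rad_c ys i j)"
  and central_rad_s: "central (rad_s x ys i)"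
  by (simp_all add: rad_c_def rad_s_def central_acomm_vecvar)

lemma central_rad_r: "central (rad_r x)"
proof -
  have "rad_r x = const half * acomm (vecvar x) (vecvar x)"
    using const_half_double[of "vecvar x * vecvar x"] by (simp add: rad_r_def acomm_def power2_eq_square distrib_left)
  then show ?thesis
    by (simp add: central_mult central_const central_acomm_vecvar)
qed

lemma central_eval_T: "central (eval_T ys t)"
  unfolding eval_T_def
  by (intro central_sum central_mult central_const central_prod_list)
     (auto intro!: central_power central_rad_c)

lemma eval_T_mult: "eval_T ys (t * t') = eval_T ys t * eval_T ys t'"
proof (induction t rule: poly_mapping_induct)
  case (single m b)
  show ?case
  proof (induction t' rule: poly_mapping_induct)
    case (single m' b')
    let ?p = "\<lambda>m. prod_list (map (\<lambda>(i, j). rad_c ys i j ^ lookup m (C_Var i j))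
      [(i, j). i \<leftarrow> [0..<length ys], j \<leftarrow> [i..<length ys]])"
    have "?p (m + m') = prod_list (map (\<lambda>ij. (case ij of (i, j) \<Rightarrow> rad_c ys i j ^ lookup m (C_Var i j)) *
       (case ij of (i, j) \<Rightarrow> rad_c ys i j ^ lookup m' (C_Var i j)))
      [(i, j). i \<leftarrow> [0..<length ys], j \<leftarrow> [i..<length ys]])"
      by (intro arg_cong[where f = prod_list] map_cong refl) (auto simp: lookup_add power_add)
    also have "\<dots> = ?p m * ?p m'"
      by (rule prod_list_mult_central) (auto intro: central_power central_rad_c)
    finally show ?case
      by (simp add: mult_single eval_T_single const_mult central_mult_swap[OF central_const])
  qed (simp_all add: distrib_left eval_T_add)
qed (simp_all add: distrib_right eval_T_add)

definition rs_mon :: "'v \<Rightarrow> 'v list \<Rightarrow> (svar \<Rightarrow>\<^sub>0 nat) \<Rightarrow> ('v, qcoeff) radial" where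
  "rs_mon x ys \<mu> = rs_monomial x ys (lookup \<mu> R_Var) (\<lambda>i. lookup \<mu> (S_Var i))"

lemma central_rs_mon: "central (rs_mon x ys \<mu>)"
  unfolding rs_mon_def rs_monomial_def
  by (intro central_mult central_power central_rad_r central_prod_list)
     (auto intro!: central_power central_rad_s)

lemma rs_mon_add: "rs_mon x ys (\<mu> + \<nu>) = rs_mon x ys \<mu> * rs_mon x ys \<nu>"
proof -
  let ?p = "\<lambda>\<mu>. prod_list (map (\<lambda>i. rad_s x ys i ^ lookup \<mu> (S_Var i)) [0..<length ys])"
  have "?p (\<mu> + \<nu>) = prod_list (map (\<lambda>i. rad_s x ys i ^ lookup \<mu> (S_Var i) *
      rad_s x ys i ^ lookup \<nu> (S_Var i)) [0..<length ys])"
    by (intro arg_cong[where f = prod_list] map_cong refl) (auto simp: lookup_add power_add)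
  also have "\<dots> = ?p \<mu> * ?p \<nu>"
    by (rule prod_list_mult_central) (auto intro: central_power central_rad_s)
  finally show ?thesis
    unfolding rs_mon_def rs_monomial_def lookup_add power_add
    by (simp add: central_mult_swap[OF central_power[OF central_rad_r]])
qed

lemma eval_A_eq: "eval_A x ys A = (\<Sum>\<mu>\<in>Poly_Mapping.keys A. eval_T ys (lookup A \<mu>) * rs_mon x ys \<mu>)"
  by (simp add: eval_A_def rs_mon_def)

lemma eval_A_add: "eval_A x ys (A + B) = eval_A x ys A + eval_A x ys B"
  unfolding eval_A_eq
  by (rule setsum_keys_plus_distrib) (simp_all add: eval_T_add distrib_right)

lemma eval_A_0 [simp]: "eval_A x ys 0 = 0"
  by (simp add: eval_A_def)

lemma eval_A_uminus: "eval_A x ys (- A) = - eval_A x ys A"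
  using eval_A_add[of x ys A "- A"] by (simp add: eq_neg_iff_add_eq_0 add.commute)

lemma eval_A_single: "eval_A x ys (single \<mu> t) = eval_T ys t * rs_mon x ys \<mu>"
  by (simp add: eval_A_eq)

text \<open>On polynomials outside \<open>A_ring\<close>, variables with an index out of range are evaluated to \<open>1\<close>.\<close>

lemma eval_A_mult: "eval_A x ys (A * B) = eval_A x ys A * eval_A x ys B"
proof (induction A rule: poly_mapping_induct)
  case (single m b)
  show ?case
  proof (induction B rule: poly_mapping_induct)
    case (single m' b')
    show ?case
      by (simp add: mult_single eval_A_single eval_T_mult rs_mon_add central_mult_swap[OF central_eval_T])
  qed (simp_all add: distrib_left eval_A_add)
qed (simp_all add: distrib_right eval_A_add)

lemma central_eval_A: "central (eval_A x ys A)"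
  unfolding eval_A_eq by (intro central_sum central_mult central_eval_T central_rs_mon)

lemma rs_mon_0 [simp]: "rs_mon x ys 0 = 1"
  by (simp add: rs_mon_def rs_monomial_def map_replicate_const)

lemma eval_T_const: "eval_T ys (single 0 b) = const b"
proof -
  have "prod_list (map (\<lambda>(i, j). rad_c ys i j ^ 0) L) = 1" for L
    by (induction L) auto
  then show ?thesis
    by (simp add: eval_T_single)
qed

lemma eval_T_1: "eval_T ys 1 = 1"
  using eval_T_const[of ys 1] by simp

lemma eval_A_const: "eval_A x ys (single 0 (single 0 b)) = const b"
  by (simp add: eval_A_single eval_T_const)

lemma prod_list_single_power:
  assumes "distinct L" "j \<in> set L"
  shows "prod_list (map (\<lambda>i. f i ^ (if i = j then 1 else 0)) L) = (f j :: 'a::monoid_mult)"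
  using assms
proof (induction L)
  case (Cons a L)
  have "prod_list (map (\<lambda>i. f i ^ (if i = a then 1 else 0)) L) = 1" if "a \<notin> set L"
    using that by (induction L) auto
  then show ?case using Cons by auto
qed simp

lemma rs_mon_R: "rs_mon x ys (single R_Var 1) = rad_r x"
proof -
  have "prod_list (map (\<lambda>i. rad_s x ys i ^ 0) L) = 1" for L
    by (induction L) auto
  then show ?thesis
    by (simp add: rs_mon_def rs_monomial_def lookup_single)
qed

lemma rs_mon_S:
  assumes "j < length ys"
  shows "rs_mon x ys (single (S_Var j) 1) = rad_s x ys j"
proof -
  have "prod_list (map (\<lambda>i. rad_s x ys i ^ lookup (single (S_Var j) 1) (S_Var i)) [0..<length ys]) =
      prod_list (map (\<lambda>i. rad_s x ys i ^ (if i = j then 1 else 0)) [0..<length ys])"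
    by (intro arg_cong[where f = prod_list]) (auto simp: lookup_single)
  also have "\<dots> = rad_s x ys j"
    using assms by (intro prod_list_single_power) auto
  finally show ?thesis
    by (simp add: rs_mon_def rs_monomial_def lookup_single_not_eq)
qed

text \<open>c_ij is symmetric, whereas \<open>T_ring\<close> admits only the names with i \<le>
  j.\<close>

definition cT :: "nat \<Rightarrow> nat \<Rightarrow> T_poly" where
  "cT i j = single (single (C_Var (min i j) (max i j)) 1) 1"

lemma distinct_pairs: "distinct [(i, j). i \<leftarrow> [0..<n], j \<leftarrow> [i..<n]]"
proof (rule distinct_concat)
  have "i = k" if "i < n" "map (Pair i) [i..<n] = map (Pair k) [k..<n]" for i k
  proof -
    have "(i, i) \<in> set (map (Pair k) [k..<n])"
      using that by (simp flip: that(2))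
    then show ?thesis by auto
  qed
  then show "distinct (map (\<lambda>i. map (Pair i) [i..<n]) [0..<n])"
    by (auto simp: distinct_map inj_on_def)
qed (auto simp: distinct_map inj_on_def)

lemma eval_T_cT:
  assumes "i < length ys" "j < length ys"
  shows "eval_T ys (cT i j) = rad_c ys i j"
proof -
  let ?L = "[(i, j). i \<leftarrow> [0..<length ys], j \<leftarrow> [i..<length ys]]"
  let ?i = "min i j" and ?j = "max i j"
  have "prod_list (map (\<lambda>(k, l). rad_c ys k l ^ lookup (single (C_Var ?i ?j) 1) (C_Var k l)) ?L) =
      prod_list (map (\<lambda>p. (case p of (k, l) \<Rightarrow> rad_c ys k l) ^ (if p = (?i, ?j) then 1 else 0)) ?L)"
  proof (intro arg_cong[where f = prod_list] map_cong refl)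
    fix p
    show "(case p of (k, l) \<Rightarrow> rad_c ys k l ^ lookup (single (C_Var ?i ?j) 1) (C_Var k l)) =
        (case p of (k, l) \<Rightarrow> rad_c ys k l) ^ (if p = (?i, ?j) then 1 else 0)"
      by (cases "p = (?i, ?j)") (auto simp: lookup_single when_def split: prod.splits)
  qed
  also have "\<dots> = (case (?i, ?j) of (k, l) \<Rightarrow> rad_c ys k l)"
    by (rule prod_list_single_power[OF distinct_pairs]) (use assms in \<open>auto intro!: bexI[of _ ?i] imageI\<close>)
  finally have "eval_T ys (cT i j) = rad_c ys ?i ?j"
    unfolding cT_def eval_T_single by simp
  then show ?thesis
    by (auto simp: min_def max_def rad_c_def acomm_def add.commute)
qed

lemma keys_plus_nat: "Poly_Mapping.keys (m + n) \<subseteq> Poly_Mapping.keys m \<union> Poly_Mapping.keys (n :: 'a \<Rightarrow>\<^sub>0 nat)"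
  by (rule keys_add)

lemma subring_T_ring: "subring (T_ring N)"
  unfolding subring_def
proof (intro conjI ballI)
  fix a b assume ab: "a \<in> T_ring N" "b \<in> T_ring N"
  show "a + b \<in> T_ring N"
    using ab keys_add[of a b] unfolding T_ring_def by blast
  show "a * b \<in> T_ring N"
    unfolding T_ring_def
  proof (clarify, rule ccontr)
    fix m v assume m: "m \<in> Poly_Mapping.keys (a * b)" and v: "v \<in> Poly_Mapping.keys m"
      and not: "\<nexists>i j. v = C_Var i j \<and> i \<le> j \<and> j < N"
    obtain k l where "k \<in> Poly_Mapping.keys a" "l \<in> Poly_Mapping.keys b" "m = k + l"
      using m keys_mult[of a b] by blast
    then show False
      using ab v not keys_plus_nat[of k l] unfolding T_ring_def by blast
  qed
next
  fix a assume "a \<in> T_ring N"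
  then show "- a \<in> T_ring N"
    by (simp add: T_ring_def in_keys_iff)
qed (auto simp: T_ring_def)

lemma single_in_T_ring: "single 0 b \<in> T_ring N"
  by (auto simp: T_ring_def)

lemma cT_in_T_ring: "i < N \<Longrightarrow> j < N \<Longrightarrow> cT i j \<in> T_ring N"
  by (auto simp: T_ring_def cT_def)

lemma cT_commute: "cT i j = cT j i"
  by (simp add: cT_def min.commute max.commute)

lemma in_block_A_ring: "in_block N (T_ring N) P m \<Longrightarrow> m S \<in> A_ring N"
  by (auto simp: in_block_def A_ring_def admissible_def in_keys_iff)

text \<open>Monomials as ordered products over a list, the form in which \<open>eval_T\<close> and
  \<open>rs_monomial\<close> build their values; the action can then be checked one variable at a
  time.\<close>

lemma single_monomial_eq_prod:
  fixes m :: "'a \<Rightarrow>\<^sub>0 nat"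
  assumes "distinct L" "Poly_Mapping.keys m \<subseteq> set L"
  shows "single m (1 :: 'k::comm_ring_1) =
    prod_list (map (\<lambda>v. single (single v 1) 1 ^ lookup m v) L)"
proof -
  have pow: "single (single v (1::nat)) (1 :: 'k) ^ n = single (single v n) 1"
    for v :: 'a and n
    by (induction n) (simp_all add: mult_single single_add[symmetric])
  have "prod_list (map (\<lambda>v. single (single v 1) (1 :: 'k) ^ f v) L) =
      single (sum_list (map (\<lambda>v. single v (f v)) L)) 1" for f
    unfolding pow by (induction L) (simp_all add: mult_single)
  moreover have "m = sum_list (map (\<lambda>v. single v (lookup m v)) L)"
  proof (rule poly_mapping_eqI)
    fix w
    have "lookup (\<Sum>v\<in>set L. single v (lookup m v)) w = lookup m w"
      using assms(2) by (auto simp: lookup_sum lookup_single when_def in_keys_iff)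
    then show "lookup m w = lookup (sum_list (map (\<lambda>v. single v (lookup m v)) L)) w"
      by (simp add: sum_list_distinct_conv_sum_set[OF assms(1)])
  qed
  ultimately show ?thesis by metis
qed

section \<open>The action of the radial algebra on the model\<close>

locale radial_variables =
  fixes x :: 'v and ys :: "'v list"
  assumes dist: "distinct (x # ys)" and univ: "set (x # ys) = UNIV"
begin

definition N :: nat where "N = length ys"

definition z :: "nat \<Rightarrow> ('v, qcoeff) radial" where "z k = vecvar ((x # ys) ! k)"

definition idx :: "'v \<Rightarrow> nat" where "idx v = (SOME k. k \<le> N \<and> (x # ys) ! k = v)"

lemma idx: "idx v \<le> N" "(x # ys) ! idx v = v"
proof -
  have "v \<in> set (x # ys)" using univ by simp
  then obtain k where "k < length (x # ys)" "(x # ys) ! k = v"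
    by (metis in_set_conv_nth)
  then have "k \<le> N \<and> (x # ys) ! k = v"
    by (simp add: N_def)
  then have "idx v \<le> N \<and> (x # ys) ! idx v = v"
    unfolding idx_def by (rule someI)
  then show "idx v \<le> N" "(x # ys) ! idx v = v" by auto
qed

lemma idx_nth: "k \<le> N \<Longrightarrow> idx ((x # ys) ! k) = k"
  using idx[of "(x # ys) ! k"] dist nth_eq_iff_index_eq[of "x # ys" "idx ((x # ys) ! k)" k]
  by (simp add: N_def)

lemma vecvar_eq_z: "vecvar v = z (idx v)"
  by (simp add: z_def idx)

lemma range_z: "range z \<subseteq> range vecvar"
  by (auto simp: z_def)

abbreviation hT :: T_poly where "hT \<equiv> single 0 half"

abbreviation vmul_T :: "nat \<Rightarrow> T_poly model \<Rightarrow> T_poly model" where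
  "vmul_T \<equiv> vmul N hT cT"

abbreviation aconst :: "qcoeff \<Rightarrow> A_poly" where
  "aconst b \<equiv> single 0 (single 0 b)"

abbreviation g :: "nat \<Rightarrow> nat \<Rightarrow> A_poly" where "g \<equiv> gpair cT"

lemma aconst_add: "aconst (a + b) = aconst a + aconst b" and aconst_mult: "aconst (a * b) = aconst a * aconst b"
  and aconst_uminus: "aconst (- a) = - aconst a"
  by (simp_all add: single_add mult_single single_uminus)

lemma g_commute: "g u v = g v u"
  by (intro gpair_commute cT_commute)

lemma vmul_T_vmul_T: "u \<le> N \<Longrightarrow> v \<le> N \<Longrightarrow> vmul_T u (vmul_T v m) S + vmul_T v (vmul_T u m) S = g u v * m S"
proof -
  have "single 0 hT + single 0 hT = (1 :: A_poly)"
    by (simp add: half_add_half flip: single_add)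
  then show "u \<le> N \<Longrightarrow> v \<le> N \<Longrightarrow> ?thesis"
    unfolding vmul_def by (intro rho_rho gpair_commute cT_commute) auto
qed

definition word_act :: "'v free_word \<Rightarrow> T_poly model \<Rightarrow> T_poly model" where
  "word_act w m = foldl (\<lambda>m v. vmul_T (idx v) m) m (letters w)"

lemma word_act_0: "word_act 0 m = m"
  by (simp add: word_act_def zero_free_word_def)

lemma word_act_plus: "word_act (w + w') m = word_act w' (word_act w m)"
  by (simp add: word_act_def plus_free_word_def)

lemma word_act_lin: "word_act w (\<lambda>S. m S + m' S) = (\<lambda>S. word_act w m S + word_act w m' S)"
  "word_act w (\<lambda>S. a * m S) = (\<lambda>S. a * word_act w m S)"
proof -
  have "foldl (\<lambda>m v. vmul_T (idx v) m) (\<lambda>S. m S + m' S) L =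
      (\<lambda>S. foldl (\<lambda>m v. vmul_T (idx v) m) m L S + foldl (\<lambda>m v. vmul_T (idx v) m) m' L S)" for L
    by (induction L arbitrary: m m') (simp_all add: vmul_add[abs_def])
  then show "word_act w (\<lambda>S. m S + m' S) = (\<lambda>S. word_act w m S + word_act w m' S)"
    by (simp add: word_act_def)
  have "foldl (\<lambda>m v. vmul_T (idx v) m) (\<lambda>S. a * m S) L =
      (\<lambda>S. a * foldl (\<lambda>m v. vmul_T (idx v) m) m L S)" for L
    by (induction L arbitrary: m) (simp_all add: vmul_scale[abs_def])
  then show "word_act w (\<lambda>S. a * m S) = (\<lambda>S. a * word_act w m S)"
    by (simp add: word_act_def)
qed

definition free_act :: "('v, qcoeff) free_alg \<Rightarrow> T_poly model \<Rightarrow> T_poly model" where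
  "free_act f m S = (\<Sum>w\<in>Poly_Mapping.keys f. aconst (lookup f w) * word_act w m S)"

lemma free_act_add: "free_act (f + f') m S = free_act f m S + free_act f' m S"
  unfolding free_act_def
  by (rule setsum_keys_plus_distrib) (simp_all add: aconst_add distrib_right del: single_add)

lemma free_act_0: "free_act 0 m S = 0"
  by (simp add: free_act_def)

lemma free_act_uminus: "free_act (- f) m S = - free_act f m S"
  using free_act_add[of f "- f" m S] by (simp add: free_act_0 eq_neg_iff_add_eq_0 add.commute)

lemma free_act_diff: "free_act (f - f') m S = free_act f m S - free_act f' m S"
  using free_act_add[of f "- f'" m S] by (simp add: free_act_uminus)

lemma free_act_single: "free_act (single w b) m S = aconst b * word_act w m S"
  by (simp add: free_act_def)

lemma free_act_lin: "free_act f (\<lambda>S. m S + m' S) = (\<lambda>S. free_act f m S + free_act f m' S)"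
  "free_act f (\<lambda>S. a * m S) = (\<lambda>S. a * free_act f m S)"
  by (auto simp: free_act_def word_act_lin fun_eq_iff distrib_left sum.distrib sum_distrib_left mult.left_commute)

lemma free_act_mult: "free_act (f * f') m = free_act f' (free_act f m)"
proof (induction f rule: poly_mapping_induct)
  case zero
  show ?case
    using free_act_lin(2)[of f' 0 m] by (simp add: free_act_0 fun_eq_iff free_act_0[abs_def])
next
  case (single w b)
  show ?case
  proof (induction f' rule: poly_mapping_induct)
    case (single w' b')
    have "free_act (single w b) m = (\<lambda>S. aconst b * word_act w m S)"
      by (simp add: free_act_single fun_eq_iff)
    then show ?case
      unfolding mult_single[of w b w' b']
      by (simp only: fun_eq_iff free_act_single word_act_plus word_act_lin aconst_mult ac_simps) simp
  qed (auto simp: fun_eq_iff free_act_0 distrib_left free_act_add)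
next
  case (add f g)
  have "free_act (f + g) m = (\<lambda>S. free_act f m S + free_act g m S)"
    by (simp add: free_act_add fun_eq_iff)
  with add show ?case
    by (simp add: fun_eq_iff distrib_right free_act_add free_act_lin)
qed

lemma free_act_gen: "free_act (free_gen v) m = vmul_T (idx v) m"
  by (simp add: free_gen_def fun_eq_iff free_act_single word_act_def)

text \<open>By the Clifford relation an anticommutator of generators acts as multiplication by the
  polynomial \<open>g\<close>, and such a multiplication commutes with every
  \<open>vmul_T\<close>.\<close>

lemma free_act_ideal: "f \<in> radial_ideal \<Longrightarrow> free_act f m S = 0"
proof (induction arbitrary: m S rule: radial_ideal.induct)
  case (gen f u v w f')
  have "free_act (acomm (free_gen u) (free_gen v)) m = (\<lambda>S. g (idx u) (idx v) * m S)" for m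
    using vmul_T_vmul_T[OF idx(1) idx(1), of v u m]
    by (simp add: acomm_def fun_eq_iff free_act_add free_act_mult free_act_gen g_commute[of "idx u" "idx v"])
  then have "free_act (commutator (acomm (free_gen u) (free_gen v)) (free_gen w)) m = (\<lambda>S. 0)" for m
    by (intro ext) (simp add: commutator_def free_act_diff free_act_mult free_act_gen vmul_scale)
  moreover have "free_act f' (\<lambda>S. 0) S = 0"
    using free_act_lin(2)[of f' 0 m] by (simp add: fun_eq_iff)
  ultimately show ?case
    by (simp add: free_act_mult)
qed (simp_all add: free_act_0 free_act_add)

definition act :: "('v, qcoeff) radial \<Rightarrow> T_poly model \<Rightarrow> T_poly model" where
  "act F = free_act (rep_radial F)"

text \<open>\<open>act\<close> is defined through a chosen representative; two representatives
  differ by an element of the ideal, which acts as zero.\<close>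

lemma act_abs: "act (abs_radial f) = free_act f"
proof -
  have "radial_rel (rep_radial (abs_radial f)) f"
    by (simp add: Quotient3_abs_rep[OF Quotient3_radial] flip: radial.abs_eq_iff)
  then show ?thesis
    using free_act_ideal[of "rep_radial (abs_radial f) - f"]
    by (simp add: act_def fun_eq_iff radial_rel_def free_act_diff)
qed

lemma abs_radial_cases: obtains f where "F = abs_radial f"
  by (metis Quotient3_abs_rep[OF Quotient3_radial])

lemma act_add: "act (F + G) m S = act F m S + act G m S"
proof -
  obtain f f' where "F = abs_radial f" "G = abs_radial f'"
    using abs_radial_cases by metis
  then show ?thesis by (simp add: plus_radial.abs_eq act_abs free_act_add)
qed

lemma act_mult: "act (F * G) m = act G (act F m)"
proof -
  obtain f f' where "F = abs_radial f" "G = abs_radial f'"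
    using abs_radial_cases by metis
  then show ?thesis by (simp add: times_radial.abs_eq act_abs free_act_mult)
qed

lemma act_const: "act (const b) m = (\<lambda>S. aconst b * m S)"
  by (simp add: const.abs_eq act_abs free_act_single fun_eq_iff word_act_0)

lemma act_z: "v \<le> N \<Longrightarrow> act (z v) m = vmul_T v m"
  by (simp add: z_def vecvar.abs_eq act_abs free_act_gen idx_nth)

lemma act_lin: "act F (\<lambda>S. m S + m' S) = (\<lambda>S. act F m S + act F m' S)"
  "act F (\<lambda>S. a * m S) = (\<lambda>S. a * act F m S)"
  by (simp_all add: act_def free_act_lin)

lemma act_0: "act 0 m S = 0"
  using act_const[of 0 m] by (simp add: fun_eq_iff)

lemma act_sum: "act (sum F I) m S = (\<Sum>i\<in>I. act (F i) m S)"
  by (induction I rule: infinite_finite_induct) (simp_all add: act_0 act_add)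

text \<open>Recovers a polynomial from its value in the radial algebra; through
  \<open>acts_as_eval_A\<close> it shows that \<open>eval_A\<close> loses nothing on
  \<open>A_ring N\<close>.\<close>

definition acts_as :: "('v, qcoeff) radial \<Rightarrow> A_poly \<Rightarrow> bool" where
  "acts_as F A \<longleftrightarrow> (\<forall>m. act F m = (\<lambda>S. A * m S))"

lemma acts_as_add: "acts_as F A \<Longrightarrow> acts_as G B \<Longrightarrow> acts_as (F + G) (A + B)"
  by (simp add: acts_as_def fun_eq_iff act_add distrib_right)

lemma acts_as_mult: "acts_as F A \<Longrightarrow> acts_as G B \<Longrightarrow> acts_as (F * G) (A * B)"
  by (simp add: acts_as_def fun_eq_iff act_mult mult.assoc mult.commute mult.left_commute)

lemma acts_as_const: "acts_as (const b) (aconst b)"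
  by (simp add: acts_as_def act_const)

lemma acts_as_1: "acts_as 1 1"
  using acts_as_const[of 1] by simp

lemma acts_as_0: "acts_as 0 0"
  using acts_as_const[of 0] by simp

lemma acts_as_power: "acts_as F A \<Longrightarrow> acts_as (F ^ n) (A ^ n)"
  by (induction n) (auto intro: acts_as_1 acts_as_mult)

lemma acts_as_sum: "(\<And>i. i \<in> I \<Longrightarrow> acts_as (F i) (A i)) \<Longrightarrow> acts_as (sum F I) (sum A I)"
  by (induction I rule: infinite_finite_induct) (auto intro: acts_as_0 acts_as_add)

lemma acts_as_prod_list: "(\<And>i. i \<in> set L \<Longrightarrow> acts_as (F i) (A i)) \<Longrightarrow> acts_as (prod_list (map F L)) (prod_list (map A L))"
  by (induction L) (auto intro: acts_as_1 acts_as_mult)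

lemma acts_as_acomm: "u \<le> N \<Longrightarrow> v \<le> N \<Longrightarrow> acts_as (acomm (z u) (z v)) (g u v)"
  using vmul_T_vmul_T[of v u] by (simp add: acts_as_def acomm_def fun_eq_iff act_add act_mult act_z g_commute[of u v])

lemma z_0: "z 0 = vecvar x" and z_Suc: "z (Suc i) = vecvar (ys ! i)"
  by (simp_all add: z_def)

lemma acts_as_rad_r: "acts_as (rad_r x) (single (single R_Var 1) 1)"
proof -
  have "rad_r x = const half * acomm (z 0) (z 0)"
    using const_half_double[of "vecvar x * vecvar x"] by (simp add: z_0 rad_r_def acomm_def power2_eq_square distrib_left)
  moreover have "single (single R_Var 1) 1 = aconst half * g 0 0"
  proof -
    have "single 0 half * (2 :: T_poly) = single 0 (half + half)"
      by (simp only: mult_2_right single_add)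
    then show ?thesis
      by (simp add: gpair_def mult_single half_add_half)
  qed
  ultimately show ?thesis
    using acts_as_mult[OF acts_as_const acts_as_acomm[of 0 0]] by simp
qed

lemma acts_as_rad_s: "i < N \<Longrightarrow> acts_as (rad_s x ys i) (single (single (S_Var i) 1) 1)"
  using acts_as_acomm[of 0 "Suc i"] by (simp add: rad_s_def z_0 z_Suc gpair_def)

lemma acts_as_rad_c: "i < N \<Longrightarrow> j < N \<Longrightarrow> acts_as (rad_c ys i j) (single 0 (cT i j))"
  using acts_as_acomm[of "Suc i" "Suc j"] by (simp add: rad_c_def z_Suc gpair_def)

text \<open>Membership in \<open>T_ring\<close> matters: a variable out of range has value 1 but
  does not multiply models by 1.\<close>

lemma acts_as_eval_T:
  assumes "t \<in> T_ring N"
  shows "acts_as (eval_T ys t) (single 0 t)"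
proof -
  let ?L = "[(i, j). i \<leftarrow> [0..<N], j \<leftarrow> [i..<N]]"
  have mon: "single m 1 = prod_list (map (\<lambda>(i, j). cT i j ^ lookup m (C_Var i j)) ?L)"
    if "m \<in> Poly_Mapping.keys t" for m
  proof -
    have "distinct (map (\<lambda>(i, j). C_Var i j) ?L)"
      unfolding distinct_map by (auto simp: distinct_pairs inj_on_def)
    moreover have "Poly_Mapping.keys m \<subseteq> set (map (\<lambda>(i, j). C_Var i j) ?L)"
      using assms that by (fastforce simp: T_ring_def image_iff)
    ultimately have "single m (1 :: qcoeff) = prod_list (map (\<lambda>v. single (single v 1) 1 ^
        lookup m v) (map (\<lambda>(i, j). C_Var i j) ?L))"
      by (rule single_monomial_eq_prod)
    also have "\<dots> = prod_list (map (\<lambda>(i, j). cT i j ^ lookup m (C_Var i j)) ?L)"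
      unfolding map_map by (intro arg_cong[where f = prod_list] map_cong refl) (auto simp: cT_def)
    finally show ?thesis .
  qed
  have prod: "single 0 (prod_list as) = prod_list (map (single 0) as)" for as :: "T_poly list"
    by (induction as) (simp_all add: mult_single[of 0 _ 0, simplified, symmetric])
  have "acts_as (prod_list (map (\<lambda>(i, j). rad_c ys i j ^ lookup m (C_Var i j)) ?L))
      (single 0 (single m 1))" if "m \<in> Poly_Mapping.keys t" for m
    unfolding mon[OF that] prod map_map
    by (rule acts_as_prod_list) (auto simp: single_0_power intro!: acts_as_power acts_as_rad_c)
  then have "acts_as (eval_T ys t) (\<Sum>m\<in>Poly_Mapping.keys t. aconst (lookup t m) *
      single 0 (single m 1))"
    unfolding eval_T_def N_def[symmetric] by (intro acts_as_sum acts_as_mult acts_as_const) 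
  moreover have "single 0 t' = (\<Sum>m\<in>Poly_Mapping.keys t'. aconst (lookup t' m) *
      single 0 (single m 1))" for t'
  proof (induction t' rule: poly_mapping_induct)
    case (add t t')
    then show ?case
      by (subst setsum_keys_plus_distrib) (simp_all add: aconst_add distrib_right single_add)
  qed (simp_all add: mult_single)
  ultimately show ?thesis by metis
qed

lemma acts_as_rs_mon:
  assumes "Poly_Mapping.keys \<mu> \<subseteq> insert R_Var (S_Var ` {..<N})"
  shows "acts_as (rs_mon x ys \<mu>) (single \<mu> 1)"
proof -
  let ?L = "R_Var # map S_Var [0..<N]"
  have "single \<mu> (1 :: T_poly) = prod_list (map (\<lambda>v. single (single v 1) 1 ^ lookup \<mu> v) ?L)"
    using assms by (intro single_monomial_eq_prod) (auto simp: distinct_map inj_on_def)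
  then show ?thesis
    unfolding rs_mon_def rs_monomial_def N_def[symmetric]
    by (auto simp: comp_def intro!: acts_as_mult acts_as_power acts_as_rad_r[simplified] acts_as_prod_list acts_as_rad_s[simplified])
qed

lemma acts_as_eval_A:
  assumes "A \<in> A_ring N"
  shows "acts_as (eval_A x ys A) A"
proof -
  have "acts_as (eval_T ys (lookup A \<mu>) * rs_mon x ys \<mu>) (single 0 (lookup A \<mu>) * single \<mu> 1)"
    if "\<mu> \<in> Poly_Mapping.keys A" for \<mu>
    using assms that by (intro acts_as_mult acts_as_eval_T acts_as_rs_mon) (auto simp: A_ring_def)
  then have "acts_as (eval_A x ys A) (\<Sum>\<mu>\<in>Poly_Mapping.keys A. single 0 (lookup A \<mu>) * single \<mu> 1)"
    unfolding eval_A_eq by (rule acts_as_sum)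
  moreover have "A' = (\<Sum>\<mu>\<in>Poly_Mapping.keys A'. single 0 (lookup A' \<mu>) * single \<mu> 1)" for A' :: A_poly
  proof (induction A' rule: poly_mapping_induct)
    case (add t t')
    then show ?case
      by (subst setsum_keys_plus_distrib) (simp_all add: distrib_right single_add)
  qed (simp_all add: mult_single)
  ultimately show ?thesis by metis
qed

end

lemma const_uminus: "const (- b) = - const b"
  using const_add[of b "- b"] by (simp add: eq_neg_iff_add_eq_0 add.commute)

context radial_variables
begin

section \<open>Coordinates in the model and expansion in wedges\<close>

definition vac :: "T_poly model" where "vac = basis_vec {} 0 1"

definition coord :: "('v, qcoeff) radial \<Rightarrow> T_poly model" where "coord F = act F vac"

definition expand :: "T_poly model \<Rightarrow> ('v, qcoeff) radial" where
  "expand m = (\<Sum>S\<in>Pow {..N}. zwedge z S * eval_A x ys (m S))"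

lemma expand_add: "expand (\<lambda>S. m S + m' S) = expand m + expand m'"
  by (simp add: expand_def eval_A_add distrib_left sum.distrib)

lemma expand_scale: "expand (\<lambda>S. A * m S) = expand m * eval_A x ys A"
  by (simp add: expand_def eval_A_mult sum_distrib_right mult.assoc centralD[OF central_eval_A, of x ys A])

lemma expand_0: "expand (\<lambda>S. 0) = 0"
  by (simp add: expand_def)

lemma expand_sum: "expand (\<lambda>S. \<Sum>i\<in>I. m i S) = (\<Sum>i\<in>I. expand (m i))"
  by (induction I rule: infinite_finite_induct) (simp_all add: expand_add expand_0)

lemma sum_Pow_insert:
  assumes "u \<le> N"
  shows "(\<Sum>S\<in>Pow {..N}. if u \<in> S then F (S - {u}) else 0) = (\<Sum>S\<in>Pow {..N}. if u \<in> S then 0 else F S)"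
proof -
  have "(\<Sum>S\<in>Pow {..N}. if u \<in> S then F (S - {u}) else 0) = (\<Sum>S\<in>{S \<in> Pow {..N}. u \<in> S}. F (S - {u}))"
    by (rule sum.inter_filter[symmetric]) simp
  also have "\<dots> = (\<Sum>S\<in>{S \<in> Pow {..N}. u \<notin> S}. F S)"
    by (rule sum.reindex_bij_witness[where i = "insert u" and j = "\<lambda>S. S - {u}"]) (use assms in auto)
  also have "\<dots> = (\<Sum>S\<in>Pow {..N}. if u \<in> S then 0 else F S)"
    by (subst sum.inter_filter) (auto intro!: sum.cong)
  finally show ?thesis .
qed

lemma sgn_above_insert_self: "sgn_above N' (insert v S) v = sgn_above N' S v"
  and sgn_above_remove_self: "sgn_above N' (S - {v}) v = sgn_above N' S v"
  by (auto simp: sgn_above_def intro!: arg_cong[where f = card] arg_cong[where f = "(^) (-1)"])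

lemma eval_A_sgn: "eval_A x ys (sgn_above N S u * A) = sgn_above N S u * eval_A x ys A"
  by (simp add: sgn_above_def minus_one_power_iff eval_A_uminus)

lemma eval_A_1: "eval_A x ys 1 = 1"
  using eval_A_const[of x ys 1] by simp

lemma eval_T_2: "eval_T ys 2 = 2"
  using eval_T_add[of ys 1 1] by (simp add: eval_T_1)

lemma sgn_above_commute: "F * (sgn_above N' S u * G) = sgn_above N' S u * (F * G)"
  by (simp add: sgn_above_def minus_one_power_iff)

lemma eval_A_g: "u \<le> N \<Longrightarrow> v \<le> N \<Longrightarrow> eval_A x ys (g u v) = acomm (z u) (z v)"
proof (cases u; cases v)
  assume "u = 0" "v = 0"
  then show ?thesis
    by (simp add: gpair_def eval_A_single rs_mon_R[simplified] eval_T_2 z_0 rad_r_def acomm_def power2_eq_square mult_2)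
next
  fix j assume "u \<le> N" "v \<le> N" "u = 0" "v = Suc j"
  then show ?thesis
    using rs_mon_S[of j ys x] by (simp add: gpair_def eval_A_single eval_T_1 N_def z_0 z_Suc rad_s_def)
next
  fix i assume "u \<le> N" "v \<le> N" "u = Suc i" "v = 0"
  then show ?thesis
    using rs_mon_S[of i ys x] by (simp add: gpair_def eval_A_single eval_T_1 N_def z_0 z_Suc rad_s_def acomm_def add.commute)
next
  fix i j assume "u \<le> N" "v \<le> N" "u = Suc i" "v = Suc j"
  then show ?thesis
    by (simp add: gpair_def eval_A_single eval_T_cT N_def z_Suc rad_c_def)
qed

lemma zwedge_z:
  assumes "S \<subseteq> {..N}"
  shows "zwedge z S * z v = (if v \<in> S then 0 else sgn_above N S v * zwedge z (insert v S)) +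
    const half * (\<Sum>u\<le>N. acomm (z u) (z v) * (if u \<in> S then sgn_above N S u * zwedge z (S - {u}) else 0))"
proof -
  have "(\<Sum>u\<in>S. sgn_above N S u * acomm (z u) (z v) * zwedge z (S - {u})) =
      (\<Sum>u\<in>S. acomm (z u) (z v) * (if u \<in> S then sgn_above N S u * zwedge z (S - {u}) else 0))"
    by (intro sum.cong refl) (simp add: sgn_above_def minus_one_power_iff)
  also have "\<dots> = (\<Sum>u\<le>N. acomm (z u) (z v) * (if u \<in> S then sgn_above N S u * zwedge z (S - {u}) else 0))"
    using assms by (intro sum.mono_neutral_left) auto
  finally show ?thesis
    using zwedge_mult[OF assms range_z, of v] by simp
qed

text \<open>The product formula \<open>zwedge_z\<close>, with its terms regrouped by the wedge that
  they produce; \<open>sum_Pow_insert\<close> matches the sets containing an index with those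
  lacking it.\<close>

lemma expand_vmul_T:
  assumes v: "v \<le> N"
  shows "expand (vmul_T v m) = expand m * z v"
proof -
  let ?e = "eval_A x ys"
  have e: "vmul_T v m = (\<lambda>S. cre N v m S + single 0 hT * (\<Sum>u\<le>N. g u v * ann N u m S))"
    by (simp add: vmul_def rho_def fun_eq_iff)
  have 1: "expand (cre N v m) = (\<Sum>S\<in>Pow {..N}. (if v \<in> S then 0 else sgn_above N S v * zwedge z (insert v S)) * ?e (m S))"
  proof -
    have "expand (cre N v m) = (\<Sum>S\<in>Pow {..N}. if v \<in> S then
        sgn_above N (S - {v}) v * zwedge z (insert v (S - {v})) * ?e (m (S - {v})) else 0)"
      unfolding expand_def cre_def
      by (intro sum.cong refl)
         (auto simp: eval_A_sgn sgn_above_remove_self insert_absorb sgn_above_commute mult.assoc)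
    also have "\<dots> = (\<Sum>S\<in>Pow {..N}. if v \<in> S then 0 else sgn_above N S v * zwedge z (insert v S) * ?e (m S))"
      by (rule sum_Pow_insert[OF v])
    also have "\<dots> = (\<Sum>S\<in>Pow {..N}. (if v \<in> S then 0 else sgn_above N S v * zwedge z (insert v S)) * ?e (m S))"
      by (intro sum.cong) auto
    finally show ?thesis .
  qed
  have 2: "expand (ann N u m) = (\<Sum>S\<in>Pow {..N}. (if u \<in> S then sgn_above N S u * zwedge z (S - {u}) else 0) * ?e (m S))"
    if "u \<le> N" for u
  proof -
    have "(\<Sum>S\<in>Pow {..N}. (if u \<in> S then sgn_above N S u * zwedge z (S - {u}) else 0) * ?e (m S)) =
       (\<Sum>S\<in>Pow {..N}. if u \<in> S then sgn_above N (S - {u}) u * zwedge z (S - {u}) * ?e (m (insert u (S - {u}))) else 0)"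
      by (intro sum.cong refl) (auto simp: sgn_above_remove_self insert_absorb)
    also have "\<dots> = (\<Sum>S\<in>Pow {..N}. if u \<in> S then 0 else sgn_above N S u * zwedge z S * ?e (m (insert u S)))"
      by (rule sum_Pow_insert[OF that])
    also have "\<dots> = expand (ann N u m)"
      unfolding expand_def ann_def
      by (intro sum.cong refl) (auto simp: eval_A_sgn sgn_above_commute mult.assoc)
    finally show ?thesis ..
  qed
  have "expand (vmul_T v m) = expand (cre N v m) + (\<Sum>u\<le>N. expand (ann N u m) * acomm (z u) (z v)) * const half"
    unfolding e using v
    by (simp add: expand_add expand_scale expand_sum eval_A_const eval_A_g)
  also have "(\<Sum>u\<le>N. expand (ann N u m) * acomm (z u) (z v)) * const half =
      (\<Sum>u\<le>N. const half * (acomm (z u) (z v) * expand (ann N u m)))"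
  proof -
    have c: "central (acomm (z u) (z v))" for u
      by (simp add: z_def central_acomm_vecvar)
    have "(\<Sum>u\<le>N. expand (ann N u m) * acomm (z u) (z v)) * const half =
        const half * (\<Sum>u\<le>N. expand (ann N u m) * acomm (z u) (z v))"
      by (rule centralD[OF central_const, symmetric])
    also have "\<dots> = const half * (\<Sum>u\<le>N. acomm (z u) (z v) * expand (ann N u m))"
      by (intro arg_cong2[where f = "(*)"] sum.cong refl centralD[OF c, symmetric])
    finally show ?thesis
      by (simp only: sum_distrib_left)
  qed
  also have "\<dots> = (\<Sum>u\<le>N. \<Sum>S\<in>Pow {..N}. const half * (acomm (z u) (z v) *
      (if u \<in> S then sgn_above N S u * zwedge z (S - {u}) else 0)) * ?e (m S))"
    by (intro sum.cong refl) (simp add: 2 sum_distrib_left mult.assoc)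
  also have "\<dots> = (\<Sum>S\<in>Pow {..N}. \<Sum>u\<le>N. const half * (acomm (z u) (z v) *
      (if u \<in> S then sgn_above N S u * zwedge z (S - {u}) else 0)) * ?e (m S))"
    by (rule sum.swap)
  also have "expand (cre N v m) + \<dots> = (\<Sum>S\<in>Pow {..N}. zwedge z S * z v * ?e (m S))"
    unfolding 1 sum.distrib[symmetric]
    by (intro sum.cong refl) (simp add: zwedge_z[of _ v] distrib_right sum_distrib_left sum_distrib_right)
  also have "\<dots> = expand m * z v"
    by (simp add: expand_def sum_distrib_right mult.assoc centralD[OF central_eval_A, of x ys _ "z v"])
  finally show ?thesis .
qed

text \<open>\<open>expand\<close> intertwines the action on models with right multiplication.
  Applied to the vacuum, which expands to 1, this yields \<open>expand_coord\<close>: every element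
  is a combination of wedges.\<close>

lemma expand_act: "expand (act F m) = expand m * F"
proof (induction F rule: radial_induct)
  case (const b)
  then show ?case by (simp add: act_const expand_scale eval_A_const)
next
  case (gen F v)
  then show ?case
    by (simp add: act_mult vecvar_eq_z act_z idx expand_vmul_T mult.assoc)
next
  case (add F G)
  have "act (F + G) m = (\<lambda>S. act F m S + act G m S)"
    by (simp add: act_add fun_eq_iff)
  with add show ?case by (simp add: expand_add distrib_left)
qed

lemma expand_vac: "expand vac = 1"
proof -
  have "expand vac = (\<Sum>S\<in>Pow {..N}. if S = {} then 1 else 0)"
    unfolding expand_def vac_def basis_vec_def
    by (intro sum.cong refl) (auto simp: zwedge_empty eval_A_1)
  then show ?thesis by simp
qed

lemma expand_coord: "expand (coord F) = F"
  by (simp add: coord_def expand_act expand_vac)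

lemma coord_add: "coord (F + G) S = coord F S + coord G S"
  by (simp add: coord_def act_add)

lemma coord_sum: "coord (sum F I) S = (\<Sum>i\<in>I. coord (F i) S)"
  by (simp add: coord_def act_sum)

lemma coord_z: "v \<le> N \<Longrightarrow> coord (F * z v) = vmul_T v (coord F)"
  by (simp add: coord_def act_mult act_z)

lemma coord_acts_as: "acts_as G A \<Longrightarrow> coord (F * G) S = A * coord F S"
  by (simp add: coord_def act_mult acts_as_def)

lemma coord_const_mult: "coord (const b * F) S = aconst b * coord F S"
  by (simp add: coord_def act_mult act_const act_lin)

lemma coord_0: "coord 0 S = 0"
  by (simp add: coord_def act_0)

lemma coord_uminus: "coord (- F) S = - coord F S"
  using coord_add[of F "- F" S] by (simp add: eq_neg_iff_add_eq_0 add.commute coord_0)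

lemma hT_in: "hT \<in> T_ring N"
  by (rule single_in_T_ring)

lemma in_block_vac: "in_block N (T_ring N) (\<lambda>_. True) vac"
  using subringD(1,2)[OF subring_T_ring[of N]]
  by (auto simp: in_block_def vac_def basis_vec_def lookup_one when_def admissible_def)

lemma in_block_coord: "in_block N (T_ring N) (\<lambda>_. True) (coord F)"
proof (induction F rule: radial_induct)
  case (const b)
  have "coord (const b) = (\<lambda>S. aconst b * vac S)"
    by (simp add: coord_def act_const)
  then show ?case
    using in_block_scale[OF subring_T_ring single_in_T_ring in_block_vac] by simp
next
  case (gen F v)
  then show ?case
    using in_block_vmul[OF subring_T_ring hT_in cT_in_T_ring idx(1), where P = "\<lambda>_. True" and m = "coord F"]
    by (simp add: vecvar_eq_z coord_z idx)
next
  case (add F G)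
  have "coord (F + G) = (\<lambda>S. coord F S + coord G S)"
    by (simp add: coord_add fun_eq_iff)
  with add show ?case
    by (simp add: in_block_add[OF subring_T_ring])
qed

lemma ann_basis_vec: "ann N u (basis_vec A 0 1) S = (if u \<in> A then sgn_above N A u * basis_vec (A - {u}) 0 1 S else 0)"
proof (cases "u \<in> A \<and> S = A - {u}")
  case True
  then show ?thesis by (auto simp: ann_def basis_vec_def insert_absorb sgn_above_remove_self)
qed (auto simp: ann_def basis_vec_def)

text \<open>Independence of the wedges. The product formula is solved for the wedge over S in terms
  of smaller wedges; the contraction part of \<open>vmul_T\<close> cancels what is subtracted, and
  only creation remains. Contraction removes a second index, hence the induction on the
  cardinality.\<close>

lemma coord_zwedge: "S \<subseteq> {..N} \<Longrightarrow> coord (zwedge z S) = basis_vec S 0 1"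
proof (induction "card S" arbitrary: S rule: less_induct)
  case less
  have fin: "finite S" using less.prems finite_subset by blast
  show ?case
  proof (cases "S = {}")
    case True
    then show ?thesis
      using act_const[of 1 vac] by (simp add: zwedge_empty coord_def vac_def)
  next
    case False
    \<comment> \<open>The largest index is split off, so that appending it needs no sign.\<close>
    define b where "b = Max S"
    define A where "A = S - {b}"
    have b: "b \<in> S" "b \<le> N" using False fin less.prems by (auto simp: b_def)
    have A: "A \<subseteq> {..N}" "b \<notin> A" "S = insert b A" "finite A" using less.prems b fin by (auto simp: A_def)
    have card: "card A < card S" unfolding A_def using b fin by (intro card_Diff1_less)
    have "A \<inter> {b<..N} = {}"
      using Max_ge[OF fin] by (fastforce simp: A_def b_def)
    then have sg: "sgn_above N A b = (1 :: A_poly)" "sgn_above N A b = (1 :: ('v, qcoeff) radial)"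
      by (simp_all add: sgn_above_def)
    have IH: "coord (zwedge z A) = basis_vec A 0 1"
      using less.hyps[OF card A(1)] .
    have IH': "coord (zwedge z (A - {u})) = basis_vec (A - {u}) 0 1" for u
    proof -
      have "card (A - {u}) < card S"
        using card card_mono[OF A(4), of "A - {u}"] by auto
      then show ?thesis using less.hyps A(1) by auto
    qed
    have eq: "zwedge z S = zwedge z A * z b + (- const half) * (\<Sum>u\<le>N. acomm (z u) (z b) * (if u \<in> A then sgn_above N A u * zwedge z (A - {u}) else 0))"
      using zwedge_z[OF A(1), of b] A(2,3) sg by (simp add: sgn_above_def)
    have half: "- const half = const (- half)"
      by (simp add: const_uminus)
    have sgn_coord: "coord (sgn_above N A u * F) S' = sgn_above N A u * coord F S'" for u F S'
      by (simp add: sgn_above_def minus_one_power_iff coord_uminus)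
    have ac: "coord (acomm (z u) (z b) * F) S' = g u b * coord F S'" if "u \<le> N" for u F S'
      using coord_acts_as[OF acts_as_acomm[OF that b(2)], of F S'] centralD[of "acomm (z u) (z b)" F] 
      by (simp add: z_def central_acomm_vecvar)
    have "coord (zwedge z S) S' = basis_vec S 0 1 S'" for S'
    proof -
      have "coord (zwedge z S) S' = vmul_T b (basis_vec A 0 1) S' +
          aconst (- half) * (\<Sum>u\<le>N. g u b * (if u \<in> A then sgn_above N A u * basis_vec (A - {u}) 0 1 S' else 0))"
        unfolding eq half coord_add coord_const_mult coord_sum coord_z[OF b(2)] IH
        by (intro arg_cong2[where f = "(+)"] arg_cong2[where f = "(*)"] sum.cong refl)
           (auto simp: ac sgn_coord IH' coord_0)
      also have "vmul_T b (basis_vec A 0 1) S' = cre N b (basis_vec A 0 1) S' +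
          aconst half * (\<Sum>u\<le>N. g u b * (if u \<in> A then sgn_above N A u * basis_vec (A - {u}) 0 1 S' else 0))"
        by (simp add: vmul_def rho_def ann_basis_vec)
      also have "cre N b (basis_vec A 0 1) S' = (basis_vec S 0 1 S' :: A_poly)"
      proof (cases "S' = S")
        case True
        then show ?thesis
          using sg(1) A(2,3) by (simp add: cre_def basis_vec_def sgn_above_insert_self)
      next
        case False
        then show ?thesis
          using A(3) by (auto simp: cre_def basis_vec_def)
      qed
      finally show ?thesis
        by (simp add: aconst_uminus del: single_uminus)
    qed
    then show ?thesis by blast
  qed
qed

lemma coord_zwedge_eval_A:
  assumes "S \<subseteq> {..N}" "A \<in> A_ring N"
  shows "coord (zwedge z S * eval_A x ys A) = (\<lambda>S'. if S' = S then A else 0)"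
  using coord_acts_as[OF acts_as_eval_A[OF assms(2)], of "zwedge z S"] coord_zwedge[OF assms(1)]
  by (auto simp: basis_vec_def fun_eq_iff)

lemma expand_single:
  assumes "S \<subseteq> {..N}"
  shows "expand (\<lambda>S'. if S' = S then A else 0) = zwedge z S * eval_A x ys A"
proof -
  have "expand (\<lambda>S'. if S' = S then A else 0) = (\<Sum>S'\<in>Pow {..N}. if S' = S then zwedge z S * eval_A x ys A else 0)"
    unfolding expand_def by (intro sum.cong) auto
  then show ?thesis using assms by simp
qed

end

section \<open>The right derivative and the block matrices\<close>

lemma fld_q_power: "fld_q ^ n = Fract ([:[:0, 1:]:] ^ n) 1"
  by (induction n) (simp_all add: fld_q_def One_fract_def)

text \<open>The Jackson operators with parameters q and q^2 are determined by their equation only if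
  the parameter is not 1. The value at q = 0 separates q^n from 1.\<close>

lemma coeff_q_power_neq_1: "n > 0 \<Longrightarrow> coeff_q ^ n \<noteq> 1"
proof -
  assume n: "n > 0"
  have e: "([:[:0, 1:]:] :: real poly poly) ^ n = [:[:0, 1:] ^ n:]"
    by (induction n) (simp_all add: one_pCons)
  have "([:0, 1:] :: real poly) ^ n \<noteq> 1"
  proof
    assume "([:0, 1:] :: real poly) ^ n = 1"
    then have "poly ([:0, 1:] ^ n) 0 = (1 :: real)" by simp
    with n show False by (simp add: zero_power)
  qed
  then have "fld_q ^ n \<noteq> 1"
    by (simp add: fld_q_power One_fract_def eq_fract e one_pCons)
  moreover have "Rep_qcoeff (coeff_q ^ n) = fld_q ^ n" for n
    by (induction n) (simp_all add: one_qcoeff.rep_eq times_qcoeff.rep_eq coeff_q.rep_eq)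
  ultimately show ?thesis
    by (metis one_qcoeff.rep_eq)
qed

context radial_variables
begin

lemma y_wedge_eq: "I \<subseteq> {..<N} \<Longrightarrow> y_wedge ys I = zwedge z (Suc ` I)"
  and xy_wedge_eq: "I \<subseteq> {..<N} \<Longrightarrow> xy_wedge x ys I = zwedge z (insert 0 (Suc ` I))"
proof -
  assume "I \<subseteq> {..<N}"
  then have fin: "finite I" using finite_subset by blast
  have 1: "sorted_list_of_set (Suc ` I) = map Suc (sorted_list_of_set I)"
    by (rule sorted_list_of_set_unique[THEN iffD1])
       (use fin in \<open>auto simp: strict_sorted_list_of_set sorted_wrt_map card_image\<close>)
  have 2: "sorted_list_of_set (insert 0 (Suc ` I)) = 0 # map Suc (sorted_list_of_set I)"
    by (rule sorted_list_of_set_unique[THEN iffD1])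
       (use fin in \<open>auto simp: strict_sorted_list_of_set sorted_wrt_map card_image\<close>)
  have 3: "map z (map Suc L) = map (\<lambda>i. vecvar (ys ! i)) L" for L
    by (simp add: z_Suc)
  show "y_wedge ys I = zwedge z (Suc ` I)"
    unfolding y_wedge_def zwedge_def 1 3 ..
  show "xy_wedge x ys I = zwedge z (insert 0 (Suc ` I))"
    unfolding xy_wedge_def zwedge_def 2 list.map(2) 3 z_0 ..
qed

lemma subset_cases:
  assumes "S \<subseteq> {..N}"
  obtains I where "I \<subseteq> {..<N}" "S = Suc ` I" | I where "I \<subseteq> {..<N}" "S = insert 0 (Suc ` I)"
proof -
  define I where "I = {i. Suc i \<in> S}"
  have I: "I \<subseteq> {..<N}"
    using assms by (auto simp: I_def)
  have "k \<in> S \<longleftrightarrow> k = 0 \<and> 0 \<in> S \<or> k \<in> Suc ` I" for k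
    by (cases k) (auto simp: I_def)
  then have "S = Suc ` I \<or> S = insert 0 (Suc ` I)"
    by (cases "0 \<in> S") auto
  then show ?thesis
    using I that by blast
qed

abbreviation qT :: T_poly where "qT \<equiv> single 0 coeff_q"

abbreviation brT :: "nat \<Rightarrow> T_poly" where "brT n \<equiv> single 0 (bracket_m_plus (- int n))"

abbreviation qmT :: "nat \<Rightarrow> T_poly" where "qmT n \<equiv> single 0 (q_m_plus (- int n))"

abbreviation model_deriv :: "T_poly model \<Rightarrow> T_poly model" where "model_deriv \<equiv> deriv_op N hT cT qT brT qmT"

lemma eval_A_2: "eval_A x ys 2 = 2"
  using eval_A_add[of x ys 1 1] by (simp add: eval_A_1)

lemma expand_scalar_deriv:
  assumes S: "S \<subseteq> {..N}"
  shows "expand (scalar_deriv N hT cT qT (\<lambda>S'. if S' = S then A else 0)) = zwedge z S * deriv_sc x ys A"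
proof -
  let ?m = "\<lambda>S'. if S' = S then A else 0"
  have e: "scalar_deriv N hT cT qT ?m = (\<lambda>S'. aconst (1 + coeff_q) * vmul_T 0 (\<lambda>S'. qdiff R_Var (qT ^ 2) (?m S')) S' +
     2 * (\<Sum>i<N. vmul_T (Suc i) (\<lambda>S'. qdil R_Var (qT ^ 2) (qdiff (S_Var i) qT (?m S'))) S'))"
    by (simp add: scalar_deriv_def fun_eq_iff single_add)
  have 1: "(\<lambda>S'. qdiff R_Var (qT ^ 2) (?m S')) = (\<lambda>S'. if S' = S then jackson R_Var (coeff_q ^ 2) A else 0)"
    by (auto simp: fun_eq_iff jackson_eq_qdiff coeff_q_power_neq_1 single_0_power)
  have 2: "(\<lambda>S'. qdil R_Var (qT ^ 2) (qdiff (S_Var i) qT (?m S'))) =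
     (\<lambda>S'. if S' = S then dilation R_Var (coeff_q ^ 2) (jackson (S_Var i) coeff_q A) else 0)" for i
    using coeff_q_power_neq_1[of 1]
    by (auto simp: fun_eq_iff jackson_eq_qdiff dilation_eq_qdil single_0_power)
  let ?J = "eval_A x ys (jackson R_Var (coeff_q ^ 2) A)"
  let ?K = "\<lambda>i. eval_A x ys (dilation R_Var (coeff_q ^ 2) (jackson (S_Var i) coeff_q A))"
  have "expand (scalar_deriv N hT cT qT ?m) = zwedge z S * ?J * z 0 * const (1 + coeff_q) +
      (\<Sum>i<N. zwedge z S * ?K i * z (Suc i)) * 2"
    unfolding e 1 2 expand_add expand_scale expand_sum eval_A_const eval_A_2
    by (simp add: expand_vmul_T expand_single[OF S])
  also have "zwedge z S * ?J * z 0 * const (1 + coeff_q) = zwedge z S * (const (1 + coeff_q) * vecvar x * ?J)"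
    by (simp only: z_0 mult.assoc centralD[OF central_eval_A, of x ys _ "vecvar x * const (1 + coeff_q)"])
       (simp only: centralD[OF central_const, of "1 + coeff_q" "vecvar x"] flip: mult.assoc)
  also have "(\<Sum>i<N. zwedge z S * ?K i * z (Suc i)) = zwedge z S * (\<Sum>i<N. vecvar (ys ! i) * ?K i)"
    by (simp add: z_Suc mult.assoc centralD[OF central_eval_A, of x ys _ "vecvar _"] sum_distrib_left)
  also have "\<dots> * 2 = zwedge z S * (2 * (\<Sum>i<N. vecvar (ys ! i) * ?K i))"
    by (simp only: mult_2 mult_2_right distrib_left)
  finally show ?thesis
    unfolding deriv_sc_def N_def[symmetric] distrib_left .
qed

definition radial_deriv :: "('v, qcoeff) radial \<Rightarrow> ('v, qcoeff) radial" where
  "radial_deriv F = expand (model_deriv (coord F))"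

lemma is_right_deriv_radial_deriv: "is_right_deriv x ys radial_deriv"
  unfolding is_right_deriv_def N_def[symmetric]
proof (intro conjI allI impI)
  fix F G
  have "coord (F + G) = (\<lambda>S. coord F S + coord G S)"
    by (simp add: coord_add fun_eq_iff)
  then have "model_deriv (coord (F + G)) = (\<lambda>S. model_deriv (coord F) S + model_deriv (coord G) S)"
    by (intro ext) (simp add: deriv_op_add)
  then show "radial_deriv (F + G) = radial_deriv F + radial_deriv G"
    by (simp add: radial_deriv_def expand_add)
next
  fix b F
  have "coord (const b * F) = (\<lambda>S. aconst b * coord F S)"
    by (simp add: coord_const_mult fun_eq_iff)
  then have "model_deriv (coord (const b * F)) = (\<lambda>S. aconst b * model_deriv (coord F) S)"
    by (intro ext) (simp add: deriv_op_scale)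
  then show "radial_deriv (const b * F) = const b * radial_deriv F"
    by (simp add: radial_deriv_def expand_scale eval_A_const centralD[OF central_const])
next
  fix I A assume I: "I \<subseteq> {..<N}" and A: "A \<in> A_ring N"
  let ?S = "Suc ` I"
  let ?m = "\<lambda>S'. if S' = ?S then A else 0"
  have S: "?S \<subseteq> {..N}" "0 \<notin> ?S" using I by auto
  have 1: "ann N 0 ?m = (\<lambda>S'. 0)"
    using S(2) by (auto simp: ann_def fun_eq_iff)
  have 2: "(\<lambda>S'. if 0 \<in> S' then single 0 (qmT (card S' - 1)) * ?m S' else ?m S') = ?m"
    using S(2) by (auto simp: fun_eq_iff)
  have "model_deriv ?m = scalar_deriv N hT cT qT ?m"
    unfolding fun_eq_iff deriv_op_def 1 2 by simp
  then show "radial_deriv (y_wedge ys I * eval_A x ys A) = y_wedge ys I * deriv_sc x ys A"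
    by (simp add: radial_deriv_def y_wedge_eq[OF I] coord_zwedge_eval_A[OF S(1) A] expand_scalar_deriv[OF S(1)])
next
  fix I A assume I: "I \<subseteq> {..<N}" and A: "A \<in> A_ring N"
  let ?T = "Suc ` I" and ?S = "insert 0 (Suc ` I)"
  let ?m = "\<lambda>S'. if S' = ?S then A else 0"
  have S: "?S \<subseteq> {..N}" "?T \<subseteq> {..N}" using I by auto
  have fin: "finite I" using I finite_subset by blast
  have cT: "card ?T = card I" and cS: "card ?S = Suc (card I)"
    using fin by (simp_all add: card_image)
  \<comment> \<open>All y-indices lie above index 0, so contracting x out of x \<and> y_I produces
    the sign (-1)^card I of the specification.\<close>
  have "?T \<inter> {0<..N} = ?T"
    using I by auto
  then have sg: "sgn_above N ?T 0 = (-1) ^ card I"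
    by (simp add: sgn_above_def cT)
  have ins: "insert 0 S' = ?S \<longleftrightarrow> S' = ?T" if "0 \<notin> S'" for S'
    using that by (intro insert_ident) auto
  have 1: "single 0 (brT (card S')) * ann N 0 ?m S' = (if S' = ?T then aconst (bracket_m_plus (- int (card I))) * ((-1) ^ card I * A) else 0)" for S'
    using sg by (auto simp: ann_def ins cT)
  have 2: "(\<lambda>S'. if 0 \<in> S' then single 0 (qmT (card S' - 1)) * ?m S' else ?m S') =
      (\<lambda>S'. aconst (q_m_plus (- int (card I))) * ?m S')"
    by (auto simp: fun_eq_iff cS)
  have "model_deriv ?m = (\<lambda>S'. (if S' = ?T then aconst (bracket_m_plus (- int (card I))) * ((-1) ^ card I * A) else 0) +
      aconst (q_m_plus (- int (card I))) * scalar_deriv N hT cT qT ?m S')"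
    unfolding fun_eq_iff deriv_op_def 1 2 scalar_deriv_scale by simp
  then have "radial_deriv (xy_wedge x ys I * eval_A x ys A) = zwedge z ?T * eval_A x ys (aconst (bracket_m_plus (- int (card I))) * ((-1) ^ card I * A)) +
     zwedge z ?S * deriv_sc x ys A * const (q_m_plus (- int (card I)))"
    by (simp only: radial_deriv_def xy_wedge_eq[OF I] coord_zwedge_eval_A[OF S(1) A] expand_scalar_deriv[OF S(1)]
       expand_add expand_scale expand_single[OF S(2)] eval_A_const)
  also have "eval_A x ys (aconst (bracket_m_plus (- int (card I))) * ((-1) ^ card I * A)) =
     (-1) ^ card I * (const (bracket_m_plus (- int (card I))) * eval_A x ys A)"
    by (simp add: eval_A_mult eval_A_const minus_one_power_iff eval_A_uminus eval_A_1)
  also have "zwedge z ?T * ((-1) ^ card I * (const (bracket_m_plus (- int (card I))) * eval_A x ys A)) =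
      (-1) ^ card I * const (bracket_m_plus (- int (card I))) * zwedge z ?T * eval_A x ys A"
  proof -
    have "zwedge z ?T * ((-1) ^ card I * F) = (-1) ^ card I * (zwedge z ?T * F)" for F
      by (simp add: minus_one_power_iff)
    then show ?thesis
      by (simp only: central_left_commute[OF central_const, of "zwedge z ?T"] mult.assoc)
  qed
  also have "zwedge z ?S * deriv_sc x ys A * const (q_m_plus (- int (card I))) =
      const (q_m_plus (- int (card I))) * zwedge z ?S * deriv_sc x ys A"
    unfolding mult.assoc[of "const (q_m_plus (- int (card I)))"] by (rule centralD[OF central_const, symmetric])
  finally show "radial_deriv (xy_wedge x ys I * eval_A x ys A) =
      (-1) ^ card I * const (bracket_m_plus (- int (card I))) * y_wedge ys I * eval_A x ys A +
      const (q_m_plus (- int (card I))) * xy_wedge x ys I * deriv_sc x ys A"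
    unfolding y_wedge_eq[OF I] xy_wedge_eq[OF I] .
qed

text \<open>The specification fixes an additive operator on the products of a wedge and a scalar,
  and by \<open>expand_coord\<close> every element is a sum of such products.\<close>

lemma is_right_deriv_unique:
  assumes D: "is_right_deriv x ys D"
  shows "D = radial_deriv"
proof
  fix F
  have sum: "E (sum f J) = (\<Sum>i\<in>J. E (f i))" if "is_right_deriv x ys E" for E and f :: "nat set \<Rightarrow> _" and J
  proof -
    have add: "E (F + G) = E F + E G" for F G
      using that[unfolded is_right_deriv_def, THEN conjunct1] by blast
    from add[of 0 0] have "E 0 = 0" by simp
    then show ?thesis
      by (induction J rule: infinite_finite_induct) (simp_all add: add)
  qed
  have y: "E (y_wedge ys I * eval_A x ys A) = y_wedge ys I * deriv_sc x ys A"
    if "is_right_deriv x ys E" "I \<subseteq> {..<N}" "A \<in> A_ring N" for E I A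
    using that(1)[unfolded is_right_deriv_def, THEN conjunct2, THEN conjunct2, THEN conjunct1, rule_format, of I A]
      that(2,3) by (simp only: N_def)
  have xy: "E (xy_wedge x ys I * eval_A x ys A) =
      (-1) ^ card I * const (bracket_m_plus (- int (card I))) * y_wedge ys I * eval_A x ys A +
      const (q_m_plus (- int (card I))) * xy_wedge x ys I * deriv_sc x ys A"
    if "is_right_deriv x ys E" "I \<subseteq> {..<N}" "A \<in> A_ring N" for E I A
    using that(1)[unfolded is_right_deriv_def, THEN conjunct2, THEN conjunct2, THEN conjunct2, rule_format, of I A]
      that(2,3) by (simp only: N_def)
  have eq: "D (zwedge z S * eval_A x ys A) = radial_deriv (zwedge z S * eval_A x ys A)"
    if S: "S \<subseteq> {..N}" and A: "A \<in> A_ring N" for S A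
    using S
  proof (cases rule: subset_cases)
    case (1 I)
    then show ?thesis
      using y[OF D 1(1) A] y[OF is_right_deriv_radial_deriv 1(1) A] by (simp add: y_wedge_eq)
  next
    case (2 I)
    then show ?thesis
      using xy[OF D 2(1) A] xy[OF is_right_deriv_radial_deriv 2(1) A] by (simp add: xy_wedge_eq)
  qed
  have "D (expand (coord F)) = radial_deriv (expand (coord F))"
    unfolding expand_def sum[OF D] sum[OF is_right_deriv_radial_deriv]
    by (intro sum.cong refl eq in_block_A_ring[OF in_block_coord]) auto
  then show "D F = radial_deriv F"
    by (simp add: expand_coord)
qed

lemma right_deriv_eq: "right_deriv x ys = radial_deriv"
  unfolding right_deriv_def
  by (rule the_equality) (fact is_right_deriv_radial_deriv, rule is_right_deriv_unique)

lemma block_op_eq: "block_op x ys F = expand (model_deriv (vmul_T 0 (coord F)))"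
  by (simp add: block_op_def right_deriv_eq radial_deriv_def coord_z flip: z_0)

end

section \<open>Indices, bases and matrices of the homogeneous blocks\<close>

definition block_index :: "nat \<Rightarrow> nat \<Rightarrow> (nat set \<times> (svar \<Rightarrow>\<^sub>0 nat)) set" where
  "block_index N k = {(S, \<mu>). admissible N S \<mu> \<and> weight N S \<mu> = int k}"

definition rs_exponent :: "nat \<Rightarrow> nat \<Rightarrow> (nat \<Rightarrow> nat) \<Rightarrow> svar \<Rightarrow>\<^sub>0 nat" where
  "rs_exponent N a \<beta> = single R_Var a + (\<Sum>i<N. single (S_Var i) (\<beta> i))"

lemma lookup_rs_exponent:
  "lookup (rs_exponent N a \<beta>) R_Var = a"
  "lookup (rs_exponent N a \<beta>) (S_Var i) = (if i < N then \<beta> i else 0)"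
proof -
  have "(\<Sum>j<N. lookup (single (S_Var j) (\<beta> j)) R_Var) = 0"
    by (simp add: lookup_single)
  then show "lookup (rs_exponent N a \<beta>) R_Var = a"
    by (simp add: rs_exponent_def lookup_add lookup_sum)
  have "(\<Sum>j<N. lookup (single (S_Var j) (\<beta> j)) (S_Var i)) = (\<Sum>j<N. if j = i then \<beta> j else 0)"
    by (intro sum.cong) (auto simp: lookup_single)
  then show "lookup (rs_exponent N a \<beta>) (S_Var i) = (if i < N then \<beta> i else 0)"
    by (simp add: rs_exponent_def lookup_add lookup_sum lookup_single)
qed

lemma rs_exponent_surj:
  assumes "Poly_Mapping.keys \<mu> \<subseteq> insert R_Var (S_Var ` {..<N})"
  shows "\<mu> = rs_exponent N (lookup \<mu> R_Var) (\<lambda>i. lookup \<mu> (S_Var i))"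
proof (rule poly_mapping_eqI)
  fix v
  show "lookup \<mu> v = lookup (rs_exponent N (lookup \<mu> R_Var)
      (\<lambda>i. lookup \<mu> (S_Var i))) v"
  proof (cases v)
    case (S_Var i)
    have "lookup \<mu> (S_Var i) = 0" if "\<not> i < N"
      using assms that by (fastforce simp: in_keys_iff subset_eq image_iff)
    then show ?thesis
      by (simp add: S_Var lookup_rs_exponent)
  qed (simp add: lookup_rs_exponent)
qed

lemma keys_rs_exponent: "Poly_Mapping.keys (rs_exponent N a \<beta>) \<subseteq> insert R_Var (S_Var ` {..<N})"
proof
  fix v assume "v \<in> Poly_Mapping.keys (rs_exponent N a \<beta>)"
  then show "v \<in> insert R_Var (S_Var ` {..<N})"
    by (cases v) (auto simp: in_keys_iff lookup_rs_exponent split: if_splits)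
qed

lemma rs_exponent_cong: "(\<And>i. i < N \<Longrightarrow> \<beta> i = \<gamma> i) \<Longrightarrow> rs_exponent N a \<beta> = rs_exponent N a \<gamma>"
  by (simp add: rs_exponent_def)

lemma weight_rs_exponent: "weight N S (rs_exponent N a \<beta>) = of_bool (0 \<in> S) + 2 * int a + (\<Sum>i<N. int (\<beta> i))"
  by (simp add: weight_def lookup_rs_exponent)

text \<open>All summands of the weight are nonnegative, so every exponent is bounded by k.\<close>

lemma finite_block_index: "finite (block_index N k)"
proof (rule finite_subset)
  let ?M = "(\<lambda>(a, \<beta>). rs_exponent N a \<beta>) ` ({..k} \<times> (PiE {..<N} (\<lambda>_. {..k})))"
  show "block_index N k \<subseteq> Pow {..N} \<times> ?M"
  proof
    fix p assume "p \<in> block_index N k"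
    then obtain S \<mu> where p: "p = (S, \<mu>)" and adm: "admissible N S \<mu>" and w: "weight N S \<mu> = int k"
      by (auto simp: block_index_def)
    let ?a = "lookup \<mu> R_Var" and ?\<beta> = "\<lambda>i. lookup \<mu> (S_Var i)"
    have ob: "0 \<le> (of_bool (0 \<in> S) :: int)"
      by simp
    have pos: "0 \<le> (\<Sum>i<N. int (?\<beta> i))"
      by (simp add: sum_nonneg)
    have a: "?a \<le> k"
      using w pos ob unfolding weight_def by linarith
    have b: "?\<beta> i \<le> k" if "i < N" for i
    proof -
      have "int (?\<beta> i) \<le> (\<Sum>i<N. int (?\<beta> i))"
        using that by (intro member_le_sum) auto
      then show ?thesis
        using w ob unfolding weight_def by linarith
    qed
    have "\<mu> = rs_exponent N ?a ?\<beta>"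
      using adm by (intro rs_exponent_surj) (simp add: admissible_def)
    \<comment> \<open>The finite set \<open>PiE\<close> consists of functions that are undefined off
      the index set, so the exponents are cut down accordingly.\<close>
    also have "\<dots> = rs_exponent N ?a (restrict ?\<beta> {..<N})"
      by (intro rs_exponent_cong) simp
    finally have "\<mu> = rs_exponent N ?a (restrict ?\<beta> {..<N})" .
    moreover have "restrict ?\<beta> {..<N} \<in> PiE {..<N} (\<lambda>_. {..k})"
      using b by auto
    ultimately have "\<mu> \<in> ?M"
      using a by (intro image_eqI[of _ _ "(?a, restrict ?\<beta> {..<N})"]) auto
    then show "p \<in> Pow {..N} \<times> ?M"
      using adm by (simp add: p admissible_def)
  qed
  show "finite (Pow {..N} \<times> ?M)"
    by (intro finite_cartesian_product finite_imageI finite_PiE) auto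
qed

context radial_variables
begin

definition block_vec :: "nat set \<times> (svar \<Rightarrow>\<^sub>0 nat) \<Rightarrow> ('v, qcoeff) radial" where
  "block_vec p = zwedge z (fst p) * rs_mon x ys (snd p)"

lemma coord_block_vec:
  assumes "admissible N S \<mu>"
  shows "coord (block_vec (S, \<mu>)) = basis_vec S \<mu> 1"
proof -
  have "single \<mu> 1 \<in> A_ring N"
    using assms subringD(2)[OF subring_T_ring] by (auto simp: A_ring_def admissible_def)
  then show ?thesis
    using coord_zwedge_eval_A[of S "single \<mu> 1"] assms
    by (simp add: block_vec_def admissible_def eval_A_single eval_T_1 basis_vec_def fun_eq_iff)
qed

lemma basis_vec_inj: "basis_vec S \<mu> (1 :: T_poly) = basis_vec S' \<mu>' 1 \<Longrightarrow> (S, \<mu>) = (S', \<mu>')"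
proof -
  assume eq: "basis_vec S \<mu> (1 :: T_poly) = basis_vec S' \<mu>' 1"
  have "lookup (basis_vec S' \<mu>' (1 :: T_poly) S) \<mu> = 1"
    by (simp flip: eq add: basis_vec_def)
  then show ?thesis
    by (auto simp: basis_vec_def lookup_single when_def split: if_splits)
qed

text \<open>\<open>block_basis\<close> is a set of algebra elements. Only because different indices
  give different elements does an enumeration of this set have one entry per index.\<close>

lemma inj_block_vec: "inj_on block_vec (block_index N k)"
proof (rule inj_onI)
  fix p p' assume p: "p \<in> block_index N k" "p' \<in> block_index N k" and eq: "block_vec p = block_vec p'"
  obtain S \<mu> S' \<mu>' where pp: "p = (S, \<mu>)" "p' = (S', \<mu>')"
    by (metis surj_pair)
  have "coord (block_vec p) = coord (block_vec p')"
    using eq by simp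
  then show "p = p'"
    using p basis_vec_inj[of S \<mu> S' \<mu>'] by (simp add: pp block_index_def coord_block_vec)
qed

lemma rs_monomial_eq: "rs_monomial x ys a \<beta> = rs_mon x ys (rs_exponent N a \<beta>)"
proof -
  have "map (\<lambda>i. rad_s x ys i ^ \<beta> i) [0..<length ys] =
      map (\<lambda>i. rad_s x ys i ^ (if i < N then \<beta> i else 0)) [0..<length ys]"
    by (simp add: N_def)
  then show ?thesis
    by (simp only: rs_mon_def rs_monomial_def lookup_rs_exponent)
qed

lemma block_basis_eq: "block_basis x ys k = block_vec ` block_index N k"
proof (intro equalityI subsetI)
  fix F assume "F \<in> block_basis x ys k"
  then consider
      (y) I a \<beta> where "I \<subseteq> {..<N}" "2 * a + (\<Sum>i<N. \<beta> i) = k" "F = y_wedge ys I * rs_monomial x ys a \<beta>"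
    | (xy) I a \<beta> where "I \<subseteq> {..<N}" "1 + 2 * a + (\<Sum>i<N. \<beta> i) = k" "F = xy_wedge x ys I * rs_monomial x ys a \<beta>"
    unfolding block_basis_def N_def by blast
  then show "F \<in> block_vec ` block_index N k"
  proof cases
    case y
    then have "F = block_vec (Suc ` I, rs_exponent N a \<beta>)"
      by (simp add: block_vec_def y_wedge_eq rs_monomial_eq)
    moreover have "(Suc ` I, rs_exponent N a \<beta>) \<in> block_index N k"
      using y keys_rs_exponent[of N a \<beta>] by (auto simp: block_index_def admissible_def weight_rs_exponent)
    ultimately show ?thesis by blast
  next
    case xy
    then have "F = block_vec (insert 0 (Suc ` I), rs_exponent N a \<beta>)"
      by (simp add: block_vec_def xy_wedge_eq rs_monomial_eq)
    moreover have "(insert 0 (Suc ` I), rs_exponent N a \<beta>) \<in> block_index N k"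
      using xy keys_rs_exponent[of N a \<beta>] by (auto simp: block_index_def admissible_def weight_rs_exponent)
    ultimately show ?thesis by blast
  qed
next
  fix F assume "F \<in> block_vec ` block_index N k"
  then obtain S \<mu> where F: "F = block_vec (S, \<mu>)" and adm: "admissible N S \<mu>" and w: "weight N S \<mu> = int k"
    by (auto simp: block_index_def)
  define a \<beta> where "a = lookup \<mu> R_Var" and "\<beta> i = lookup \<mu> (S_Var i)" for i
  have mu: "\<mu> = rs_exponent N a \<beta>"
    using rs_exponent_surj[of \<mu> N] adm unfolding a_def \<beta>_def admissible_def by blast
  have "int (of_bool (0 \<in> S) + 2 * a + (\<Sum>i<N. \<beta> i)) = int k"
    using w by (simp add: mu weight_rs_exponent)
  then have w': "of_bool (0 \<in> S) + 2 * a + (\<Sum>i<N. \<beta> i) = k"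
    by (simp only: of_nat_eq_iff)
  have "S \<subseteq> {..N}" using adm by (simp add: admissible_def)
  then show "F \<in> block_basis x ys k"
  proof (cases rule: subset_cases)
    case (1 I)
    then have "F = y_wedge ys I * rs_monomial x ys a \<beta>"
      by (simp add: F block_vec_def y_wedge_eq rs_monomial_eq mu)
    moreover have "2 * a + (\<Sum>i<N. \<beta> i) = k"
      using w' 1(2) by auto
    ultimately show ?thesis
      using 1(1) unfolding block_basis_def N_def by blast
  next
    case (2 I)
    then have "F = xy_wedge x ys I * rs_monomial x ys a \<beta>"
      by (simp add: F block_vec_def xy_wedge_eq rs_monomial_eq mu)
    moreover have "1 + 2 * a + (\<Sum>i<N. \<beta> i) = k"
      using w' 2(2) by auto
    ultimately show ?thesis
      using 2(1) unfolding block_basis_def N_def by blast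
  qed
qed

lemma expand_in_block:
  assumes m: "in_block N (T_ring N) (\<lambda>w. w = int k) m"
  shows "expand m = (\<Sum>p\<in>block_index N k. block_vec p * eval_T ys (lookup (m (fst p)) (snd p)))"
proof -
  let ?t = "\<lambda>p. block_vec p * eval_T ys (lookup (m (fst p)) (snd p))"
  have "expand m = (\<Sum>S\<in>Pow {..N}. \<Sum>\<mu>\<in>Poly_Mapping.keys (m S). ?t (S, \<mu>))"
    unfolding expand_def eval_A_eq sum_distrib_left
    by (intro sum.cong refl) (simp add: block_vec_def mult.assoc centralD[OF central_rs_mon])
  also have "\<dots> = (\<Sum>p\<in>Sigma (Pow {..N}) (\<lambda>S. Poly_Mapping.keys (m S)). ?t p)"
    by (subst sum.Sigma) (auto intro!: sum.cong)
  also have "\<dots> = (\<Sum>p\<in>block_index N k. ?t p)"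
  proof (rule sum.mono_neutral_left[OF finite_block_index])
    show "Sigma (Pow {..N}) (\<lambda>S. Poly_Mapping.keys (m S)) \<subseteq> block_index N k"
      using m by (auto simp: in_block_def block_index_def in_keys_iff)
    show "\<forall>p\<in>block_index N k - Sigma (Pow {..N}) (\<lambda>S. Poly_Mapping.keys (m S)). ?t p = 0"
      by (auto simp: block_index_def admissible_def in_keys_iff)
  qed
  finally show ?thesis .
qed

text \<open>Column p of the block matrix, in model coordinates.\<close>

definition image_vec :: "nat set \<times> (svar \<Rightarrow>\<^sub>0 nat) \<Rightarrow> T_poly model" where
  "image_vec p = model_deriv (vmul_T 0 (basis_vec (fst p) (snd p) 1))"

lemma in_block_image_vec:
  assumes "p \<in> block_index N k"
  shows "in_block N (T_ring N) (\<lambda>w. w = int k) (image_vec p)"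
proof -
  have "in_block N (T_ring N) (\<lambda>w. w = int k) (basis_vec (fst p) (snd p) 1)"
    using assms subringD(1,2)[OF subring_T_ring[of N]]
    by (auto simp: in_block_def basis_vec_def lookup_single when_def block_index_def)
  from in_block_deriv_op[OF subring_T_ring hT_in cT_in_T_ring single_in_T_ring single_in_T_ring single_in_T_ring
      in_block_vmul[OF subring_T_ring hT_in cT_in_T_ring le0 this]]
  show ?thesis
    by (simp add: image_vec_def)
qed

lemma block_op_block_vec:
  assumes "p \<in> block_index N k"
  shows "block_op x ys (block_vec p) = (\<Sum>p'\<in>block_index N k. block_vec p' * eval_T ys (lookup (image_vec p (fst p')) (snd p')))"
proof -
  have "coord (block_vec p) = basis_vec (fst p) (snd p) 1"
    using assms coord_block_vec by (auto simp: block_index_def)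
  then show ?thesis
    using expand_in_block[OF in_block_image_vec[OF assms]] by (simp add: block_op_eq image_vec_def)
qed

lemma coord_block_vec_mult:
  assumes "p \<in> block_index N k" "p' \<in> block_index N k" "t \<in> T_ring N"
  shows "lookup (coord (block_vec p * eval_T ys t) (fst p')) (snd p') = (if p = p' then t else 0)"
proof -
  obtain S \<mu> S' \<mu>' where pp: "p = (S, \<mu>)" "p' = (S', \<mu>')"
    by (metis surj_pair)
  have "coord (block_vec p) = basis_vec S \<mu> 1"
    using assms(1) by (simp add: pp block_index_def coord_block_vec)
  then show ?thesis
    by (simp add: pp coord_acts_as[OF acts_as_eval_T[OF assms(3)]] basis_vec_def mult_single lookup_single when_def)
qed

text \<open>Existence is the expansion of the images in the block. For uniqueness,
  \<open>coord\<close> extracts each coefficient from the defining equation, so two admissible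
  matrices agree entry by entry.\<close>

lemma matrix_wrt_block:
  assumes ps: "distinct ps" "set ps = block_index N k"
  shows "matrix_wrt ys (map block_vec ps) (block_op x ys) =
    mat (length ps) (length ps) (\<lambda>(i, j). lookup (image_vec (ps ! j) (fst (ps ! i))) (snd (ps ! i)))"
proof -
  let ?n = "length ps"
  let ?M = "mat ?n ?n (\<lambda>(i, j). lookup (image_vec (ps ! j) (fst (ps ! i))) (snd (ps ! i)))"
  define ok where "ok M \<longleftrightarrow> M \<in> carrier_mat ?n ?n \<and> (\<forall>i<?n. \<forall>j<?n. M $$ (i, j) \<in> T_ring N) \<and>
      (\<forall>j<?n. block_op x ys (map block_vec ps ! j) = (\<Sum>i<?n. map block_vec ps ! i * eval_T ys (M $$ (i, j))))" for M
  have idx: "ps ! i \<in> block_index N k" if "i < ?n" for i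
    using nth_mem[OF that] ps(2) by simp
  have bij: "bij_betw ((!) ps) {..<?n} (block_index N k)"
    using ps by (intro bij_betw_nth) simp_all
  have M: "ok ?M"
    unfolding ok_def
  proof (intro conjI allI impI)
    fix i j assume ij: "i < ?n" "j < ?n"
    show "?M $$ (i, j) \<in> T_ring N"
      using in_block_image_vec[OF idx[OF ij(2)]] ij by (simp add: in_block_def)
  next
    fix j assume j: "j < ?n"
    have "block_op x ys (block_vec (ps ! j)) = (\<Sum>i<?n. block_vec (ps ! i) *
        eval_T ys (lookup (image_vec (ps ! j) (fst (ps ! i))) (snd (ps ! i))))"
      unfolding block_op_block_vec[OF idx[OF j]] by (rule sum.reindex_bij_betw[OF bij, symmetric])
    then show "block_op x ys (map block_vec ps ! j) = (\<Sum>i<?n. map block_vec ps ! i * eval_T ys (?M $$ (i, j)))"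
      using j by simp
  qed simp
  have entry: "M $$ (i, j) = lookup (coord (block_op x ys (block_vec (ps ! j))) (fst (ps ! i))) (snd (ps ! i))"
    if M: "ok M" and ij: "i < ?n" "j < ?n" for M i j
  proof -
    have MT: "M $$ (i', j) \<in> T_ring N" if "i' < ?n" for i'
      using M that ij(2) unfolding ok_def by blast
    have "block_op x ys (map block_vec ps ! j) = (\<Sum>i'<?n. map block_vec ps ! i' * eval_T ys (M $$ (i', j)))"
      using M ij(2) unfolding ok_def by blast
    then have "block_op x ys (block_vec (ps ! j)) = (\<Sum>i'<?n. block_vec (ps ! i') * eval_T ys (M $$ (i', j)))"
      using ij(2) by simp
    then have "lookup (coord (block_op x ys (block_vec (ps ! j))) (fst (ps ! i))) (snd (ps ! i)) =
        (\<Sum>i'<?n. lookup (coord (block_vec (ps ! i') * eval_T ys (M $$ (i', j))) (fst (ps ! i))) (snd (ps ! i)))"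
      by (simp add: coord_sum lookup_sum)
    also have "\<dots> = (\<Sum>i'<?n. if i' = i then M $$ (i', j) else 0)"
    proof (intro sum.cong refl)
      fix i' assume "i' \<in> {..<?n}"
      then have i': "i' < ?n" by simp
      show "lookup (coord (block_vec (ps ! i') * eval_T ys (M $$ (i', j))) (fst (ps ! i))) (snd (ps ! i)) =
          (if i' = i then M $$ (i', j) else 0)"
        unfolding coord_block_vec_mult[OF idx[OF i'] idx[OF ij(1)] MT[OF i']]
        using nth_eq_iff_index_eq[OF ps(1) i' ij(1)] by simp
    qed
    finally show ?thesis using ij by simp
  qed
  show ?thesis
    unfolding matrix_wrt_def length_map N_def[symmetric] ok_def[symmetric]
  proof (rule the_equality)
    show "ok ?M" by (rule M)
    fix M' assume M': "ok M'"
    have dim: "dim_row M' = ?n" "dim_col M' = ?n"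
      using M' by (auto simp: ok_def)
    show "M' = ?M"
      by (rule eq_matI) (simp_all only: dim dim_row_mat dim_col_mat entry[OF M'] entry[OF M])
  qed
qed

text \<open>\<open>endo_det\<close> chooses its enumeration by \<open>SOME\<close>. Pulling that
  list back along \<open>block_vec\<close> gives some enumeration \<open>ps\<close> of the indices,
  and nothing more may be assumed about its order.\<close>

lemma block_det_eq:
  obtains ps where "distinct ps" "set ps = block_index N k"
    "block_det x ys k = det (mat (length ps) (length ps)
      (\<lambda>(i, j). lookup (image_vec (ps ! j) (fst (ps ! i))) (snd (ps ! i))))"
proof -
  define es where "es = (SOME es. distinct es \<and> set es = block_basis x ys k)"
  have "finite (block_basis x ys k)"
    by (simp add: block_basis_eq finite_block_index)
  then have "\<exists>es. distinct es \<and> set es = block_basis x ys k"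
    using finite_distinct_list by blast
  then have es: "distinct es \<and> set es = block_basis x ys k"
    unfolding es_def by (rule someI_ex)
  define ps where "ps = map (the_inv_into (block_index N k) block_vec) es"
  have "map block_vec ps = es"
    unfolding ps_def map_map using es
    by (intro map_idI) (auto simp: block_basis_eq f_the_inv_into_f[OF inj_block_vec])
  moreover have "set ps = block_index N k"
    unfolding ps_def set_map using es by (auto simp: block_basis_eq the_inv_into_f_f[OF inj_block_vec] image_image)
  moreover have "distinct ps"
    using es \<open>map block_vec ps = es\<close> by (metis distinct_map)
  ultimately show ?thesis
    using that[of ps] matrix_wrt_block[of ps k] by (simp add: block_det_def endo_det_def es_def)
qed

end

section \<open>Specialisation of the parameters\<close>

text \<open>The outer polynomial variable is Q, set to 0; the inner one is q.\<close>

definition eval_num :: "real \<Rightarrow> real poly poly \<Rightarrow> real" where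
  "eval_num q a = poly (poly a 0) q"

lemma eval_num_simps [simp]:
  "eval_num q (a + b) = eval_num q a + eval_num q b"
  "eval_num q (a - b) = eval_num q a - eval_num q b"
  "eval_num q (a * b) = eval_num q a * eval_num q b"
  "eval_num q 0 = 0" "eval_num q 1 = 1"
  by (simp_all add: eval_num_def)

definition regular :: "real \<Rightarrow> real poly poly fract \<Rightarrow> bool" where
  "regular q z \<longleftrightarrow> (\<exists>a b. z = Fract a b \<and> eval_num q b \<noteq> 0)"

text \<open>Evaluation at \<open>Q = 0\<close> and a real value of \<open>q\<close>; meaningful on \<open>regular\<close> fractions only.\<close>

definition eval_fract :: "real \<Rightarrow> real poly poly fract \<Rightarrow> real" where
  "eval_fract q z = (THE r. \<exists>a b. z = Fract a b \<and> eval_num q b \<noteq> 0 \<and> r = eval_num q a / eval_num q b)"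

lemma eval_fract_Fract:
  assumes b: "eval_num q b \<noteq> 0"
  shows "eval_fract q (Fract a b) = eval_num q a / eval_num q b"
  unfolding eval_fract_def
proof (rule the_equality)
  show "\<exists>a' b'. Fract a b = Fract a' b' \<and> eval_num q b' \<noteq> 0 \<and> eval_num q a / eval_num q b = eval_num q a' / eval_num q b'"
    using b by blast
  fix r assume "\<exists>a' b'. Fract a b = Fract a' b' \<and> eval_num q b' \<noteq> 0 \<and> r = eval_num q a' / eval_num q b'"
  then obtain a' b' where *: "Fract a b = Fract a' b'" "eval_num q b' \<noteq> 0" "r = eval_num q a' / eval_num q b'"
    by blast
  have "b \<noteq> 0" "b' \<noteq> 0" using b *(2) by auto
  then have "a * b' = a' * b"
    using *(1) by (simp add: eq_fract)
  then have "eval_num q a * eval_num q b' = eval_num q a' * eval_num q b"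
    by (metis eval_num_simps(3))
  then show "r = eval_num q a / eval_num q b"
    using b *(2,3) by (simp add: frac_eq_eq)
qed

lemma eval_fract_add:
  assumes "regular q y" "regular q z"
  shows "regular q (y + z)" "eval_fract q (y + z) = eval_fract q y + eval_fract q z"
proof -
  obtain a b c d where *: "y = Fract a b" "eval_num q b \<noteq> 0" "z = Fract c d" "eval_num q d \<noteq> 0"
    using assms by (auto simp: regular_def)
  have "b \<noteq> 0" "d \<noteq> 0" using * by auto
  then have e: "y + z = Fract (a * d + c * b) (b * d)"
    by (simp add: *)
  have bd: "eval_num q (b * d) \<noteq> 0" using * by simp
  show "regular q (y + z)"
    unfolding regular_def e using bd by blast
  show "eval_fract q (y + z) = eval_fract q y + eval_fract q z"
    unfolding e eval_fract_Fract[OF bd] unfolding *(1,3) eval_fract_Fract[OF *(2)] eval_fract_Fract[OF *(4)]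
    using *(2,4) by (simp add: add_frac_eq)
qed

lemma eval_fract_mult:
  assumes "regular q y" "regular q z"
  shows "regular q (y * z)" "eval_fract q (y * z) = eval_fract q y * eval_fract q z"
proof -
  obtain a b c d where *: "y = Fract a b" "eval_num q b \<noteq> 0" "z = Fract c d" "eval_num q d \<noteq> 0"
    using assms by (auto simp: regular_def)
  have e: "y * z = Fract (a * c) (b * d)"
    by (simp add: *)
  have bd: "eval_num q (b * d) \<noteq> 0" using * by simp
  show "regular q (y * z)"
    unfolding regular_def e using bd by blast
  show "eval_fract q (y * z) = eval_fract q y * eval_fract q z"
    unfolding e eval_fract_Fract[OF bd] unfolding *(1,3) eval_fract_Fract[OF *(2)] eval_fract_Fract[OF *(4)]
    by simp
qed

lemma regular_Fract: "eval_num q b \<noteq> 0 \<Longrightarrow> regular q (Fract a b)"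
  by (auto simp: regular_def)

lemma eval_num_q: "eval_num q [:[:0, 1:]:] = q"
  and eval_num_Q: "eval_num q [:0, 1:] = 0"
  and eval_num_real: "eval_num q [:[:c:]:] = c"
  by (simp_all add: eval_num_def)

lemma inverse_one_minus_fld_q: "inverse (1 - fld_q) = Fract 1 (1 - [:[:0, 1:]:])"
proof -
  have "1 - fld_q = Fract (1 - [:[:0, 1:]:]) 1"
    by (simp add: fld_q_def One_fract_def)
  then show ?thesis by simp
qed

text \<open>The only denominators among the generators are q and 1 - q, and neither vanishes for 0 <
  q < 1. At q = 0 itself this fails, so that value is reached only as a limit.\<close>

lemma regular_coeff_ring:
  assumes q: "0 < q" "q < 1" and "z \<in> coeff_ring"
  shows "regular q z"
  using assms(3)
proof (induction rule: coeff_ring.induct)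
  case q_inv
  then show ?case
    using q by (simp add: fld_q_def regular_Fract eval_num_q)
next
  case one_minus_q_inv
  then show ?case
    unfolding inverse_one_minus_fld_q using q by (intro regular_Fract) (simp add: eval_num_q)
qed (auto simp: fld_real_def fld_q_def fld_Q_def regular_Fract eval_fract_add eval_fract_mult)

definition eval_coeff :: "real \<Rightarrow> qcoeff \<Rightarrow> real" where
  "eval_coeff q b = eval_fract q (Rep_qcoeff b)"

context
  fixes q :: real
  assumes q: "0 < q" "q < 1"
begin

lemma regular_Rep: "regular q (Rep_qcoeff b)"
  by (rule regular_coeff_ring[OF q Rep_qcoeff])

lemma eval_coeff_add: "eval_coeff q (a + b) = eval_coeff q a + eval_coeff q b"
  by (simp add: eval_coeff_def plus_qcoeff.rep_eq eval_fract_add regular_Rep)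

lemma eval_coeff_mult: "eval_coeff q (a * b) = eval_coeff q a * eval_coeff q b"
  by (simp add: eval_coeff_def times_qcoeff.rep_eq eval_fract_mult regular_Rep)

lemma eval_coeff_real: "eval_coeff q (coeff_real c) = c"
  by (simp add: eval_coeff_def coeff_real.rep_eq fld_real_def eval_fract_Fract eval_num_real)

lemma eval_coeff_0: "eval_coeff q 0 = 0"
  and eval_coeff_1: "eval_coeff q 1 = 1"
  by (simp_all add: eval_coeff_def zero_qcoeff.rep_eq one_qcoeff.rep_eq Zero_fract_def One_fract_def eval_fract_Fract)

lemma eval_coeff_half: "eval_coeff q half = 1 / 2"
  by (simp add: half_def eval_coeff_real)

lemma eval_coeff_q: "eval_coeff q coeff_q = q"
  by (simp add: eval_coeff_def coeff_q.rep_eq fld_q_def eval_fract_Fract eval_num_q)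

lemma eval_coeff_q_m_plus: "eval_coeff q (q_m_plus a) = 0"
proof -
  have "eval_fract q fld_Q = 0"
    by (simp add: fld_Q_def eval_fract_Fract eval_num_Q)
  then show ?thesis
    unfolding eval_coeff_def q_m_plus.rep_eq
    by (simp add: eval_fract_mult regular_coeff_ring[OF q] coeff_ring.Q coeff_ring_q_powi)
qed

text \<open>Q q^a vanishes at Q = 0 for every a, so the value no longer depends on a and stays
  bounded as q tends to 0.\<close>

lemma eval_coeff_bracket: "eval_coeff q (bracket_m_plus a) = 1 / (1 - q)"
proof -
  let ?y = "1 - fld_Q * fld_q powi a"
  have "?y \<in> coeff_ring"
    by (intro coeff_ring_diff coeff_ring_1 coeff_ring.mult coeff_ring.Q coeff_ring_q_powi)
  then have "eval_coeff q (bracket_m_plus a) = eval_fract q ?y * eval_fract q (inverse (1 - fld_q))"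
    unfolding eval_coeff_def bracket_m_plus.rep_eq divide_inverse
    by (intro eval_fract_mult regular_coeff_ring[OF q] coeff_ring.one_minus_q_inv)
  also have "eval_fract q (inverse (1 - fld_q)) = 1 / (1 - q)"
    unfolding inverse_one_minus_fld_q using q by (subst eval_fract_Fract) (simp_all add: eval_num_q)
  also have "eval_fract q ?y = 1"
  proof -
    have "eval_fract q (?y + fld_Q * fld_q powi a) = eval_fract q ?y + eval_fract q (fld_Q * fld_q powi a)"
      using \<open>?y \<in> coeff_ring\<close>
      by (intro eval_fract_add regular_coeff_ring[OF q] coeff_ring.mult coeff_ring.Q coeff_ring_q_powi)
    then show ?thesis
      using eval_coeff_q_m_plus[of a] eval_coeff_1 by (simp add: eval_coeff_def q_m_plus.rep_eq one_qcoeff.rep_eq)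
  qed
  finally show ?thesis by simp
qed

end

text \<open>Exponents cannot cancel, so only the two constant terms contribute. Hence reading off
  the constant term, i.e. putting all c_ij = 0, is a ring homomorphism, as needed for
  \<open>eval_param\<close>.\<close>

lemma lookup_0_mult:
  fixes f g :: "('a \<Rightarrow>\<^sub>0 nat) \<Rightarrow>\<^sub>0 'b::comm_ring_1"
  shows "lookup (f * g) 0 = lookup f 0 * lookup g 0"
proof (induction f rule: poly_mapping_induct)
  case (single m b)
  show ?case
  proof (cases "m = 0")
    case True
    then show ?thesis by (simp add: lookup_const_mult)
  next
    case False
    have "0 \<noteq> m + k" for k
    proof
      assume "0 = m + k"
      then have "lookup m v + lookup k v = 0" for v
        by (metis lookup_add lookup_zero)
      then have "m = 0" by (intro poly_mapping_eqI) simp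
      with False show False by simp
    qed
    then show ?thesis
      using False by (simp add: lookup_single_mult_eq_0 lookup_single)
  qed
qed (simp_all add: distrib_right lookup_add)

definition eval_param :: "real \<Rightarrow> T_poly \<Rightarrow> real" where
  "eval_param q t = eval_coeff q (lookup t 0)"

lemma comm_ring_hom_eval_param: "0 < q \<Longrightarrow> q < 1 \<Longrightarrow> comm_ring_hom (eval_param q)"
  by unfold_locales
     (simp_all add: eval_param_def lookup_add lookup_0_mult eval_coeff_add eval_coeff_mult eval_coeff_0 eval_coeff_1)

section \<open>Base change of the model operators along a ring homomorphism\<close>

context comm_ring_hom
begin

definition pmap :: "'a spoly \<Rightarrow> 'b spoly" where "pmap = Poly_Mapping.map hom"

lemma lookup_pmap: "lookup (pmap f) \<mu> = hom (lookup f \<mu>)"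
  by (simp add: pmap_def map.rep_eq when_def)

lemma pmap_0: "pmap 0 = 0"
  and pmap_add: "pmap (f + g) = pmap f + pmap g"
  and pmap_uminus: "pmap (- f) = - pmap f"
  by (rule poly_mapping_eqI; simp add: lookup_pmap lookup_add hom_add hom_uminus)+

lemma pmap_sum: "pmap (sum f I) = (\<Sum>i\<in>I. pmap (f i))"
  by (induction I rule: infinite_finite_induct) (simp_all add: pmap_0 pmap_add)

lemma pmap_single: "pmap (single \<nu> b) = single \<nu> (hom b)"
  by (rule poly_mapping_eqI) (simp add: lookup_pmap lookup_single when_def)

lemma pmap_single_mult: "pmap (single \<nu> b * f) = single \<nu> (hom b) * pmap f"
proof (induction f rule: poly_mapping_induct)
  case (single m b)
  then show ?case by (simp add: mult_single pmap_single hom_mult)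
qed (simp_all add: pmap_0 distrib_left pmap_add)

lemma pmap_sgn: "pmap (sgn_above N S u * f) = sgn_above N S u * pmap f"
  by (simp add: sgn_above_def minus_one_power_iff pmap_uminus)

lemma pmap_qdiff: "pmap (qdiff u P f) = qdiff u (hom P) (pmap f)"
  by (rule poly_mapping_eqI) (simp add: lookup_pmap lookup_qdiff hom_mult hom_sum hom_power)

lemma pmap_qdil: "pmap (qdil u P f) = qdil u (hom P) (pmap f)"
  by (rule poly_mapping_eqI) (simp add: lookup_pmap lookup_qdil hom_mult hom_power)

lemma pmap_cre: "pmap (cre N u m S) = cre N u (\<lambda>S. pmap (m S)) S"
  and pmap_ann: "pmap (ann N u m S) = ann N u (\<lambda>S. pmap (m S)) S"
  by (simp_all add: cre_def ann_def pmap_sgn pmap_0)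

lemma hom_2: "hom 2 = 2"
  using hom_add[of 1 1] by simp

lemma pmap_gpair: "pmap (gpair c u v * f) = gpair (\<lambda>i j. hom (c i j)) u v * pmap f"
  by (cases u; cases v) (simp_all add: gpair_def pmap_single_mult hom_2)

lemma pmap_vmul: "pmap (vmul N h c v m S) = vmul N (hom h) (\<lambda>i j. hom (c i j)) v (\<lambda>S. pmap (m S)) S"
  by (simp add: vmul_def rho_def pmap_add pmap_cre pmap_single_mult pmap_sum pmap_gpair pmap_ann)

lemma pmap_2: "pmap (2 * f) = 2 * pmap f"
  unfolding mult_2 by (rule pmap_add)

lemma pmap_scalar_deriv: "pmap (scalar_deriv N h c q m S) = scalar_deriv N (hom h) (\<lambda>i j. hom (c i j)) (hom q) (\<lambda>S. pmap (m S)) S"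
  by (simp add: scalar_deriv_def pmap_add pmap_single_mult pmap_vmul pmap_2 pmap_sum pmap_qdiff pmap_qdil hom_add hom_power
      del: single_add)

lemma pmap_deriv_op: "pmap (deriv_op N h c q br qm m S) =
    deriv_op N (hom h) (\<lambda>i j. hom (c i j)) (hom q) (\<lambda>n. hom (br n)) (\<lambda>n. hom (qm n)) (\<lambda>S. pmap (m S)) S"
proof -
  have "(\<lambda>S. pmap (if 0 \<in> S then single 0 (qm (card S - 1)) * m S else m S)) =
    (\<lambda>S. if 0 \<in> S then single 0 (hom (qm (card S - 1))) * pmap (m S) else pmap (m S))"
    by (auto simp: pmap_single_mult)
  then show ?thesis
    by (simp add: deriv_op_def pmap_add pmap_single_mult pmap_ann pmap_scalar_deriv)
qed

lemma pmap_basis_vec: "pmap (basis_vec S \<mu> 1 S') = basis_vec S \<mu> 1 S'"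
  by (simp add: basis_vec_def pmap_single pmap_0)

end

section \<open>Coefficientwise limits of models\<close>

definition mconv :: "('c \<Rightarrow> real model) \<Rightarrow> real model \<Rightarrow> 'c filter \<Rightarrow> bool" where
  "mconv M m F \<longleftrightarrow> (\<forall>S \<mu>. ((\<lambda>t. lookup (M t S) \<mu>) \<longlongrightarrow> lookup (m S) \<mu>) F)"

lemma mconv_add: "mconv M m F \<Longrightarrow> mconv M' m' F \<Longrightarrow> mconv (\<lambda>t S. M t S + M' t S) (\<lambda>S. m S + m' S) F"
  by (simp add: mconv_def lookup_add tendsto_add)

lemma mconv_sum: "(\<And>i. i \<in> I \<Longrightarrow> mconv (M i) (m i) F) \<Longrightarrow> mconv (\<lambda>t S. \<Sum>i\<in>I. M i t S) (\<lambda>S. \<Sum>i\<in>I. m i S) F"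
  by (simp add: mconv_def lookup_sum tendsto_sum)

lemma mconv_single_mult:
  assumes "mconv M m F" "(b \<longlongrightarrow> b0) F"
  shows "mconv (\<lambda>t S. single \<nu> (b t) * M t S) (\<lambda>S. single \<nu> b0 * m S) F"
  unfolding mconv_def
proof (intro allI)
  fix S \<mu>
  show "((\<lambda>t. lookup (single \<nu> (b t) * M t S) \<mu>) \<longlongrightarrow>
      lookup (single \<nu> b0 * m S) \<mu>) F"
  proof (cases "\<exists>\<kappa>. \<mu> = \<nu> + \<kappa>")
    case True
    then show ?thesis
      using assms by (auto simp: lookup_single_mult mconv_def intro!: tendsto_mult)
  next
    case False
    then show ?thesis
      by (simp add: lookup_single_mult_eq_0)
  qed
qed

lemma mconv_sgn: "((\<lambda>t. lookup (f t) \<mu>) \<longlongrightarrow> lookup f0 \<mu>) F \<Longrightarrow>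
   ((\<lambda>t. lookup (sgn_above N S u * f t) \<mu>) \<longlongrightarrow> lookup (sgn_above N S u * f0 :: real spoly) \<mu>) F"
  by (simp add: sgn_above_def minus_one_power_iff tendsto_minus)

lemma mconv_cre: "mconv M m F \<Longrightarrow> mconv (\<lambda>t. cre N u (M t)) (cre N u m) F"
  and mconv_ann: "mconv M m F \<Longrightarrow> mconv (\<lambda>t. ann N u (M t)) (ann N u m) F"
  by (auto simp: mconv_def cre_def ann_def intro: mconv_sgn)

lemma mconv_gpair: "mconv M m F \<Longrightarrow> mconv (\<lambda>t S. gpair c u v * M t S) (\<lambda>S. gpair c u v * m S) F"
  by (cases u; cases v) (simp_all add: gpair_def mconv_single_mult)

lemma mconv_vmul:
  assumes "mconv M m F"
  shows "mconv (\<lambda>t. vmul N h c v (M t)) (vmul N h c v m) F"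
proof -
  have e: "vmul N h c v m = (\<lambda>S. cre N v m S + single 0 h * (\<Sum>u\<le>N. gpair c u v * ann N u m S))" for m :: "real model"
    by (simp add: vmul_def rho_def fun_eq_iff)
  show ?thesis
    unfolding e using assms
    by (intro mconv_add mconv_cre mconv_single_mult mconv_sum mconv_gpair mconv_ann tendsto_const)
qed

lemma mconv_qdiff:
  assumes "mconv M m F" "(b \<longlongrightarrow> b0) F"
  shows "mconv (\<lambda>t S. qdiff u (b t) (M t S)) (\<lambda>S. qdiff u b0 (m S)) F"
  using assms unfolding mconv_def lookup_qdiff by (intro allI tendsto_intros) auto

lemma mconv_qdil:
  assumes "mconv M m F" "(b \<longlongrightarrow> b0) F"
  shows "mconv (\<lambda>t S. qdil u (b t) (M t S)) (\<lambda>S. qdil u b0 (m S)) F"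
  using assms unfolding mconv_def lookup_qdil by (intro allI tendsto_intros) auto

text \<open>The argument m may stay fixed: in the block operator the preceding multiplication by x
  does not involve q once c_ij = 0.\<close>

lemma mconv_deriv_op:
  assumes q: "(q \<longlongrightarrow> q0) F" and br: "\<And>n. ((\<lambda>t. br t n) \<longlongrightarrow> br0 n) F" and qm: "\<And>n. ((\<lambda>t. qm t n) \<longlongrightarrow> qm0 n) F"
  shows "mconv (\<lambda>t. deriv_op N h c (q t) (br t) (qm t) m) (deriv_op N h c q0 br0 qm0 m) F"
proof -
  let ?k = "\<lambda>qm S. if 0 \<in> S then single 0 (qm (card S - 1)) * m S else m S"
  have e: "deriv_op N h c q br qm m = (\<lambda>S. single 0 (br (card S)) * ann N 0 m S +
     (single 0 (1 + q) * vmul N h c 0 (\<lambda>S. qdiff R_Var (q ^ 2) (?k qm S)) S +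
      single 0 2 * (\<Sum>i<N. vmul N h c (Suc i) (\<lambda>S. qdil R_Var (q ^ 2) (qdiff (S_Var i) q (?k qm S))) S)))"
    for q :: real and br qm
    by (simp add: deriv_op_def scalar_deriv_def fun_eq_iff)
  have k: "mconv (\<lambda>t. ?k (qm t)) (?k qm0) F"
    unfolding mconv_def by (auto simp: lookup_const_mult intro!: tendsto_mult qm)
  have a: "mconv (\<lambda>t S. single 0 (br t (card S)) * ann N 0 m S) (\<lambda>S. single 0 (br0 (card S)) * ann N 0 m S) F"
    unfolding mconv_def by (auto simp: lookup_const_mult intro!: tendsto_mult br)
  show ?thesis
    unfolding e
    by (intro mconv_add[OF a] mconv_add mconv_single_mult mconv_vmul mconv_sum mconv_qdiff mconv_qdil k q tendsto_intros)
qed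

section \<open>The limit operator\<close>

lemma qdiff_uminus: "qdiff u P (- f) = - qdiff u P f"
  by (rule poly_mapping_eqI) (simp add: lookup_qdiff)

lemma qdil_uminus: "qdil u P (- f) = - qdil u P f"
  by (rule poly_mapping_eqI) (simp add: lookup_qdil)

lemma qdiff_sum: "qdiff u P (sum f I) = (\<Sum>i\<in>I. qdiff u P (f i))"
  by (induction I rule: infinite_finite_induct) (simp_all add: qdiff_add)

lemma qdil_sum: "qdil u P (sum f I) = (\<Sum>i\<in>I. qdil u P (f i))"
  by (induction I rule: infinite_finite_induct) (simp_all add: qdil_add)

lemma qdiff_ann: "qdiff u P (ann N v m S) = ann N v (\<lambda>S. qdiff u P (m S)) S"
  and qdil_cre: "qdil u P (cre N v m S) = cre N v (\<lambda>S. qdil u P (m S)) S"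
  and qdil_ann: "qdil u P (ann N v m S) = ann N v (\<lambda>S. qdil u P (m S)) S"
  by (simp_all add: cre_def ann_def sgn_above_def minus_one_power_iff qdiff_uminus qdil_uminus)

section \<open>Shifts and projections at q = 0\<close>

definition var :: "svar \<Rightarrow> 'k::comm_ring_1 spoly" where
  "var u = single (single u 1) 1"

lemma lookup_var_mult:
  "lookup (var u * f) \<mu> =
     (if lookup \<mu> u = 0 then 0 else lookup f (\<mu> - single u 1))"
proof (cases "lookup \<mu> u = 0")
  case True
  have "\<mu> \<noteq> single u 1 + \<kappa>" for \<kappa>
    using True by (auto simp: lookup_add)
  then show ?thesis
    using True unfolding var_def by (simp add: lookup_single_mult_eq_0)
next
  case False
  then have "\<mu> = single u 1 + (\<mu> - single u 1)"
    by (intro poly_mapping_eqI) (auto simp: lookup_add lookup_minus lookup_single when_def)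
  then show ?thesis
    using False lookup_single_mult[of "single u 1" 1 f "\<mu> - single u 1"]
    unfolding var_def by simp
qed

text \<open>0^0 = 1, so every q-integer 1 + q + ... + q^n is 1 at q = 0. Thus
  \<open>qdiff u 0\<close> is a pure shift, and for the same reason \<open>qdil u 0\<close> is the
  projection to u^0.\<close>

lemma geometric_0: "(\<Sum>i\<le>n. 0 ^ i) = (1 :: 'a::comm_ring_1)"
  by (induction n) simp_all

lemma lookup_qdiff_0: "lookup (qdiff u 0 f) \<mu> = lookup f (single u 1 + \<mu>)"
  by (simp add: lookup_qdiff geometric_0)

lemma lookup_qdil_0: "lookup (qdil u 0 f) \<mu> = (if lookup \<mu> u = 0 then lookup f \<mu> else 0)"
  by (simp add: lookup_qdil power_0_left)

lemma qdiff_var_same: "qdiff u 0 (var u * f) = f"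
  unfolding var_def by (rule poly_mapping_eqI) (simp add: lookup_qdiff_0 lookup_single_mult del: One_nat_def)

lemma qdiff_var_other:
  assumes "u \<noteq> v"
  shows "qdiff u 0 (var v * f) = var v * qdiff u 0 f"
proof (rule poly_mapping_eqI)
  fix \<mu> :: "svar \<Rightarrow>\<^sub>0 nat"
  have "single u (1::nat) + \<mu> - single v 1 = single u 1 + (\<mu> - single v 1)"
    if "lookup \<mu> v \<noteq> 0"
    using that by (intro poly_mapping_eqI) (auto simp: lookup_add lookup_minus lookup_single when_def)
  then show "lookup (qdiff u 0 (var v * f)) \<mu> = lookup (var v * qdiff u 0 f) \<mu>"
    using assms by (simp add: lookup_qdiff_0 lookup_var_mult lookup_add lookup_single del: One_nat_def)
qed

lemma qdil_var_same: "qdil u 0 (var u * f) = 0"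
  by (rule poly_mapping_eqI) (simp add: lookup_qdil_0 lookup_var_mult)

lemma qdil_var_other:
  assumes "u \<noteq> v"
  shows "qdil u 0 (var v * f) = var v * qdil u 0 f"
  by (rule poly_mapping_eqI)
     (use assms in \<open>auto simp: lookup_qdil_0 lookup_var_mult lookup_minus lookup_single\<close>)

lemma qdil_qdiff_other:
  assumes "u \<noteq> v"
  shows "qdil u 0 (qdiff v 0 f) = qdiff v 0 (qdil u 0 f)"
  by (rule poly_mapping_eqI)
     (use assms in \<open>auto simp: lookup_qdil_0 lookup_qdiff_0 lookup_add lookup_single\<close>)

lemma qdil_0_idem: "qdil u 0 (qdil u 0 f) = qdil u 0 f"
  by (rule poly_mapping_eqI) (simp add: lookup_qdil_0)

definition koszul :: "nat \<Rightarrow> 'k::comm_ring_1 model \<Rightarrow> 'k model" where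
  "koszul N m S = (\<Sum>j<N. var (S_Var j) * ann N (Suc j) m S)"

definition derham :: "nat \<Rightarrow> 'k::comm_ring_1 model \<Rightarrow> 'k model" where
  "derham N m S = (\<Sum>i<N. cre N (Suc i) (\<lambda>S. qdiff (S_Var i) 0 (m S)) S)"

lemma koszul_add: "koszul N (\<lambda>S. m S + m' S) S = koszul N m S + koszul N m' S"
  and koszul_0: "koszul N (\<lambda>S. 0) S = 0"
  by (simp_all add: koszul_def ann_add ann_scale ann_zero distrib_left sum.distrib sum_distrib_left mult.left_commute)

lemma derham_0: "derham N (\<lambda>S. 0) S = 0"
  by (simp add: derham_def cre_zero)

lemma qdiff_R_koszul: "qdiff R_Var 0 (koszul N m S) = koszul N (\<lambda>S. qdiff R_Var 0 (m S)) S"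
  and qdil_R_koszul: "qdil R_Var 0 (koszul N m S) = koszul N (\<lambda>S. qdil R_Var 0 (m S)) S"
  by (simp_all add: koszul_def qdiff_sum qdil_sum qdiff_var_other qdil_var_other qdiff_ann qdil_ann)

lemma qdil_R_derham: "qdil R_Var 0 (derham N m S) = derham N (\<lambda>S. qdil R_Var 0 (m S)) S"
  by (simp add: derham_def qdil_sum qdil_cre qdil_qdiff_other)

lemma koszul_fun: "koszul N m = (\<lambda>S. \<Sum>j<N. var (S_Var j) * ann N (Suc j) m S)"
  and derham_fun: "derham N m = (\<lambda>S. \<Sum>i<N. cre N (Suc i) (\<lambda>S. qdiff (S_Var i) 0 (m S)) S)"
  by (simp_all add: koszul_def derham_def fun_eq_iff)

text \<open>The products of two variables are symmetric and the double contractions antisymmetric,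
  so the sum equals its own negative; real coefficients allow the factor 2 to be cancelled.\<close>

lemma koszul_koszul:
  fixes m :: "real model"
  shows "koszul N (koszul N m) S = 0"
proof -
  have e: "koszul N (koszul N m) S = (\<Sum>j<N. \<Sum>k<N. var (S_Var j) * (var (S_Var k) * ann N (Suc j) (ann N (Suc k) m) S))"
    unfolding koszul_fun[of N m] unfolding koszul_def by (simp add: ann_sum ann_scale sum_distrib_left)
  have "koszul N (koszul N m) S + koszul N (koszul N m) S =
     (\<Sum>j<N. \<Sum>k<N. var (S_Var j) * (var (S_Var k) * ann N (Suc j) (ann N (Suc k) m) S)) +
     (\<Sum>j<N. \<Sum>k<N. var (S_Var k) * (var (S_Var j) * ann N (Suc k) (ann N (Suc j) m) S))"
    unfolding e by (intro arg_cong2[where f = "(+)"] refl sum.swap)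
  also have "\<dots> = (\<Sum>j<N. \<Sum>k<N. var (S_Var j) * (var (S_Var k) *
      (ann N (Suc j) (ann N (Suc k) m) S + ann N (Suc k) (ann N (Suc j) m) S)))"
    unfolding sum.distrib[symmetric] by (intro sum.cong refl) (simp only: distrib_left mult.left_commute)
  also have "\<dots> = 0"
    by (intro sum.neutral ballI) (simp add: ann_ann)
  finally have "lookup (koszul N (koszul N m) S) \<mu> + lookup (koszul N (koszul N m) S) \<mu> = 0" for \<mu>
    by (simp flip: lookup_add)
  then show ?thesis
    by (intro poly_mapping_eqI) simp
qed

text \<open>A homotopy formula. For i \<noteq> j the shift in s_i commutes with s_j and the terms
  cancel by anticommutation. For i = j, shifting after multiplying is the identity (case y_j
  present), while multiplying after shifting is the projection to monomials containing s_j (case y_j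
  absent). So the eigenvalue counts the j for which y_j or s_j occurs.\<close>

lemma koszul_derham:
  "lookup (koszul N (derham N m) S + derham N (koszul N m) S) \<mu> =
     (\<Sum>j<N. of_bool (Suc j \<in> S \<or> lookup \<mu> (S_Var j) \<noteq> 0)) * lookup (m S) \<mu>"
proof -
  let ?d = "\<lambda>i m S. qdiff (S_Var i) 0 (m S)"
  have 1: "koszul N (derham N m) S = (\<Sum>j<N. \<Sum>i<N. var (S_Var j) * ann N (Suc j) (cre N (Suc i) (?d i m)) S)"
    unfolding derham_fun koszul_def by (simp add: ann_sum sum_distrib_left)
  have 2: "derham N (koszul N m) S = (\<Sum>j<N. \<Sum>i<N. cre N (Suc i) (\<lambda>S. qdiff (S_Var i) 0 (var (S_Var j) * ann N (Suc j) m S)) S)"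
    unfolding koszul_fun derham_def by (subst sum.swap) (simp add: qdiff_sum cre_sum)
  have "koszul N (derham N m) S + derham N (koszul N m) S = (\<Sum>j<N. \<Sum>i<N. 
     var (S_Var j) * ann N (Suc j) (cre N (Suc i) (?d i m)) S +
     cre N (Suc i) (\<lambda>S. qdiff (S_Var i) 0 (var (S_Var j) * ann N (Suc j) m S)) S)"
    unfolding 1 2 sum.distrib ..
  also have "\<dots> = (\<Sum>j<N. \<Sum>i<N. if i = j then (if Suc j \<in> S then m S else var (S_Var j) * ?d j m S) else 0)"
  proof (intro sum.cong refl)
    fix i j assume "j \<in> {..<N}" "i \<in> {..<N}"
    then have ij: "Suc i \<le> N" "Suc j \<le> N" by auto
    show "var (S_Var j) * ann N (Suc j) (cre N (Suc i) (?d i m)) S +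
     cre N (Suc i) (\<lambda>S. qdiff (S_Var i) 0 (var (S_Var j) * ann N (Suc j) m S)) S =
     (if i = j then (if Suc j \<in> S then m S else var (S_Var j) * ?d j m S) else 0)"
    proof (cases "i = j")
      case True
      have "ann N (Suc j) (cre N (Suc j) f) S = (if Suc j \<in> S then 0 else f S)" for f :: "'a model"
        using cre_ann[OF ij(2) ij(2), of f S] by (auto simp: cre_def ann_def)
      moreover have "cre N (Suc j) (ann N (Suc j) m) S = (if Suc j \<in> S then m S else 0)"
        using cre_ann[OF ij(2) ij(2), of m S] by (auto simp: cre_def ann_def)
      ultimately show ?thesis
        using True by (simp add: qdiff_var_same)
    next
      case False
      have "cre N (Suc i) (\<lambda>S. qdiff (S_Var i) 0 (var (S_Var j) * ann N (Suc j) m S)) S =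
          var (S_Var j) * cre N (Suc i) (ann N (Suc j) (?d i m)) S"
        using False by (simp add: qdiff_var_other cre_scale qdiff_ann)
      moreover have "var (S_Var j) * ann N (Suc j) (cre N (Suc i) (?d i m)) S + var (S_Var j) * cre N (Suc i) (ann N (Suc j) (?d i m)) S = 0"
        using cre_ann[OF ij, of "?d i m" S] False by (simp add: add.commute flip: distrib_left)
      ultimately show ?thesis
        using False by simp
    qed
  qed
  also have "\<dots> = (\<Sum>j<N. if Suc j \<in> S then m S else var (S_Var j) * ?d j m S)"
    by (intro sum.cong refl) simp
  finally have "lookup (koszul N (derham N m) S + derham N (koszul N m) S) \<mu> =
      (\<Sum>j<N. lookup (if Suc j \<in> S then m S else var (S_Var j) * ?d j m S) \<mu>)"
    by (simp add: lookup_sum)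
  also have "\<dots> = (\<Sum>j<N. of_bool (Suc j \<in> S \<or> lookup \<mu> (S_Var j) \<noteq> 0) * lookup (m S) \<mu>)"
  proof (intro sum.cong refl)
    fix j
    have "single (S_Var j) 1 + (\<mu> - single (S_Var j) 1) = \<mu>" if "lookup \<mu> (S_Var j) \<noteq> 0"
      using that by (intro poly_mapping_eqI) (auto simp: lookup_add lookup_minus lookup_single when_def)
    then show "lookup (if Suc j \<in> S then m S else var (S_Var j) * ?d j m S) \<mu> =
        of_bool (Suc j \<in> S \<or> lookup \<mu> (S_Var j) \<noteq> 0) * lookup (m S) \<mu>"
      by (simp add: lookup_var_mult lookup_qdiff_0 del: One_nat_def)
  qed
  finally show ?thesis
    by (simp add: sum_distrib_right)
qed

lemma one_plus_derham_koszul_inj: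
  fixes v :: "real model"
  assumes v: "\<And>S. v S + derham N (koszul N v) S = 0"
  shows "v S = 0"
proof -
  let ?w = "koszul N v"
  have "koszul N v S + koszul N (derham N ?w) S = 0" for S
  proof -
    have "koszul N (\<lambda>S. v S + derham N ?w S) S = 0"
      by (simp add: v koszul_0)
    then show ?thesis by (simp add: koszul_add)
  qed
  \<comment> \<open>This zero is added to complete \<iota>D w to the diagonal operator (\<iota>D +
    D\<iota>) w.\<close>
  moreover have "derham N (koszul N ?w) S = 0" for S
    by (simp add: koszul_koszul[abs_def] derham_0)
  ultimately have w: "?w S + (koszul N (derham N ?w) S + derham N (koszul N ?w) S) = 0" for S
    by simp
  have "?w S = 0" for S
  proof (rule poly_mapping_eqI)
    fix \<mu> :: "svar \<Rightarrow>\<^sub>0 nat"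
    let ?e = "(\<Sum>j<N. of_bool (Suc j \<in> S \<or> lookup \<mu> (S_Var j) \<noteq> 0)) :: real"
    have "lookup (?w S + (koszul N (derham N ?w) S + derham N (koszul N ?w) S)) \<mu> = 0"
      unfolding w by simp
    then have "(1 + ?e) * lookup (?w S) \<mu> = 0"
      unfolding lookup_add[of "?w S"] koszul_derham by (simp add: distrib_right)
    moreover have "0 \<le> ?e"
      by (intro sum_nonneg) simp
    then have "1 + ?e \<noteq> 0"
      by linarith
    ultimately show "lookup (?w S) \<mu> = lookup 0 \<mu>"
      by simp
  qed
  then have "?w = (\<lambda>S. 0)"
    by blast
  then show ?thesis
    using v[of S] by (simp add: derham_0)
qed

abbreviation h2 :: "real spoly" where "h2 \<equiv> single 0 (1 / 2)"

lemma h2_double: "h2 * f + h2 * f = f"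
proof -
  have "h2 + h2 = 1"
    by (simp flip: single_add)
  then show ?thesis
    unfolding distrib_right[symmetric] by simp
qed

abbreviation rmul :: "nat \<Rightarrow> nat \<Rightarrow> real model \<Rightarrow> real model" where
  "rmul N \<equiv> vmul N (1 / 2) (\<lambda>_ _. 0)"

text \<open>The block operator at \<open>c\<^sub>i\<^sub>j = 0\<close>, \<open>Q = 0\<close>, \<open>q = 0\<close>.\<close>

definition limit_op :: "nat \<Rightarrow> real model \<Rightarrow> real model" where
  "limit_op N m = deriv_op N (1 / 2) (\<lambda>_ _. 0) 0 (\<lambda>_. 1) (\<lambda>_. 0) (rmul N 0 m)"

lemma sum_atMost_shift: "(\<Sum>u\<le>N. f u) = f 0 + (\<Sum>j<N. f (Suc j))"
  by (rule sum.atMost_shift)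

text \<open>The entry 2r of the form meets the factor 1/2, so the contraction with x carries exactly
  r, whereas those with the y_j keep the 1/2.\<close>

lemma rmul_0: "rmul N 0 m S = cre N 0 m S + var R_Var * ann N 0 m S + h2 * koszul N m S"
proof -
  have "single (single R_Var 1) (2 :: real) = 2 * var R_Var"
    unfolding mult_2 var_def single_add[symmetric] by simp
  then have "gpair (\<lambda>_ _. 0) 0 0 = (2 * var R_Var :: real spoly)"
    by (simp add: gpair_def)
  moreover have "h2 * (2 * f) = f" for f :: "real spoly"
    unfolding mult_2 distrib_left by (rule h2_double)
  moreover have "gpair (\<lambda>_ _. 0) (Suc j) 0 = (var (S_Var j) :: real spoly)" for j
    by (simp add: gpair_def var_def)
  ultimately show ?thesis
    unfolding vmul_def rho_def sum_atMost_shift by (simp add: koszul_def distrib_left mult.assoc)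
qed

text \<open>With c_ij = 0 the vector y_i pairs only with x.\<close>

lemma rmul_Suc:
  assumes "i < N"
  shows "rmul N (Suc i) m S = cre N (Suc i) m S + h2 * (var (S_Var i) * ann N 0 m S)"
proof -
  have "gpair (\<lambda>_ _. 0) (Suc j) (Suc i) = (0 :: real spoly)" "gpair (\<lambda>_ _. 0) 0 (Suc i) = (var (S_Var i) :: real spoly)" for j
    by (simp_all add: gpair_def var_def)
  then show ?thesis
    unfolding vmul_def rho_def sum_atMost_shift by simp
qed

text \<open>The part without x. It arises because the factor q^(m-p) is 0 in the limit and erases
  all components x \<and> y_I before the scalar derivative.\<close>

definition restr :: "'k::comm_ring_1 model \<Rightarrow> 'k model" where
  "restr m S = (if 0 \<in> S then 0 else m S)"

lemma koszul_restr: "koszul N (restr m) S = (if 0 \<in> S then 0 else koszul N m S)"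
  by (auto simp: koszul_def restr_def ann_def intro!: sum.neutral sum.cong)

lemma ann_koszul: "ann N 0 (koszul N m) S = - koszul N (ann N 0 m) S"
proof -
  have "ann N 0 (koszul N m) S = (\<Sum>j<N. var (S_Var j) * ann N 0 (ann N (Suc j) m) S)"
    unfolding koszul_fun by (simp add: ann_sum ann_scale)
  also have "\<dots> = (\<Sum>j<N. - (var (S_Var j) * ann N (Suc j) (ann N 0 m) S))"
  proof (intro sum.cong refl)
    fix j assume "j \<in> {..<N}"
    then have "ann N 0 (ann N (Suc j) m) S = - ann N (Suc j) (ann N 0 m) S"
      using ann_ann[of 0 N "Suc j" m S] by (simp add: eq_neg_iff_add_eq_0)
    then show "var (S_Var j) * ann N 0 (ann N (Suc j) m) S = - (var (S_Var j) * ann N (Suc j) (ann N 0 m) S)"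
      by simp
  qed
  finally show ?thesis by (simp add: koszul_def sum_negf)
qed

lemma ann_ann_same: "ann N u (ann N u m) S = 0"
  by (simp add: ann_def)

text \<open>The contraction part of the derivative and the r-derivative part contain
  \<open>ann (cre m)\<close> and \<open>cre (ann m)\<close> for x, whose sum is m by
  anticommutation; their terms with \<open>koszul N (ann N 0 m)\<close> cancel. What is left depends
  on m only through \<open>restr m\<close>: this is the triangularity.\<close>

lemma limit_op_eq:
  fixes m :: "real model" and N :: nat
  defines "X \<equiv> koszul N (restr m)"
  shows "limit_op N m S = m S + h2 * cre N 0 (\<lambda>S. qdiff R_Var 0 (X S)) S + derham N (\<lambda>S. qdil R_Var 0 (X S)) S"
proof -
  define w where "w = restr (rmul N 0 m)"
  have w: "w S = var R_Var * ann N 0 m S + h2 * X S" for S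
    unfolding w_def restr_def rmul_0 X_def koszul_restr by (auto simp: cre_def ann_def)
  let ?Y = "\<lambda>S. qdiff R_Var 0 (X S)"
  let ?Z = "\<lambda>i S. qdiff (S_Var i) 0 (qdil R_Var 0 (X S))"
  have X0: "X (insert 0 S) = 0" for S
    by (simp add: X_def koszul_restr)
  \<comment> \<open>The r-shift cancels the factor \<open>var R_Var\<close> in w.\<close>
  have Y: "(\<lambda>S. qdiff R_Var 0 (w S)) = (\<lambda>S. ann N 0 m S + h2 * ?Y S)"
    by (simp add: w qdiff_add qdiff_var_same qdiff_scale fun_eq_iff)
  \<comment> \<open>The projection to r^0 kills the term of w that carries the factor
    \<open>var R_Var\<close>.\<close>
  have Z: "(\<lambda>S. qdil R_Var 0 (qdiff (S_Var i) 0 (w S))) = (\<lambda>S. h2 * ?Z i S)" for i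
    by (simp add: w qdiff_add qdil_add qdiff_var_other qdil_var_same qdiff_scale qdil_scale qdil_qdiff_other fun_eq_iff)
  have "(\<lambda>S. if 0 \<in> S then single 0 0 * rmul N 0 m S else rmul N 0 m S) = w"
    by (simp add: w_def restr_def fun_eq_iff)
  then have "limit_op N m S = ann N 0 (rmul N 0 m) S + scalar_deriv N (1 / 2) (\<lambda>_ _. 0) 0 w S"
    by (simp add: limit_op_def deriv_op_def)
  also have "scalar_deriv N (1 / 2) (\<lambda>_ _. 0) 0 w S = rmul N 0 (\<lambda>S. ann N 0 m S + h2 * ?Y S) S + 2 * (\<Sum>i<N. rmul N (Suc i) (\<lambda>S. h2 * ?Z i S) S)"
    unfolding scalar_deriv_def by (simp add: Y Z)
  also have "2 * (\<Sum>i<N. rmul N (Suc i) (\<lambda>S. h2 * ?Z i S) S) = derham N (\<lambda>S. qdil R_Var 0 (X S)) S"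
  proof -
    have two: "2 * (h2 * f) = f" for f :: "real spoly"
      unfolding mult_2 by (rule h2_double)
    \<comment> \<open>The contraction with x contributes nothing, since X lives on sets without 0;
      the remaining \<open>h2\<close> is absorbed by the factor 2 in
      \<open>scalar_deriv\<close>.\<close>
    have step: "rmul N (Suc i) (\<lambda>S. h2 * ?Z i S) S = h2 * cre N (Suc i) (?Z i) S" if "i < N" for i
      unfolding rmul_Suc[OF that] by (simp add: cre_scale ann_def X0)
    show ?thesis
      unfolding derham_def sum_distrib_left
    proof (rule sum.cong[OF refl])
      fix i assume "i \<in> {..<N}"
      then show "2 * rmul N (Suc i) (\<lambda>S. h2 * ?Z i S) S = cre N (Suc i) (?Z i) S"
        by (simp only: step two lessThan_iff)
    qed
  qed
  also have "rmul N 0 (\<lambda>S. ann N 0 m S + h2 * ?Y S) S = cre N 0 (ann N 0 m) S + h2 * koszul N (ann N 0 m) S + h2 * cre N 0 ?Y S"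
  proof -
    have "rmul N 0 (ann N 0 m) S = cre N 0 (ann N 0 m) S + h2 * koszul N (ann N 0 m) S"
      unfolding rmul_0 by (simp add: ann_ann_same)
    \<comment> \<open>\<open>?Y\<close> is the r-shift of X, and X is itself in the image of
      \<iota>; \<iota> commutes with the r-shift and squares to zero.\<close>
    moreover have "koszul N ?Y S = 0"
      by (simp add: koszul_koszul X_def flip: qdiff_R_koszul)
    then have "rmul N 0 ?Y S = cre N 0 ?Y S"
      unfolding rmul_0 by (simp add: ann_def X0)
    ultimately show ?thesis
      by (simp add: vmul_add vmul_scale)
  qed
  also have "ann N 0 (rmul N 0 m) S = ann N 0 (cre N 0 m) S - h2 * koszul N (ann N 0 m) S"
  proof -
    have e: "rmul N 0 m = (\<lambda>S. cre N 0 m S + var R_Var * ann N 0 m S + h2 * koszul N m S)"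
      by (simp add: rmul_0 fun_eq_iff)
    show ?thesis
      unfolding e ann_add ann_scale ann_koszul ann_ann_same by simp
  qed
  finally have "limit_op N m S = (cre N 0 (ann N 0 m) S + ann N 0 (cre N 0 m) S) + h2 * cre N 0 ?Y S + derham N (\<lambda>S. qdil R_Var 0 (X S)) S"
    by (simp add: algebra_simps)
  then show ?thesis
    by (simp add: cre_ann)
qed

text \<open>On sets without 0 the creation term is absent, and the r^0 projection of the equation is
  \<open>one_plus_derham_koszul_inj\<close>. Back substitution then gives the other powers of r and
  finally the sets containing 0.\<close>

lemma limit_op_inj:
  assumes L: "\<And>S. limit_op N m S = 0"
  shows "m S = 0"
proof -
  let ?u = "restr m"
  let ?v = "\<lambda>S. qdil R_Var 0 (?u S)"
  have u: "?u S + derham N (\<lambda>S. qdil R_Var 0 (koszul N ?u S)) S = 0" for S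
  proof (cases "0 \<in> S")
    case True
    have "derham N (\<lambda>S. qdil R_Var 0 (koszul N ?u S)) S = 0"
      using True by (auto simp: derham_def cre_def koszul_restr intro!: sum.neutral)
    then show ?thesis using True by (simp add: restr_def)
  next
    case False
    then show ?thesis
      using L[of S] unfolding limit_op_eq by (simp add: restr_def cre_def)
  qed
  have "?v S + derham N (koszul N ?v) S = 0" for S
  proof -
    have "qdil R_Var 0 (?u S + derham N (\<lambda>S. qdil R_Var 0 (koszul N ?u S)) S) = 0"
      unfolding u by simp
    then show ?thesis
      by (simp add: qdil_add qdil_R_derham qdil_0_idem qdil_R_koszul)
  qed
  then have v: "?v S = 0" for S
    by (rule one_plus_derham_koszul_inj)
  \<comment> \<open>In the equation for \<open>?u\<close> at arbitrary powers of r, the second term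
    depends on \<open>?v\<close> only, so it vanishes.\<close>
  have "qdil R_Var 0 (koszul N ?u S) = 0" for S
    unfolding qdil_R_koszul v by (rule koszul_0)
  then have u0: "?u S = 0" for S
    using u[of S] by (simp add: derham_0)
  then have "?u = (\<lambda>S. 0)"
    by blast
  then have "koszul N ?u S = 0" for S
    by (simp add: koszul_0)
  then show ?thesis
    using L[of S] unfolding limit_op_eq by (simp add: cre_zero derham_0)
qed

section \<open>Nonvanishing of the determinant\<close>

lemma limit_op_add: "limit_op N (\<lambda>S. m S + m' S) S = limit_op N m S + limit_op N m' S"
  by (simp add: limit_op_def vmul_add[abs_def] deriv_op_add)

lemma limit_op_scale: "limit_op N (\<lambda>S. single 0 b * m S) S = single 0 b * limit_op N m S"
  by (simp add: limit_op_def vmul_scale[abs_def] deriv_op_scale)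

lemma limit_op_sum:
  "limit_op N (\<lambda>S. \<Sum>i\<in>I. single 0 (b i) * m i S) S = (\<Sum>i\<in>I. single 0 (b i) * limit_op N (m i) S)"
proof (induction I rule: infinite_finite_induct)
  case (insert i I)
  then show ?case by (simp add: limit_op_add limit_op_scale)
qed (use limit_op_scale[of N 0 "\<lambda>_. 0" S] in simp_all)

text \<open>The Leibniz formula makes the determinant a polynomial in the entries.\<close>

lemma tendsto_det:
  fixes A :: "'c \<Rightarrow> nat \<Rightarrow> nat \<Rightarrow> real"
  assumes "\<And>i j. i < n \<Longrightarrow> j < n \<Longrightarrow> ((\<lambda>t. A t i j) \<longlongrightarrow> L i j) F"
  shows "((\<lambda>t. det (mat n n (\<lambda>(i, j). A t i j))) \<longlongrightarrow> det (mat n n (\<lambda>(i, j). L i j))) F"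
proof -
  have d: "det (mat n n (\<lambda>(i, j). f i j)) =
      (\<Sum>p\<in>{p. p permutes {0..<n}}. signof p * (\<Prod>i = 0..<n. f i (p i)))" for f :: "nat \<Rightarrow> nat \<Rightarrow> real"
    unfolding det_def'[OF mat_carrier]
  proof (intro sum.cong refl arg_cong2[where f = "(*)"] prod.cong)
    fix p i assume "p \<in> {p. p permutes {0..<n}}" "i \<in> {0..<n}"
    then have "i < n" "p i < n"
      using permutes_in_image[of p "{0..<n}" i] by auto
    then show "mat n n (\<lambda>(i, j). f i j) $$ (i, p i) = f i (p i)"
      by simp
  qed
  show ?thesis
    unfolding d
  proof (intro tendsto_sum tendsto_mult tendsto_const tendsto_prod assms)
    fix p i assume "p \<in> {p. p permutes {0..<n}}" "i \<in> {0..<n}"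
    then show "i < n" "p i < n"
      using permutes_in_image[of p "{0..<n}" i] by auto
  qed
qed

lemma eventually_unit_interval: "eventually (\<lambda>q. 0 < q \<and> q < 1) (at_right (0 :: real))"
  unfolding eventually_at_right_field by (intro exI[of _ 1]) simp

context radial_variables
begin

lemma eval_param_image_vec:
  assumes q: "0 < q" "q < 1"
  shows "eval_param q (lookup (image_vec p S) \<mu>) =
    lookup (deriv_op N (1 / 2) (\<lambda>_ _. 0) q (\<lambda>_. 1 / (1 - q)) (\<lambda>_. 0)
      (rmul N 0 (basis_vec (fst p) (snd p) 1)) S) \<mu>"
proof -
  interpret hom: comm_ring_hom "eval_param q"
    by (rule comm_ring_hom_eval_param[OF q])
  have c: "eval_param q (cT i j) = 0" for i j
  proof -
    have "single (C_Var (min i j) (max i j)) (1::nat) \<noteq> 0"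
      by (metis lookup_single_eq lookup_zero zero_neq_one)
    then show ?thesis
      by (simp add: eval_param_def cT_def lookup_single_not_eq eval_coeff_0[OF q] del: One_nat_def)
  qed
  have s: "eval_param q (single 0 b) = eval_coeff q b" for b
    by (simp add: eval_param_def)
  have "eval_param q (lookup (image_vec p S) \<mu>) = lookup (hom.pmap (image_vec p S)) \<mu>"
    by (simp add: hom.lookup_pmap)
  then show ?thesis
    by (simp add: image_vec_def hom.pmap_deriv_op hom.pmap_vmul hom.pmap_basis_vec c s
        eval_coeff_half[OF q] eval_coeff_q[OF q] eval_coeff_bracket[OF q] eval_coeff_q_m_plus[OF q])
qed

text \<open>1/(1-q) tends to 1. The specialised entries agree with the real operator only for 0 < q
  < 1, which suffices for the one-sided limit.\<close>

lemma tendsto_image_vec: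
  "((\<lambda>q. eval_param q (lookup (image_vec p S) \<mu>)) \<longlongrightarrow>
     lookup (limit_op N (basis_vec (fst p) (snd p) 1) S) \<mu>) (at_right 0)"
proof -
  let ?m = "rmul N 0 (basis_vec (fst p) (snd p) 1)"
  have q: "((\<lambda>q. q) \<longlongrightarrow> (0::real)) (at_right 0)"
    by (rule tendsto_ident_at)
  have "((\<lambda>q. 1 / (1 - q)) \<longlongrightarrow> 1 / (1 - (0::real))) (at_right 0)"
    by (intro tendsto_intros q) simp
  then have "mconv (\<lambda>q. deriv_op N (1 / 2) (\<lambda>_ _. 0) q (\<lambda>_. 1 / (1 - q)) (\<lambda>_. 0) ?m)
      (deriv_op N (1 / 2) (\<lambda>_ _. 0) 0 (\<lambda>_. 1) (\<lambda>_. 0) ?m) (at_right 0)"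
    by (intro mconv_deriv_op q tendsto_const) simp
  then have "((\<lambda>q. lookup (deriv_op N (1 / 2) (\<lambda>_ _. 0) q (\<lambda>_. 1 / (1 - q)) (\<lambda>_. 0) ?m S) \<mu>) \<longlongrightarrow>
      lookup (limit_op N (basis_vec (fst p) (snd p) 1) S) \<mu>) (at_right 0)"
    by (simp add: mconv_def limit_op_def)
  moreover have "eventually (\<lambda>q. lookup (deriv_op N (1 / 2) (\<lambda>_ _. 0) q (\<lambda>_. 1 / (1 - q)) (\<lambda>_. 0) ?m S) \<mu> =
      eval_param q (lookup (image_vec p S) \<mu>)) (at_right (0::real))"
    using eventually_unit_interval
    by (rule eventually_mono) (auto simp: eval_param_image_vec)
  ultimately show ?thesis
    by (rule Lim_transform_eventually)
qed

text \<open>Homogeneity is inherited in the limit: outside the block the entries of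
  \<open>image_vec\<close> vanish, so their specialisations are zero for all q near 0 from the
  right.\<close>

lemma limit_op_outside:
  assumes "p \<in> block_index N k" "(S, \<mu>) \<notin> block_index N k"
  shows "lookup (limit_op N (basis_vec (fst p) (snd p) 1) S) \<mu> = 0"
proof -
  have "lookup (image_vec p S) \<mu> = 0"
    using in_block_image_vec[OF assms(1)] assms(2) by (auto simp: in_block_def block_index_def)
  moreover have "eventually (\<lambda>q. eval_param q 0 = 0) (at_right (0::real))"
    using eventually_unit_interval
    by (rule eventually_mono) (auto simp: eval_param_def eval_coeff_0)
  ultimately have "((\<lambda>q. eval_param q (lookup (image_vec p S) \<mu>)) \<longlongrightarrow> 0) (at_right 0)"
    by (simp add: tendsto_eventually)
  then show ?thesis
    using tendsto_unique[OF _ tendsto_image_vec] by (metis trivial_limit_at_right_real)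
qed

text \<open>A kernel vector of the matrix is the coefficient vector of a model m in the block. The
  matrix controls \<open>limit_op N m\<close> only inside the block; \<open>limit_op_outside\<close>
  covers the rest, so \<open>limit_op_inj\<close> forces m, and with it the vector, to be
  zero.\<close>

lemma limit_matrix_det:
  assumes ps: "distinct ps" "set ps = block_index N k"
  shows "det (mat (length ps) (length ps) (\<lambda>(i, j). lookup
    (limit_op N (basis_vec (fst (ps ! j)) (snd (ps ! j)) 1) (fst (ps ! i))) (snd (ps ! i)))) \<noteq> (0 :: real)"
    (is "det ?L \<noteq> 0")
proof
  let ?n = "length ps"
  let ?l = "\<lambda>j. limit_op N (basis_vec (fst (ps ! j)) (snd (ps ! j)) 1)"
  assume "det ?L = 0"
  then obtain v where v: "v \<in> carrier_vec ?n" "v \<noteq> 0\<^sub>v ?n" "?L *\<^sub>v v = 0\<^sub>v ?n"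
    using det_0_iff_vec_prod_zero_field[of ?L ?n] by auto
  define m :: "real model" where
    "m S = (\<Sum>j<?n. single 0 (v $ j) * basis_vec (fst (ps ! j)) (snd (ps ! j)) 1 S)" for S
  have "limit_op N m S = 0" for S
  proof (rule poly_mapping_eqI)
    fix \<mu>
    have l: "lookup (limit_op N m S) \<mu> = (\<Sum>j<?n. v $ j * lookup (?l j S) \<mu>)"
      unfolding m_def limit_op_sum by (simp add: lookup_sum lookup_const_mult)
    show "lookup (limit_op N m S) \<mu> = lookup 0 \<mu>"
    proof (cases "(S, \<mu>) \<in> block_index N k")
      case True
      then obtain i where i: "i < ?n" "ps ! i = (S, \<mu>)"
        using ps(2) by (metis in_set_conv_nth)
      have "(?L *\<^sub>v v) $ i = 0"
        using v(3) i(1) by simp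
      then have "(\<Sum>j<?n. lookup (?l j S) \<mu> * v $ j) = 0"
        using i v(1) by (simp add: scalar_prod_def atLeast0LessThan)
      then show ?thesis
        unfolding l by (simp add: mult.commute)
    next
      case False
      have "lookup (?l j S) \<mu> = 0" if "j < ?n" for j
        using limit_op_outside[OF _ False, of "ps ! j"] nth_mem[OF that] ps(2) by simp
      then show ?thesis
        unfolding l by simp
    qed
  qed
  then have m: "m S = 0" for S
    by (rule limit_op_inj)
  have "v $ i = 0" if i: "i < ?n" for i
  proof -
    have "lookup (m (fst (ps ! i))) (snd (ps ! i)) =
        (\<Sum>j<?n. v $ j * lookup (basis_vec (fst (ps ! j)) (snd (ps ! j)) 1 (fst (ps ! i))) (snd (ps ! i)))"
      unfolding m_def by (simp add: lookup_sum lookup_const_mult)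
    also have "\<dots> = (\<Sum>j<?n. if j = i then v $ j else 0)"
    proof (intro sum.cong refl)
      fix j assume "j \<in> {..<?n}"
      then have "fst (ps ! i) = fst (ps ! j) \<and> snd (ps ! j) = snd (ps ! i) \<longleftrightarrow> j = i"
        using nth_eq_iff_index_eq[OF ps(1), of j i] i by (auto simp: prod_eq_iff)
      then show "v $ j * lookup (basis_vec (fst (ps ! j)) (snd (ps ! j)) 1 (fst (ps ! i))) (snd (ps ! i)) =
          (if j = i then v $ j else 0)"
        by (auto simp: basis_vec_def lookup_single when_def)
    qed
    finally show ?thesis
      using i by (simp add: m)
  qed
  then have "v = 0\<^sub>v ?n"
    using v(1) by (intro eq_vecI) auto
  with v(2) show False ..
qed

text \<open>Ring homomorphisms commute with determinants. If the block determinant were zero, so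
  would be all its specialisations for 0 < q < 1, and hence their limit, the determinant of the
  limit matrix.\<close>

lemma block_det_nonzero: "block_det x ys k \<noteq> 0"
proof
  assume zero: "block_det x ys k = 0"
  obtain ps where ps: "distinct ps" "set ps = block_index N k" and
    det: "block_det x ys k = det (mat (length ps) (length ps)
      (\<lambda>(i, j). lookup (image_vec (ps ! j) (fst (ps ! i))) (snd (ps ! i))))"
    by (rule block_det_eq)
  let ?n = "length ps"
  let ?e = "\<lambda>q i j. eval_param q (lookup (image_vec (ps ! j) (fst (ps ! i))) (snd (ps ! i)))"
  have "((\<lambda>q. det (mat ?n ?n (\<lambda>(i, j). ?e q i j))) \<longlongrightarrow>
      det (mat ?n ?n (\<lambda>(i, j). lookup
    (limit_op N (basis_vec (fst (ps ! j)) (snd (ps ! j)) 1) (fst (ps ! i))) (snd (ps ! i))))) (at_right 0)"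
    by (intro tendsto_det tendsto_image_vec)
  moreover have "eventually (\<lambda>q. det (mat ?n ?n (\<lambda>(i, j). ?e q i j)) = 0) (at_right (0::real))"
    using eventually_unit_interval
  proof (rule eventually_mono)
    fix q :: real assume "0 < q \<and> q < 1"
    then interpret hom: comm_ring_hom "eval_param q"
      by (intro comm_ring_hom_eval_param) auto
    have "mat ?n ?n (\<lambda>(i, j). ?e q i j) = map_mat (eval_param q) (mat ?n ?n
      (\<lambda>(i, j). lookup (image_vec (ps ! j) (fst (ps ! i))) (snd (ps ! i))))"
      by (rule eq_matI) auto
    then show "det (mat ?n ?n (\<lambda>(i, j). ?e q i j)) = 0"
      using zero by (simp add: det)
  qed
  then have "((\<lambda>q. det (mat ?n ?n (\<lambda>(i, j). ?e q i j))) \<longlongrightarrow> 0) (at_right 0)"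
    by (rule tendsto_eventually)
  ultimately show False
    using limit_matrix_det[OF ps] tendsto_unique[OF trivial_limit_at_right_real] by blast
qed

end

theorem proposition5p4:
  fixes x :: 'v and ys :: "'v list" and k :: nat
  assumes "distinct (x # ys)" and "set (x # ys) = UNIV"
  shows "block_det x ys k \<noteq> 0"
proof -
  interpret radial_variables x ys
    using assms by unfold_locales
  show ?thesis
    by (rule block_det_nonzero)
qed

end
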